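(* Let $p$ be an odd prime. Then $$\sum_{k=0}^{(p-1)/2}\frac{\binom{2k}k^3}{(-8)^k(k+1)}\equiv\begin{cases}-24y^2+2p\pmod{p^2}&\text{if } p\equiv1\pmod 4\text{ and } p=x^2+4y^2 \text{ with } x,y\in\mathbb Z,\\ \frac12R_1(p)+p\pmod{p^2}&\text{if } p\equiv 3\pmod 4.\end{cases}$$
   Context: For an odd prime $p$, $R_1(p)=(2p+2-2^{p-1})\binom{(p-1)/2}{[p/4]}^2$, where $[u]$ denotes the greatest integer not exceeding $u$. Congruences modulo $p^r$ between rational numbers with denominators prime to $p$ mean that the difference is $p^r$ times such a rational number. *)

theory Defs
  imports Complex_Main "HOL-Computational_Algebra.Primes"
begin

definition qcong :: "rat \<Rightarrow> rat \<Rightarrow> int \<Rightarrow> bool" where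
  "qcong a b m \<longleftrightarrow> (\<exists>u v :: int. v \<noteq> 0 \<and> coprime v m \<and> a - b = of_int m * (of_int u / of_int v))"

definition R1 :: "nat \<Rightarrow> rat" where
  "R1 p = (2 * of_nat p + 2 - 2 ^ (p - 1)) * of_nat (((p - 1) div 2) choose (p div 4)) ^ 2"

end

theory Submission
  imports Defs "HOL-Number_Theory.Number_Theory" "HOL-Computational_Algebra.Computational_Algebra"
begin

text \<open>
  Write $n = (p-1)/2$. Modulo $p^2$ one has $\binom{2k}{k}^2 \equiv (-16)^k \binom{n}{k}\binom{n+k}{k}$,
  which turns the sum into $\sum_k \binom{2k}{k}\binom{n}{k}\binom{n+k}{k} 2^k/(k+1)$. By Clausen's
  identity for the Legendre polynomial (a comparison of differential equations) and one explicit
  integration, this equals $P^2 - 2n(n+1)(P-2Y)^2$, where $P = [z^n](1-z^2)^n(1-z)^{-p}$ and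
  $Y = [z^{n-1}](1-z^2)^{n-1}(1-z)^{-p}$. Modulo $p^2$ the factor $(1-z)^{-p}$ is
  $1 + p\sum_j z^j/j$ up to degree $p-1$, so $P$ and $Y$ reduce to two binomial sums
  with closed forms, in terms of $C = \binom{n}{[p/4]}$ and an alternating harmonic number $h$.

  If $p \equiv 3 \pmod 4$, the expansion of $2^p$ expresses $h$ by the Fermat quotient of $2$.
  If $p = 4m+1$, one needs in addition $4x^2 \equiv C^2(1-ph) + 2p$. Jacobsthal's theorem identifies
  $2x$ up to sign with $\sum_x \left(\frac{x^3-x}{p}\right)$. Replacing every $x$ by $s = x^p$, which
  satisfies $s^p \equiv s \pmod{p^2}$, the Legendre symbols become
  $s^n\,((1-s^2)^p)^n \equiv s^n\,(1 - s^2 - p\sum_{i<p} s^{2i}/i)^n$, and the sums over $s$ of powers of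
  $s$ are $p-1$ or $0$ modulo $p^2$.
\<close>

section \<open>Alternating sums of binomial coefficients\<close>

text \<open>The constant -8 enters through (-16)^k / (-8)^k = 2^k: Clausen's identity has the
  argument x(1+x), which is 2 at x = 1, so P is the Legendre value P_n(3). The choice n = (p-1)/2
  matters through 4n(n+1) = p^2 - 1: the recurrences see n only in n(n+1), which is -1/4 modulo p^2.
  P and Y are sums of one shape with parameters (N, M) = (n, n) and (n-1, n+1); both have N + M = p
  - 1, hence the common factor (1-z)^(-p). The parity of n decides which of P and Y is divisible by
  p, and this separates the two cases. For p = 1 mod 4 the number h is never evaluated: it enters
  the sum and 4x^2 only through C^2 (1 - ph) and is eliminated between them. The obstacle in the
  congruence for 4x^2 is that Euler's criterion holds modulo p only. Raising to the p-th power turns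
  a congruence modulo p into one modulo p^2, which explains the p-th powers there. Wherever a factor
  p is explicit, closed forms modulo p are enough.\<close>

lemma choose_absorb: "of_nat (Suc b) * of_nat (Suc a choose Suc b) = (of_nat (Suc a) * of_nat (a choose b) :: rat)"
  by (metis Suc_times_binomial_eq of_nat_mult mult.commute)

lemma choose_absorb_comp:
  "(of_nat (Suc a) - of_nat b) * of_nat (Suc a choose b) = (of_nat (Suc a) * of_nat (a choose b) :: rat)"
proof (cases "b \<le> a")
  case True
  have "(Suc a - b) * (Suc a choose b) = Suc a * (a choose b)"
    using binomial_absorb_comp[of "Suc a" b] by simp
  then show ?thesis using True
    by (metis of_nat_diff of_nat_mult le_SucI)
next
  case False
  then show ?thesis by (cases "b = Suc a") (auto simp: binomial_eq_0)
qed

lemma choose_step2: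
  "of_nat (Suc (Suc a) choose Suc b) * of_nat (Suc b) * (of_nat (Suc a) - of_nat b)
     = (of_nat (Suc (Suc a)) * of_nat (Suc a) * of_nat (a choose b) :: rat)"
proof -
  have "of_nat (Suc (Suc a) choose Suc b) * of_nat (Suc b) * (of_nat (Suc a) - of_nat b)
     = (of_nat (Suc b) * of_nat (Suc (Suc a) choose Suc b)) * (of_nat (Suc a) - of_nat b :: rat)"
    by (simp only: ac_simps)
  also have "\<dots> = of_nat (Suc (Suc a)) * ((of_nat (Suc a) - of_nat b) * of_nat (Suc a choose b))"
    by (simp only: choose_absorb ac_simps)
  also have "\<dots> = of_nat (Suc (Suc a)) * (of_nat (Suc a) * of_nat (a choose b))"
    by (simp only: choose_absorb_comp)
  finally show ?thesis by (simp only: ac_simps)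
qed

lemma central_binomial_Suc:
  "of_nat (2 * Suc k choose Suc k) * of_nat (Suc k) = (2 * (2 * of_nat k + 1) * of_nat (2 * k choose k) :: rat)"
proof -
  have "of_nat (2 * Suc k choose Suc k) * of_nat (Suc k) * of_nat (Suc k)
      = (of_nat (2 * Suc k) * (2 * of_nat k + 1) * of_nat (2 * k choose k) :: rat)"
    using choose_step2[of "2 * k" k] by (simp add: algebra_simps)
  then have "of_nat (Suc k) * (of_nat (2 * Suc k choose Suc k) * of_nat (Suc k))
      = of_nat (Suc k) * (2 * (2 * of_nat k + 1) * of_nat (2 * k choose k) :: rat)"
    by (simp add: algebra_simps)
  then show ?thesis by (simp only: mult_cancel_left of_nat_eq_0_iff nat.simps simp_thms)
qed

text \<open>With n = a + 2 and k = b + 2 the weight is k - (n - k), so both absorption rules apply.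
  Pascal's rule then leaves a difference of binomials two places apart, and alternating sums of such
  differences telescope.\<close>

lemma choose_weighted_diff:
  "(2 * of_nat b + 2 - of_nat a) * of_nat (Suc (Suc a) choose Suc (Suc b))
     = (of_nat (Suc (Suc a)) * (of_nat (a choose b) - of_nat (a choose Suc (Suc b))) :: rat)"
proof -
  have 1: "of_nat (Suc (Suc b)) * of_nat (Suc (Suc a) choose Suc (Suc b))
      = (of_nat (Suc (Suc a)) * of_nat (Suc a choose Suc b) :: rat)"
    by (rule choose_absorb)
  have 2: "(of_nat (Suc (Suc a)) - of_nat (Suc (Suc b))) * of_nat (Suc (Suc a) choose Suc (Suc b))
      = (of_nat (Suc (Suc a)) * of_nat (Suc a choose Suc (Suc b)) :: rat)"
    by (rule choose_absorb_comp)
  have "(2 * of_nat b + 2 - of_nat a) * of_nat (Suc (Suc a) choose Suc (Suc b)) =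
     of_nat (Suc (Suc b)) * of_nat (Suc (Suc a) choose Suc (Suc b)) -
     (of_nat (Suc (Suc a)) - of_nat (Suc (Suc b))) * (of_nat (Suc (Suc a) choose Suc (Suc b)) :: rat)"
    by (simp add: algebra_simps del: binomial_Suc_Suc)
  also have "\<dots> = of_nat (Suc (Suc a)) * (of_nat (Suc a choose Suc b) - of_nat (Suc a choose Suc (Suc b)))"
    by (simp only: 1 2 right_diff_distrib)
  finally show ?thesis by simp
qed

lemma choose_weighted_alternating_sum:
  "(\<Sum>i<m. (-1) ^ i * ((2 * of_nat (b + i) + 2 - of_nat a) * of_nat (Suc (Suc a) choose Suc (Suc (b + i)))))
     = (of_nat (Suc (Suc a)) * ((of_nat (a choose b) - of_nat (a choose Suc b))
          - (-1) ^ m * (of_nat (a choose (b + m)) - of_nat (a choose Suc (b + m)))) :: rat)"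
  by (induction m) (simp_all only: choose_weighted_diff, simp_all add: algebra_simps del: binomial_Suc_Suc)

text \<open>This is H_(2r) - H_r. For p = 4r + 1 its 2r terms are exactly those in
  \<open>pcong_two_power\<close>; for p = 4r + 3 that sum has one term more.\<close>

definition alt_harm :: "nat \<Rightarrow> rat" where
  "alt_harm r = (\<Sum>j<2 * r. (-1) ^ j / of_nat (Suc j))"

lemma alt_harm_Suc: "alt_harm (Suc r) = alt_harm r + 1 / (2 * of_nat r + 1) - 1 / (2 * of_nat r + 2)"
  by (simp add: alt_harm_def algebra_simps)

text \<open>Induction on r. Passing from row 2r to row 2r + 2 multiplies by a factor with
  denominator (r+1)^2 - (i+1)^2. Dividing by i + 1 splits this into a sum of the same kind and an
  alternating sum weighted by i + 1, which telescopes and produces the increment of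
  \<open>alt_harm\<close>.\<close>

lemma choose_even_alternating_sum:
  "(\<Sum>i<r. (-1) ^ i * of_nat (2 * r choose (r + Suc i)) / of_nat (Suc i)) = of_nat (2 * r choose r) * alt_harm r"
proof (induction r)
  case 0
  show ?case by (simp add: alt_harm_def)
next
  case (Suc r)
  define c where "c = (of_nat (2 * r choose r) :: rat)"
  define d where "d = (of_nat (2 * Suc r choose Suc r) :: rat)"
  define R where "R = (of_nat r :: rat)"
  have R: "R + 1 > 0" "2 * R + 1 > 0" by (auto simp: R_def add_nonneg_pos)
  have dc: "d * (R + 1) = 2 * (2 * R + 1) * c"
    using central_binomial_Suc[of r] by (simp add: d_def c_def R_def add.commute)
  have tm: "2 * (2 * R + 1) * (of_nat (2 * r choose (r + Suc i)) / of_nat (Suc i)) =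
      (R + 1) * (of_nat (2 * Suc r choose (Suc r + Suc i)) / of_nat (Suc i)) -
       (of_nat (Suc i) * of_nat (2 * Suc r choose (Suc r + Suc i))) / (R + 1)" for i
  proof -
    define I where "I = (of_nat (Suc i) :: rat)"
    define x where "x = (of_nat (2 * r choose (r + Suc i)) :: rat)"
    define y where "y = (of_nat (2 * Suc r choose (Suc r + Suc i)) :: rat)"
    have I: "I > 0" by (simp add: I_def)
    have "y * (R + 1 + I) * (R + 1 - I) = 2 * (R + 1) * (2 * R + 1) * x"
      using choose_step2[of "2 * r" "r + Suc i"]
      by (simp add: x_def y_def R_def I_def algebra_simps del: binomial_Suc_Suc)
    then have "2 * (2 * R + 1) * x * (R + 1) = y * ((R + 1) * (R + 1) - I * I)"
      by (simp add: algebra_simps)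
    then have "2 * (2 * R + 1) * x = (R + 1) * y - I * (I * y) / (R + 1)"
    proof -
      assume "2 * (2 * R + 1) * x * (R + 1) = y * ((R + 1) * (R + 1) - I * I)"
      then have e: "2 * (2 * R + 1) * x * (R + 1) = (R + 1) * ((R + 1) * y) - I * (I * y)"
        by (simp add: algebra_simps)
      have nz: "R + 1 \<noteq> 0" using R by linarith
      have "2 * (2 * R + 1) * x = ((R + 1) * ((R + 1) * y) - I * (I * y)) / (R + 1)"
        using e unfolding nonzero_eq_divide_eq[OF nz] .
      also have "\<dots> = (R + 1) * y - I * (I * y) / (R + 1)"
        by (simp only: diff_divide_distrib nonzero_mult_div_cancel_left[OF nz])
      finally show ?thesis .
    qed
    then have "2 * (2 * R + 1) * x / I = (R + 1) * y / I - (I * y) / (R + 1)"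
      using I by (simp add: diff_divide_distrib)
    then show ?thesis unfolding x_def[symmetric] y_def[symmetric] I_def[symmetric] by simp
  qed
  \<comment> \<open>The weight i + 1 is half of the telescoping weight 2(r+i) + 2 - 2r, whence the
    division by 2. The upper end contributes nothing because its binomials vanish.\<close>
  have "(\<Sum>i<Suc r. (-1) ^ i * (of_nat (Suc i) * of_nat (2 * Suc r choose (Suc r + Suc i))) :: rat) = c"
  proof -
    have "(\<Sum>i<Suc r. (-1) ^ i * (of_nat (Suc i) * of_nat (2 * Suc r choose (Suc r + Suc i))) :: rat)
      = (\<Sum>i<Suc r. (-1) ^ i * ((2 * of_nat (r + i) + 2 - of_nat (2 * r)) *
           of_nat (Suc (Suc (2 * r)) choose Suc (Suc (r + i))))) / 2"
      unfolding sum_divide_distrib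
      by (rule sum.cong) (simp_all add: algebra_simps del: binomial_Suc_Suc)
    also have "\<dots> = (R + 1) * (c - of_nat (2 * r choose Suc r))"
      unfolding choose_weighted_alternating_sum
      by (simp add: c_def R_def binomial_eq_0 add.commute)
    also have "(R + 1) * of_nat (2 * r choose Suc r) = R * c"
    proof (cases r)
      case (Suc r')
      have "of_nat (Suc r) * of_nat (2 * r choose Suc r) = (of_nat (2 * r) - of_nat r) * (of_nat (2 * r choose r) :: rat)"
        using choose_absorb[of r "Suc (2 * r')"] choose_absorb_comp[of "Suc (2 * r')" r] Suc
        by (simp del: binomial_Suc_Suc)
      then show ?thesis by (simp add: c_def R_def algebra_simps)
    qed (simp add: R_def c_def)
    then have "(R + 1) * (c - of_nat (2 * r choose Suc r)) = c" by (simp add: algebra_simps)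
    finally show ?thesis .
  qed
  note alt = this
  define Q where "Q = (\<Sum>i<Suc r. (-1) ^ i * of_nat (2 * Suc r choose (Suc r + Suc i)) / of_nat (Suc i) :: rat)"
  have "2 * (2 * R + 1) * (c * alt_harm r) =
     (\<Sum>i<Suc r. (-1) ^ i * (2 * (2 * R + 1) * (of_nat (2 * r choose (r + Suc i)) / of_nat (Suc i))))"
    unfolding c_def Suc.IH[symmetric]
    by (simp add: sum_distrib_left binomial_eq_0 algebra_simps)
  also have "\<dots> = (\<Sum>i<Suc r. (R + 1) * ((-1) ^ i * of_nat (2 * Suc r choose (Suc r + Suc i)) / of_nat (Suc i)) -
       ((-1) ^ i * (of_nat (Suc i) * of_nat (2 * Suc r choose (Suc r + Suc i)))) / (R + 1))"
    unfolding tm by (rule sum.cong) (simp_all add: algebra_simps del: binomial_Suc_Suc of_nat_Suc)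
  also have "\<dots> = (R + 1) * Q - c / (R + 1)"
    by (simp only: sum_subtractf sum_distrib_left[symmetric] sum_divide_distrib[symmetric] alt Q_def)
  finally have "(R + 1) * Q
     = (R + 1) * (d * (alt_harm r + 1 / ((2 * R + 1) * (2 * R + 2))))"
  proof -
    assume a: "2 * (2 * R + 1) * (c * alt_harm r) = (R + 1) * Q - c / (R + 1)"
    have d: "d = 2 * (2 * R + 1) * c / (R + 1)" using dc R by (simp add: field_simps)
    have "(R + 1) * (d * (alt_harm r + 1 / ((2 * R + 1) * (2 * R + 2)))) = 2 * (2 * R + 1) * (c * alt_harm r) + c / (R + 1)"
    proof -
      have *: "K * (2 * L * c / K * (a + 1 / (L * (2 * K)))) = 2 * L * (c * a) + c / K"
        if "K \<noteq> 0" "L \<noteq> 0" for K L a :: rat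
        using that by (simp add: field_simps)
      have "2 * R + 2 = 2 * (R + 1)" by simp
      then show ?thesis unfolding d using *[of "R + 1" "2 * R + 1"] R by simp
    qed
    with a show ?thesis by auto
  qed
  then have "Q
     = d * (alt_harm r + 1 / ((2 * R + 1) * (2 * R + 2)))" using R by simp
  also have "1 / ((2 * R + 1) * (2 * R + 2)) = 1 / (2 * R + 1) - 1 / (2 * R + 2)"
    using R by (simp add: field_simps)
  also have "alt_harm r + (1 / (2 * R + 1) - 1 / (2 * R + 2)) = alt_harm (Suc r)"
    by (simp add: alt_harm_Suc R_def)
  finally show ?case by (simp only: d_def Q_def)
qed

text \<open>The same induction with (2t+3)^2 - (2i+1)^2 = 4(t+i+2)(t+1-i). Here the telescoping sum
  vanishes, by the symmetry of the middle binomials of row 2t + 1, so the recursion is homogeneous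
  and the value is a pure product.\<close>

lemma choose_odd_alternating_sum:
  "(\<Sum>i<Suc t. (-1) ^ i * of_nat (2 * t + 1 choose (t + 1 + i)) / of_nat (2 * i + 1))
     = (16 ^ Suc t / (8 * of_nat (Suc t) * of_nat (2 * Suc t choose Suc t)) :: rat)"
proof (induction t)
  case 0
  show ?case by (simp add: numeral_2_eq_2)
next
  case (Suc t)
  define A where "A = (\<Sum>i<Suc t. (-1) ^ i * of_nat (2 * t + 1 choose (t + 1 + i)) / of_nat (2 * i + 1) :: rat)"
  define B where "B = (\<Sum>i<Suc (Suc t). (-1) ^ i * of_nat (2 * Suc t + 1 choose (Suc t + 1 + i)) / of_nat (2 * i + 1) :: rat)"
  define T where "T = (of_nat t :: rat)"
  have T: "T \<ge> 0" by (simp add: T_def)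
  have tm: "4 * (2 * T + 3) * (2 * T + 2) * (of_nat (2 * t + 1 choose (t + 1 + i)) / of_nat (2 * i + 1)) =
      (2 * T + 3)\<^sup>2 * (of_nat (2 * Suc t + 1 choose (Suc t + 1 + i)) / of_nat (2 * i + 1)) -
       of_nat (2 * i + 1) * of_nat (2 * Suc t + 1 choose (Suc t + 1 + i))" for i
  proof -
    define I where "I = (of_nat i :: rat)"
    define x where "x = (of_nat (2 * t + 1 choose (t + 1 + i)) :: rat)"
    define y where "y = (of_nat (2 * Suc t + 1 choose (Suc t + 1 + i)) :: rat)"
    have I: "2 * I + 1 > 0" by (simp add: I_def add_nonneg_pos)
    have "y * (T + I + 2) * (T + 1 - I) = (2 * T + 3) * (2 * T + 2) * x"
      using choose_step2[of "2 * t + 1" "t + 1 + i"]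
      by (simp add: x_def y_def T_def I_def algebra_simps del: binomial_Suc_Suc)
    then have "4 * (2 * T + 3) * (2 * T + 2) * x = y * ((2 * T + 3)\<^sup>2 - (2 * I + 1)\<^sup>2)"
      by (simp add: power2_eq_square algebra_simps)
    moreover have "of_nat (2 * i + 1) = 2 * I + 1" by (simp add: I_def)
    ultimately show ?thesis unfolding x_def[symmetric] y_def[symmetric]
      using I by (simp add: field_simps power2_eq_square)
  qed
  have alt: "(\<Sum>i<Suc (Suc t). (-1) ^ i * (of_nat (2 * i + 1) * of_nat (2 * Suc t + 1 choose (Suc t + 1 + i))) :: rat) = 0"
  proof -
    have "(\<Sum>i<Suc (Suc t). (-1) ^ i * (of_nat (2 * i + 1) * of_nat (2 * Suc t + 1 choose (Suc t + 1 + i))) :: rat)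
      = (\<Sum>i<Suc (Suc t). (-1) ^ i * ((2 * of_nat (t + i) + 2 - of_nat (2 * t + 1)) *
           of_nat (Suc (Suc (2 * t + 1)) choose Suc (Suc (t + i)))))"
      by (rule sum.cong) (simp_all add: algebra_simps del: binomial_Suc_Suc)
    also have "\<dots> = 0"
      unfolding choose_weighted_alternating_sum
      using binomial_symmetric[of t "2 * t + 1"] by (simp add: binomial_eq_0 del: binomial_Suc_Suc)
    finally show ?thesis .
  qed
  have "4 * (2 * T + 3) * (2 * T + 2) * A =
     (\<Sum>i<Suc (Suc t). (-1) ^ i * (4 * (2 * T + 3) * (2 * T + 2) * (of_nat (2 * t + 1 choose (t + 1 + i)) / of_nat (2 * i + 1))))"
    unfolding A_def sum.lessThan_Suc[of _ "Suc t"]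
    by (subst (2) binomial_eq_0) (simp_all only: sum_distrib_left, auto intro!: sum.cong simp: algebra_simps)
  also have "\<dots> = (\<Sum>i<Suc (Suc t). (2 * T + 3)\<^sup>2 * ((-1) ^ i * of_nat (2 * Suc t + 1 choose (Suc t + 1 + i)) / of_nat (2 * i + 1)) -
       ((-1) ^ i * (of_nat (2 * i + 1) * of_nat (2 * Suc t + 1 choose (Suc t + 1 + i)))))"
    unfolding tm by (rule sum.cong) (simp_all add: right_diff_distrib mult.left_commute del: binomial_Suc_Suc)
  also have "\<dots> = (2 * T + 3)\<^sup>2 * B"
    by (simp only: sum_subtractf sum_distrib_left[symmetric] B_def alt diff_zero)
  finally have "(2 * T + 3) * (4 * (2 * T + 2) * A) = (2 * T + 3) * ((2 * T + 3) * B)"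
    by (simp only: power2_eq_square ac_simps)
  moreover have T3: "2 * T + 3 \<noteq> 0" using T by linarith
  ultimately have "4 * (2 * T + 2) * A = (2 * T + 3) * B" by (simp only: mult_cancel_left simp_thms)
  then have "B = 4 * (2 * T + 2) / (2 * T + 3) * A"
    using T3 by (simp add: field_simps)
  also have "A = 16 ^ Suc t / (8 * (T + 1) * of_nat (2 * Suc t choose Suc t))"
    using Suc.IH by (simp add: A_def T_def add.commute)
  also have "4 * (2 * T + 2) / (2 * T + 3) * (16 ^ Suc t / (8 * (T + 1) * of_nat (2 * Suc t choose Suc t)))
     = 16 ^ Suc (Suc t) / (8 * (2 * (2 * T + 3) * of_nat (2 * Suc t choose Suc t)))"
    using T by (simp add: divide_simps del: binomial_Suc_Suc)
  also have "2 * (2 * T + 3) * of_nat (2 * Suc t choose Suc t) = of_nat (Suc (Suc t)) * of_nat (2 * Suc (Suc t) choose Suc (Suc t))"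
    using central_binomial_Suc[of "Suc t"] by (simp add: T_def algebra_simps del: binomial_Suc_Suc)
  finally show ?case by (simp only: B_def mult.assoc)
qed

text \<open>Partial fractions of M! / (y(y+1)...(y+M)). By Pascal's rule the sum for M + 1 at y is
  the sum for M at y minus the sum for M at y + 1, and the right-hand side obeys the same
  recursion.\<close>

lemma alternating_choose_partial_fraction:
  fixes y :: rat
  assumes "\<And>j. j \<le> M \<Longrightarrow> y + of_nat j \<noteq> 0"
  shows "(\<Sum>j\<le>M. (-1) ^ j * of_nat (M choose j) / (y + of_nat j)) = fact M / pochhammer y (Suc M)"
  using assms
proof (induction M arbitrary: y)
  case 0
  show ?case by simp
next
  case (Suc M)
  have y: "y \<noteq> 0" "y + 1 + of_nat M \<noteq> 0" using Suc.prems[of 0] Suc.prems[of "Suc M"] by (auto simp: add.assoc add.commute)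
  have nz: "pochhammer (y + 1) M \<noteq> 0"
    using Suc.prems by (auto simp: pochhammer_prod add.assoc) (metis Suc_leI le_SucI of_nat_Suc order_less_imp_le)
  have "(\<Sum>j\<le>Suc M. (-1) ^ j * of_nat (Suc M choose j) / (y + of_nat j)) =
     1 / y + (\<Sum>j\<le>M. - ((-1) ^ j * of_nat (M choose j) / (y + 1 + of_nat j)) - (-1) ^ j * of_nat (M choose Suc j) / (y + of_nat (Suc j)))"
    unfolding sum.atMost_Suc_shift
    by (simp add: add_divide_distrib diff_divide_distrib algebra_simps)
  also have "\<dots> = (1 / y + (\<Sum>j\<le>M. (-1) ^ Suc j * of_nat (M choose Suc j) / (y + of_nat (Suc j))))
      - (\<Sum>j\<le>M. (-1) ^ j * of_nat (M choose j) / (y + 1 + of_nat j))"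
    by (simp add: sum_subtractf sum_negf)
  also have "1 / y + (\<Sum>j\<le>M. (-1) ^ Suc j * of_nat (M choose Suc j) / (y + of_nat (Suc j)))
      = (\<Sum>j\<le>Suc M. (-1) ^ j * of_nat (M choose j) / (y + of_nat j))"
    unfolding sum.atMost_Suc_shift by simp
  also have "\<dots> = (\<Sum>j\<le>M. (-1) ^ j * of_nat (M choose j) / (y + of_nat j))" by simp
  also have "\<dots> = fact M / pochhammer y (Suc M)" by (rule Suc.IH) (use Suc.prems in auto)
  also have "(\<Sum>j\<le>M. (-1) ^ j * of_nat (M choose j) / (y + 1 + of_nat j)) = fact M / pochhammer (y + 1) (Suc M)"
    by (rule Suc.IH) (use Suc.prems[of "Suc _"] in \<open>auto simp: add.assoc\<close>)
  also have "fact M / pochhammer y (Suc M) - fact M / pochhammer (y + 1) (Suc M) = fact (Suc M) / pochhammer y (Suc (Suc M))"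
  proof -
    have 1: "pochhammer y (Suc M) = y * pochhammer (y + 1) M" by (rule pochhammer_rec)
    have 2: "pochhammer (y + 1) (Suc M) = pochhammer (y + 1) M * (y + 1 + of_nat M)" by (rule pochhammer_Suc)
    have 3: "pochhammer y (Suc (Suc M)) = y * (pochhammer (y + 1) M * (y + 1 + of_nat M))" by (simp only: pochhammer_rec[of y "Suc M"] 2)
    have 4: "(fact (Suc M) :: rat) = (of_nat M + 1) * fact M" by (simp add: add.commute)
    show ?thesis unfolding 1 2 3 4 using y nz by (simp add: divide_simps) (simp add: algebra_simps)
  qed
  finally show ?case .
qed

section \<open>Clausen's identity\<close>

lemma choose_Suc_ratio: "of_nat (Suc k) * of_nat (n choose Suc k) = ((of_nat n - of_nat k) * of_nat (n choose k) :: rat)"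
  using choose_absorb[of k "n - 1"] choose_absorb_comp[of "n - 1" k]
  by (cases n) (simp_all del: binomial_Suc_Suc, cases k, simp_all)

definition delannoy_term :: "nat \<Rightarrow> nat \<Rightarrow> rat" where
  "delannoy_term n k = of_nat (n choose k) * of_nat (n + k choose k)"

lemma delannoy_term_0 [simp]: "delannoy_term n 0 = 1"
  by (simp add: delannoy_term_def)

lemma delannoy_term_eq_0: "k > n \<Longrightarrow> delannoy_term n k = 0"
  by (simp add: delannoy_term_def binomial_eq_0)

text \<open>The ratio of consecutive terms depends on n only through n(n+1). This yields Legendre's
  equation, and at n = (p-1)/2 the comparison with squared central binomials.\<close>

lemma delannoy_term_Suc:
  "of_nat (Suc k) ^ 2 * delannoy_term n (Suc k)
     = (of_nat (n * (n + 1)) - of_nat (k * (k + 1))) * delannoy_term n k"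
proof -
  have 2: "of_nat (Suc k) * of_nat (n + Suc k choose Suc k) = ((of_nat n + of_nat k + 1) * of_nat (n + k choose k) :: rat)"
    using choose_absorb[of k "n + k"] by (simp add: algebra_simps del: binomial_Suc_Suc)
  have "of_nat (Suc k) ^ 2 * delannoy_term n (Suc k) =
      (of_nat (Suc k) * of_nat (n choose Suc k)) * (of_nat (Suc k) * of_nat (n + Suc k choose Suc k))"
    by (simp only: power2_eq_square delannoy_term_def ac_simps)
  also have "\<dots> = ((of_nat n - of_nat k) * (of_nat n + of_nat k + 1)) * delannoy_term n k"
    unfolding 2 choose_Suc_ratio[of k n] delannoy_term_def by (simp only: ac_simps)
  also have "(of_nat n - of_nat k) * (of_nat n + of_nat k + 1) = (of_nat (n * (n + 1)) - of_nat (k * (k + 1)) :: rat)"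
    by (simp add: algebra_simps)
  finally show ?thesis .
qed

lemma coeff_sum_monom: "coeff (\<Sum>k\<le>n. monom (f k) k) j = (if j \<le> n then f j else 0)"
  by (simp add: coeff_sum)

lemma poly_sum_monom:
  fixes f :: "nat \<Rightarrow> rat"
  shows "poly (\<Sum>k\<le>n. monom (f k) k) x = (\<Sum>k\<le>n. f k * x ^ k)"
  by (simp add: poly_sum Polynomial.poly_monom)

lemma pderiv_sum_atMost:
  fixes f :: "nat \<Rightarrow> rat poly"
  shows "pderiv (\<Sum>k\<le>n. f k) = (\<Sum>k\<le>n. pderiv (f k))"
  by (induction n) (simp_all add: pderiv_add)

text \<open>
  In the variable $x$ with argument $1 + 2x$, the Legendre polynomial $P_n(1 + 2x)$ has the coefficients
  \<open>delannoy_term n k\<close>, and \<open>Xq\<close> is the polynomial $x(1+x)$.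
\<close>

abbreviation Xq :: "rat poly" where "Xq \<equiv> [:0, 1, 1:]"

lemma coeff_Xq_mult: "coeff (Xq * Q) (Suc k) = coeff Q k + (if k = 0 then 0 else coeff Q (k - 1))"
  by (cases k) simp_all

lemma coeff_pderiv_Xq_pderiv:
  "coeff (pderiv (Xq * pderiv Q)) k = of_nat (Suc k) * (of_nat (Suc k) * coeff Q (Suc k) + of_nat k * coeff Q k)"
  unfolding coeff_pderiv coeff_Xq_mult by (cases k) (simp_all add: coeff_pderiv)

lemma coeff_pderiv_Xq:
  "coeff (pderiv (Xq * R)) k = of_nat (Suc k) * (coeff R k + (if k = 0 then 0 else coeff R (k - 1)))"
  unfolding coeff_pderiv coeff_Xq_mult ..

lemma coeff_linear_mult: "coeff ([:a, b:] * Q) k = a * coeff Q k + b * (if k = 0 then 0 else coeff Q (k - 1))"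
  by (cases k) simp_all

text \<open>Squares of solutions of a second-order equation satisfy a third-order one. With W =
  \<open>Xq * pderiv P\<close> one has W' = N P, Xq U' = 2 P W and Xq (Xq U')' = 2 (N Xq U + W^2);
  one more derivative gives the claim.\<close>

lemma symmetric_square_ODE:
  fixes P :: "rat poly"
  assumes ode: "pderiv (Xq * pderiv P) = [:N:] * P"
  defines "U \<equiv> P * P"
  shows "pderiv (Xq * pderiv (Xq * pderiv U)) = [:2 * N:] * (pderiv Xq * U + 2 * (Xq * pderiv U))"
proof -
  define W where "W = Xq * pderiv P"
  define c where "c = [:N:]"
  have c: "pderiv c = 0" "[:2 * N:] = 2 * c" by (simp_all add: c_def numeral_poly)
  have W: "pderiv W = c * P" using ode by (simp add: W_def c_def)
  have 1: "Xq * pderiv U = P * W + P * W"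
    unfolding U_def pderiv_mult W_def by (simp only: distrib_left ac_simps)
  have "Xq * pderiv (Xq * pderiv U) = (c * (Xq * (P * P)) + W * (Xq * pderiv P)) + (c * (Xq * (P * P)) + W * (Xq * pderiv P))"
    unfolding 1 pderiv_add pderiv_mult W by (simp only: distrib_left ac_simps)
  then have 2: "Xq * pderiv (Xq * pderiv U) = (c * (Xq * U) + W * W) + (c * (Xq * U) + W * W)"
    by (simp only: W_def[symmetric] U_def)
  have "pderiv (c * (Xq * U) + W * W) = c * (P * W + P * W) + c * (pderiv Xq * U) + 2 * (c * (P * W))"
    unfolding pderiv_add pderiv_mult[of W W] pderiv_mult[of c] pderiv_mult[of Xq U] c W 1
    by (simp only: algebra_simps mult_2 mult_zero_right)
  then have "pderiv (Xq * pderiv (Xq * pderiv U)) = 2 * (c * (P * W + P * W) + c * (pderiv Xq * U) + 2 * (c * (P * W)))"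
    unfolding 2 by (simp only: pderiv_add[of "_ + _" "_ + _"] mult_2)
  also have "\<dots> = [:2 * N:] * (pderiv Xq * U + 2 * (Xq * pderiv U))"
    unfolding 1 c by (simp only: algebra_simps mult_2)
  finally show ?thesis .
qed

text \<open>The recurrence is a third-order equation for G in the variable u = x(1+x). The chain
  rule stays inside functions of u, up to one factor 1 + 2x, because (1+2x)^2 = 1 + 4u.\<close>

lemma composed_ODE:
  fixes G :: "rat poly"
  assumes rec: "\<And>k. of_nat (Suc k) ^ 3 * coeff G (Suc k)
      = 2 * (2 * of_nat k + 1) * (N - of_nat (k * (k + 1))) * coeff G k"
  defines "V \<equiv> pcompose G Xq"
  shows "pderiv (Xq * pderiv (Xq * pderiv V)) = [:2 * N:] * (pderiv Xq * V + 2 * (Xq * pderiv V))"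
proof -
  define Z where "Z = [:0, 1 :: rat:]"
  have X: "Xq = pcompose Z Xq" by (simp add: Z_def pcompose_pCons)
  have X': "pderiv Xq = [:1, 2:]" by (simp add: pderiv_pCons)
  have X'2: "[:1, 2:] * [:1, 2:] = pcompose [:1, 4 :: rat:] Xq" by (simp add: pcompose_pCons)
  have X'': "pderiv [:1, 2 :: rat:] = pcompose [:2:] Xq" by (simp add: pderiv_pCons pcompose_pCons)
  define R where "R = [:1, 4:] * pderiv (Z * pderiv G) + [:2:] * (Z * pderiv G)"
  have 1: "Xq * pderiv V = pcompose (Z * pderiv G) Xq * [:1, 2:]"
    unfolding V_def pderiv_pcompose X' pcompose_mult X[symmetric] by (simp only: ac_simps)
  have 2: "pderiv (Xq * pderiv V) = pcompose R Xq"
    unfolding 1 pderiv_mult pderiv_pcompose X' X'' R_def pcompose_add pcompose_mult X'2[symmetric]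
    by (simp only: algebra_simps)
  have 3: "pderiv (Xq * pderiv (Xq * pderiv V)) = pcompose (pderiv (Z * R)) Xq * [:1, 2:]"
    unfolding 2 X'[symmetric] by (subst X) (simp only: pcompose_mult[symmetric] pderiv_pcompose)
  have Zc: "coeff (Z * Q) k = (if k = 0 then 0 else coeff Q (k - 1))" for Q k
    unfolding Z_def coeff_linear_mult by simp
  have "pderiv (Z * R) = [:2 * N:] * (G + 2 * (Z * pderiv G))"
  proof (rule poly_eqI)
    fix k
    have two: "2 * Q = [:2:] * Q" for Q :: "rat poly" by (simp add: numeral_poly)
    have "coeff (pderiv (Z * R)) k = of_nat (Suc k) * coeff R k"
      by (simp add: coeff_pderiv Zc)
    also have "coeff R k = of_nat (Suc k) ^ 2 * coeff G (Suc k) + (4 * of_nat k ^ 2 + 2 * of_nat k) * coeff G k"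
      unfolding R_def coeff_add coeff_linear_mult
      by (cases k) (simp_all add: coeff_pderiv Zc power2_eq_square algebra_simps)
    also have "of_nat (Suc k) * (of_nat (Suc k) ^ 2 * coeff G (Suc k) + (4 * of_nat k ^ 2 + 2 * of_nat k) * coeff G k)
       = of_nat (Suc k) ^ 3 * coeff G (Suc k) + of_nat (Suc k) * (4 * of_nat k ^ 2 + 2 * of_nat k) * coeff G k"
      by (simp add: power2_eq_square power3_eq_cube algebra_simps del: of_nat_Suc)
    also have "\<dots> = 2 * N * (1 + 2 * of_nat k) * coeff G k"
      unfolding rec by (simp add: algebra_simps power2_eq_square)
    also have "\<dots> = coeff ([:2 * N:] * (G + 2 * (Z * pderiv G))) k"
      unfolding two by (cases k) (simp_all add: Zc coeff_pderiv algebra_simps)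
    finally show "coeff (pderiv (Z * R)) k = coeff ([:2 * N:] * (G + 2 * (Z * pderiv G))) k" .
  qed
  then have "pderiv (Xq * pderiv (Xq * pderiv V)) =
     pcompose ([:2 * N:] * (G + 2 * (Z * pderiv G))) Xq * [:1, 2:]" by (simp only: 3)
  also have "\<dots> = [:2 * N:] * ([:1, 2:] * V + 2 * (pcompose (Z * pderiv G) Xq * [:1, 2:]))"
  proof -
    define c where "c = [:2 * N:]"
    have c: "pcompose c Xq = c" by (simp add: c_def)
    show ?thesis
      unfolding c_def[symmetric] unfolding mult_2 pcompose_mult[of c] pcompose_add c V_def
      by (simp only: algebra_simps)
  qed
  finally show ?thesis unfolding 1 X' .
qed

text \<open>The equation at degree j reads (j+1)^3 times coefficient j + 1 equals a combination of
  lower coefficients, so the constant term determines a polynomial solution.\<close>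

lemma symmetric_square_ODE_unique:
  fixes Q :: "rat poly"
  assumes "coeff Q 0 = 0"
    and ode: "pderiv (Xq * pderiv (Xq * pderiv Q)) = [:M:] * (pderiv Xq * Q + 2 * (Xq * pderiv Q))"
  shows "Q = 0"
proof -
  have "coeff Q k = 0" for k
  proof (induction k rule: less_induct)
    case (less k)
    show ?case
    proof (cases k)
      case 0
      then show ?thesis using assms(1) by simp
    next
      case (Suc j)
      have z: "coeff Q j = 0" "coeff Q (j - 1) = 0" using less.IH Suc by auto
      have X': "pderiv Xq = [:1, 2:]" by (simp add: pderiv_pCons)
      have lhs: "coeff (pderiv (Xq * pderiv (Xq * pderiv Q))) j = of_nat (Suc j) ^ 3 * coeff Q (Suc j)"
        unfolding coeff_pderiv_Xq[of "pderiv (Xq * pderiv Q)"] unfolding coeff_pderiv_Xq_pderiv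
        using z by (cases j) (simp_all add: power3_eq_cube)
      have z2: "coeff (Xq * pderiv Q) j = 0"
      proof (cases j)
        case (Suc i)
        show ?thesis using z less.IH[of i] unfolding Suc coeff_Xq_mult \<open>k = Suc j\<close> by (cases i) (simp_all add: coeff_pderiv)
      qed simp
      have "coeff (pderiv Xq * Q + 2 * (Xq * pderiv Q)) j
          = coeff ([:1, 2:] * Q) j + (coeff (Xq * pderiv Q) j + coeff (Xq * pderiv Q) j)"
        by (simp only: X' mult_2 coeff_add)
      also have "\<dots> = 0" unfolding z2 coeff_linear_mult using z by simp
      finally have z3: "coeff (pderiv Xq * Q + 2 * (Xq * pderiv Q)) j = 0" .
      have "coeff ([:M:] * S) j = M * coeff S j" for S by simp
      then have "coeff ([:M:] * (pderiv Xq * Q + 2 * (Xq * pderiv Q))) j = 0"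
        by (simp only: z3 mult_zero_right)
      then have "of_nat (Suc j) ^ 3 * coeff Q (Suc j) = 0" using lhs by (simp only: ode)
      then show ?thesis unfolding Suc by (simp del: of_nat_Suc)
    qed
  qed
  then show ?thesis by (simp add: poly_eq_iff)
qed

text \<open>The first part is Legendre's equation in the shifted variable. For the second, both
  sides satisfy the equation of the symmetric square and have constant term 1.\<close>

lemma clausen_legendre:
  fixes n :: nat
  defines "N \<equiv> of_nat (n * (n + 1)) :: rat"
  defines "P \<equiv> (\<Sum>k\<le>n. monom (delannoy_term n k) k)"
    and "G \<equiv> (\<Sum>k\<le>n. monom (of_nat (2 * k choose k) * delannoy_term n k) k)"
  shows "pderiv (Xq * pderiv P) = [:N:] * P" and "P * P = pcompose G Xq"
proof -
  have P: "coeff P k = delannoy_term n k" for k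
    unfolding P_def coeff_sum_monom using delannoy_term_eq_0[of n k] by auto
  have G: "coeff G k = of_nat (2 * k choose k) * delannoy_term n k" for k
    unfolding G_def coeff_sum_monom using delannoy_term_eq_0[of n k] by auto
  show ode: "pderiv (Xq * pderiv P) = [:N:] * P"
  proof (rule poly_eqI)
    fix k
    have "coeff (pderiv (Xq * pderiv P)) k = of_nat (Suc k) ^ 2 * delannoy_term n (Suc k) + of_nat (k * (k + 1)) * delannoy_term n k"
      unfolding coeff_pderiv_Xq_pderiv P by (simp add: power2_eq_square algebra_simps)
    also have "\<dots> = N * delannoy_term n k"
      unfolding delannoy_term_Suc N_def by (simp add: algebra_simps)
    finally show "coeff (pderiv (Xq * pderiv P)) k = coeff ([:N:] * P) k" by (simp add: P)
  qed
  have rec: "of_nat (Suc k) ^ 3 * coeff G (Suc k)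
      = 2 * (2 * of_nat k + 1) * (N - of_nat (k * (k + 1))) * coeff G k" for k
  proof -
    have "of_nat (Suc k) ^ 3 * coeff G (Suc k) =
      (of_nat (2 * Suc k choose Suc k) * of_nat (Suc k)) * (of_nat (Suc k) ^ 2 * delannoy_term n (Suc k))"
      unfolding G by (simp only: power2_eq_square power3_eq_cube ac_simps)
    also have "\<dots> = 2 * (2 * of_nat k + 1) * (N - of_nat (k * (k + 1))) * coeff G k"
      unfolding G central_binomial_Suc delannoy_term_Suc N_def by (simp only: ac_simps)
    finally show ?thesis .
  qed
  define Q where "Q = P * P - pcompose G Xq"
  have "coeff Q 0 = 0" unfolding Q_def by (simp add: coeff_mult P coeff_pcompose_0 poly_0_coeff_0 G)
  moreover have "pderiv (Xq * pderiv (Xq * pderiv Q)) = [:2 * N:] * (pderiv Xq * Q + 2 * (Xq * pderiv Q))"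
    using symmetric_square_ODE[OF ode] composed_ODE[OF rec]
    unfolding Q_def by (simp only: pderiv_diff right_diff_distrib) (simp only: algebra_simps)
  ultimately have "Q = 0" by (rule symmetric_square_ODE_unique)
  then show "P * P = pcompose G Xq" by (simp add: Q_def)
qed

text \<open>Division by k + 1 is integration in u = x(1+x). The antiderivative of Xq' P^2 is
  obtained twice, termwise as \<open>K\<close> composed with \<open>Xq\<close> and in closed form as
  \<open>H\<close>; the two are compared at x = 1.\<close>

lemma delannoy_catalan_sum:
  fixes n' :: nat
  defines "n \<equiv> Suc n'"
  defines "N \<equiv> of_nat (n * (n + 1)) :: rat"
    and "P \<equiv> (\<Sum>k\<le>n. delannoy_term n k)"
    and "Y \<equiv> (\<Sum>k\<le>n'. of_nat (n' choose k) * of_nat (n' + 2 + k choose k))"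
  shows "(\<Sum>k\<le>n. of_nat (2 * k choose k) * delannoy_term n k * 2 ^ k / of_nat (k + 1))
      = P ^ 2 - 2 * N * (P - 2 * Y) ^ 2"
proof -
  define Pq where "Pq = (\<Sum>k\<le>n. monom (delannoy_term n k) k)"
  define a where "a = (\<lambda>k. of_nat (2 * k choose k) * delannoy_term n k)"
  define G where "G = (\<Sum>k\<le>n. monom (a k) k)"
  define K where "K = (\<Sum>k\<le>n. monom (a k / of_nat (k + 1)) (Suc k))"
  have ode: "pderiv (Xq * pderiv Pq) = [:N:] * Pq"
    unfolding Pq_def N_def by (rule clausen_legendre)
  have square: "Pq * Pq = pcompose G Xq"
    unfolding Pq_def G_def a_def by (rule clausen_legendre)
  have N: "N \<noteq> 0" unfolding N_def n_def by (simp only: of_nat_eq_0_iff) simp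
  define W where "W = Xq * pderiv Pq"
  \<comment> \<open>Differentiating Xq P^2 leaves the excess 2 Xq P P' = 2 P W. Since W' = N P, this
    is the derivative of W^2 / N, which is therefore subtracted.\<close>
  define H where "H = Xq * (Pq * Pq) - [:1 / N:] * (W * W)"
  have "pderiv H = pderiv Xq * (Pq * Pq)"
  proof -
    have c: "pderiv [:1 / N:] = 0" "[:1 / N:] * [:N:] = 1" using N by (simp_all add: pderiv_pCons)
    have "pderiv H = (Xq * (Pq * pderiv Pq + Pq * pderiv Pq) + Pq * Pq * pderiv Xq)
        - [:1 / N:] * (W * ([:N:] * Pq) + W * ([:N:] * Pq))"
      unfolding H_def pderiv_diff pderiv_mult[of Xq "Pq * Pq"] pderiv_mult[of Pq Pq]
        pderiv_mult[of "[:1/N:]"] pderiv_mult[of W W] c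
      using ode by (simp add: W_def)
    also have "[:1 / N:] * (W * ([:N:] * Pq) + W * ([:N:] * Pq)) = ([:1 / N:] * [:N:]) * (W * Pq + W * Pq)"
      by (simp only: algebra_simps)
    also have "Xq * (Pq * pderiv Pq + Pq * pderiv Pq) = W * Pq + W * Pq"
      unfolding W_def by (simp only: algebra_simps)
    finally show ?thesis unfolding c by (simp only: algebra_simps)
  qed
  moreover have "pderiv (pcompose K Xq) = pderiv Xq * (Pq * Pq)"
  proof -
    have "pderiv K = G" unfolding K_def G_def pderiv_sum_atMost pderiv_monom
      by (rule sum.cong) (simp_all add: field_simps)
    then show ?thesis by (simp only: pderiv_pcompose square mult.commute)
  qed
  ultimately have "pderiv (pcompose K Xq - H) = 0" by (simp only: pderiv_diff diff_self)
  then have "degree (pcompose K Xq - H) = 0" by (simp only: pderiv_eq_0_iff)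
  then obtain c where c: "pcompose K Xq - H = [:c:]" by (rule degree_eq_zeroE)
  have "poly (pcompose K Xq - H) 0 = 0"
    by (simp add: poly_pcompose H_def W_def K_def poly_sum Polynomial.poly_monom)
  then have "pcompose K Xq = H" unfolding c using c by simp
  then have "poly (pcompose K Xq) 1 = poly H 1" by simp
  \<comment> \<open>At x = 1 the inner polynomial has the value 2, whence 2^k; the extra factor 2 is
    the degree raised by integration.\<close>
  moreover have "poly (pcompose K Xq) 1 = 2 * (\<Sum>k\<le>n. a k * 2 ^ k / of_nat (k + 1))"
    unfolding poly_pcompose K_def poly_sum Polynomial.poly_monom sum_distrib_left
    by (intro sum.cong) simp_all
  moreover have P: "poly Pq 1 = P" unfolding Pq_def poly_sum_monom P_def by simp
  define D where "D = poly (pderiv Pq) 1"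
  have "poly H 1 = 2 * P ^ 2 - (2 * D) ^ 2 / N"
    by (simp add: H_def W_def P D_def power2_eq_square)
  moreover have "D = N * (P - 2 * Y)"
  proof -
    define Z where "Z = [:0, 1 :: rat:]"
    define Yq where "Yq = (\<Sum>k\<le>n'. monom (of_nat (n' choose k) * of_nat (n' + 2 + k choose k)) k :: rat poly)"
    have Pc: "coeff Pq k = delannoy_term n k" for k
      unfolding Pq_def coeff_sum_monom using delannoy_term_eq_0[of n k] by auto
    \<comment> \<open>Together with Legendre's equation this gives two linear relations at x = 1,
      P'' + D = N Y and 2 P'' + 3 D = N P, from which P'' is eliminated.\<close>
    have "pderiv (Z * pderiv Pq) = [:N:] * Yq"
    proof (rule poly_eqI)
      fix k
      have 1: "of_nat (Suc k) * of_nat (n choose Suc k) = (of_nat n * of_nat (n' choose k) :: rat)"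
        unfolding n_def by (rule choose_absorb)
      have 2: "of_nat (Suc k) * of_nat (n + Suc k choose Suc k) = (of_nat (n + 1) * of_nat (n' + 2 + k choose k) :: rat)"
        using choose_Suc_ratio[of k "n + Suc k"] by (simp add: n_def)
      have "coeff (pderiv (Z * pderiv Pq)) k = of_nat (Suc k) ^ 2 * delannoy_term n (Suc k)"
        unfolding coeff_pderiv Z_def by (simp add: coeff_pderiv Pc power2_eq_square)
      also have "\<dots> = (of_nat (Suc k) * of_nat (n choose Suc k)) * (of_nat (Suc k) * of_nat (n + Suc k choose Suc k))"
        by (simp only: delannoy_term_def power2_eq_square ac_simps)
      also have "\<dots> = N * (of_nat (n' choose k) * of_nat (n' + 2 + k choose k))"
        unfolding 1 2 N_def of_nat_mult by (simp only: ac_simps)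
      also have "\<dots> = coeff ([:N:] * Yq) k"
        unfolding Yq_def by (simp add: coeff_sum_monom binomial_eq_0)
      finally show "coeff (pderiv (Z * pderiv Pq)) k = coeff ([:N:] * Yq) k" .
    qed
    then have "poly (pderiv (Z * pderiv Pq)) 1 = N * poly Yq 1" by simp
    moreover have "poly Yq 1 = Y" unfolding Yq_def poly_sum_monom Y_def by simp
    moreover have "poly (pderiv (Z * pderiv Pq)) 1 = poly (pderiv (pderiv Pq)) 1 + D"
      by (simp add: pderiv_mult Z_def pderiv_pCons D_def)
    moreover have "poly (pderiv (Xq * pderiv Pq)) 1 = 2 * poly (pderiv (pderiv Pq)) 1 + 3 * D"
      unfolding pderiv_mult[of Xq] by (simp add: pderiv_pCons D_def)
    moreover have "poly (pderiv (Xq * pderiv Pq)) 1 = N * P" using ode P by simp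
    ultimately show ?thesis by (simp add: algebra_simps)
  qed
  ultimately have "2 * (\<Sum>k\<le>n. a k * 2 ^ k / of_nat (k + 1)) = 2 * P ^ 2 - (2 * (N * (P - 2 * Y))) ^ 2 / N" by simp
  also have "(2 * (N * (P - 2 * Y))) ^ 2 / N = 4 * N * (P - 2 * Y) ^ 2"
    using N by (simp add: power2_eq_square)
  finally show ?thesis by (simp add: a_def)
qed

section \<open>Congruences between p-integral rationals\<close>

locale odd_prime =
  fixes p :: nat
  assumes prime_p: "prime p" and odd_p: "odd p"
begin

text \<open>The localization of the integers at the prime p, a subring of the rationals, and not the
  p-adic completion.\<close>

definition Zp :: "rat set" where
  "Zp = {q. \<exists>a b :: int. \<not> int p dvd b \<and> q = of_int a / of_int b}"

text \<open>Since 1 / 0 = 0 lies in \<open>Zp\<close>, zero has to be excluded explicitly.\<close>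

definition Zp_unit :: "rat \<Rightarrow> bool" where
  "Zp_unit u \<longleftrightarrow> u \<in> Zp \<and> u \<noteq> 0 \<and> 1 / u \<in> Zp"

definition pcong :: "nat \<Rightarrow> rat \<Rightarrow> rat \<Rightarrow> bool" where
  "pcong k a b \<longleftrightarrow> (\<exists>w\<in>Zp. a - b = of_nat p ^ k * w)"

lemma p_gt_2: "p > 2"
  using prime_p odd_p by (metis prime_ge_2_nat dvd_refl le_neq_implies_less)

lemma prime_int_p: "prime (int p)"
  using prime_p by simp

lemma Zp_I: "\<not> int p dvd b \<Longrightarrow> of_int a / of_int b \<in> Zp"
  unfolding Zp_def by blast

lemma Zp_of_int [simp]: "of_int a \<in> Zp"
  using Zp_I[of 1 a] p_gt_2 by simp

lemma Zp_of_nat [simp]: "of_nat a \<in> Zp"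
  using Zp_of_int[of "int a"] by simp

lemma Zp_numeral [simp]: "numeral a \<in> Zp" "0 \<in> Zp" "1 \<in> Zp"
  using Zp_of_int[of "numeral a"] Zp_of_int[of 0] Zp_of_int[of 1] by simp_all

lemma Zp_add [intro]: "a \<in> Zp \<Longrightarrow> b \<in> Zp \<Longrightarrow> a + b \<in> Zp"
proof -
  assume "a \<in> Zp" "b \<in> Zp"
  then obtain x y u v :: int where *: "\<not> int p dvd y" "a = of_int x / of_int y"
    "\<not> int p dvd v" "b = of_int u / of_int v" unfolding Zp_def by blast
  then have "y \<noteq> 0" "v \<noteq> 0" by auto
  then have "a + b = of_int (x * v + u * y) / of_int (y * v)"
    using * add_frac_eq[of "of_int y" "of_int v" "of_int x" "of_int u :: rat"] by simp
  moreover have "\<not> int p dvd y * v" using * prime_int_p prime_dvd_mult_iff by blast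
  ultimately show ?thesis unfolding Zp_def by blast
qed

lemma Zp_mult [intro]: "a \<in> Zp \<Longrightarrow> b \<in> Zp \<Longrightarrow> a * b \<in> Zp"
proof -
  assume "a \<in> Zp" "b \<in> Zp"
  then obtain x y u v :: int where *: "\<not> int p dvd y" "a = of_int x / of_int y"
    "\<not> int p dvd v" "b = of_int u / of_int v" unfolding Zp_def by blast
  then have "a * b = of_int (x * u) / of_int (y * v)" by simp
  moreover have "\<not> int p dvd y * v" using * prime_int_p prime_dvd_mult_iff by blast
  ultimately show ?thesis unfolding Zp_def by blast
qed

lemma Zp_uminus [intro]: "a \<in> Zp \<Longrightarrow> - a \<in> Zp"
  using Zp_mult[OF Zp_of_int[of "-1"]] by simp

lemma Zp_diff [intro]: "a \<in> Zp \<Longrightarrow> b \<in> Zp \<Longrightarrow> a - b \<in> Zp"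
  using Zp_add[of a "- b"] Zp_uminus[of b] by simp

lemma Zp_power [intro]: "a \<in> Zp \<Longrightarrow> a ^ k \<in> Zp"
  by (induction k) auto

lemma Zp_sum [intro]: "(\<And>x. x \<in> I \<Longrightarrow> f x \<in> Zp) \<Longrightarrow> sum f I \<in> Zp"
  by (induction I rule: infinite_finite_induct) auto

lemma Zp_divide [intro]: "a \<in> Zp \<Longrightarrow> Zp_unit b \<Longrightarrow> a / b \<in> Zp"
  using Zp_mult[of a "1 / b"] by (simp add: Zp_unit_def)

lemma Zp_unit_of_nat: "\<not> p dvd b \<Longrightarrow> Zp_unit (of_nat b)"
proof -
  assume b: "\<not> p dvd b"
  then have "\<not> int p dvd int b" by simp
  then have "(1 :: rat) / of_nat b \<in> Zp" using Zp_I[of "int b" 1] by simp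
  moreover have "b \<noteq> 0" using b by (metis dvd_0_right)
  ultimately show ?thesis by (simp add: Zp_unit_def)
qed

lemma Zp_unit_small: "0 < b \<Longrightarrow> b < p \<Longrightarrow> Zp_unit (of_nat b)"
  using Zp_unit_of_nat nat_dvd_not_less by blast

lemma Zp_unit_mult [intro]: "Zp_unit a \<Longrightarrow> Zp_unit b \<Longrightarrow> Zp_unit (a * b)"
  using Zp_mult[of "1 / a" "1 / b"] by (auto simp: Zp_unit_def)

lemma Zp_unit_power [intro]: "Zp_unit a \<Longrightarrow> Zp_unit (a ^ k)"
proof (induction k)
  case 0
  show ?case by (simp add: Zp_unit_def)
qed auto

lemma Zp_unit_uminus [intro]: "Zp_unit a \<Longrightarrow> Zp_unit (- a)"
  using Zp_uminus[of "1 / a"] by (auto simp: Zp_unit_def)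

lemma Zp_unit_in [intro]: "Zp_unit a \<Longrightarrow> a \<in> Zp"
  by (simp add: Zp_unit_def)

lemma Zp_unit_nz: "Zp_unit a \<Longrightarrow> a \<noteq> 0"
  by (simp add: Zp_unit_def)

lemma Zp_unit_simps [simp]: "Zp_unit 1" "Zp_unit 2" "Zp_unit 4" "Zp_unit 8" "Zp_unit 16"
proof -
  have 2: "Zp_unit 2" using Zp_unit_small[of 2] p_gt_2 by simp
  show "Zp_unit 1" by (simp add: Zp_unit_def)
  show "Zp_unit 2" "Zp_unit 4" "Zp_unit 8" "Zp_unit 16"
    using 2 Zp_unit_power[OF 2, of 2] Zp_unit_power[OF 2, of 3] Zp_unit_power[OF 2, of 4] by simp_all
qed

lemma Zp_unit_choose: "k \<le> b \<Longrightarrow> b < p \<Longrightarrow> Zp_unit (of_nat (b choose k))"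
proof (rule Zp_unit_of_nat)
  assume kb: "k \<le> b" "b < p"
  have "fact k * fact (b - k) * (b choose k) = fact b" using kb binomial_fact_lemma by blast
  moreover have "\<not> p dvd fact b" using kb prime_p by (simp add: prime_dvd_fact_iff)
  ultimately show "\<not> p dvd (b choose k)" by (metis dvd_mult)
qed

lemma pcongI: "a - b = of_nat p ^ k * w \<Longrightarrow> w \<in> Zp \<Longrightarrow> pcong k a b"
  unfolding pcong_def by blast

lemma pcongE: "pcong k a b \<Longrightarrow> (\<And>w. w \<in> Zp \<Longrightarrow> a = b + of_nat p ^ k * w \<Longrightarrow> P) \<Longrightarrow> P"
  unfolding pcong_def by (metis add.commute diff_add_cancel)

lemma pcong_refl [simp]: "pcong k a a"
  by (rule pcongI[of _ _ _ 0]) simp_all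

lemma pcong_sym: "pcong k a b \<Longrightarrow> pcong k b a"
  by (erule pcongE) (rule pcongI[OF _ Zp_uminus], auto)

lemma pcong_trans [trans]: "pcong k a b \<Longrightarrow> pcong k b c \<Longrightarrow> pcong k a c"
proof (elim pcongE)
  fix v w assume "v \<in> Zp" "w \<in> Zp" "a = b + of_nat p ^ k * v" "b = c + of_nat p ^ k * w"
  then show ?thesis by (intro pcongI[OF _ Zp_add[of v w]]) (simp_all add: algebra_simps)
qed

lemma pcong_eq_trans [trans]: "pcong k a b \<Longrightarrow> b = c \<Longrightarrow> pcong k a c"
  by simp

lemma eq_pcong_trans [trans]: "a = b \<Longrightarrow> pcong k b c \<Longrightarrow> pcong k a c"
  by simp

lemma pcong_add: "pcong k a b \<Longrightarrow> pcong k c d \<Longrightarrow> pcong k (a + c) (b + d)"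
proof (elim pcongE)
  fix v w assume "v \<in> Zp" "w \<in> Zp" "a = b + of_nat p ^ k * v" "c = d + of_nat p ^ k * w"
  then show ?thesis by (intro pcongI[OF _ Zp_add[of v w]]) (simp_all add: algebra_simps)
qed

lemma pcong_uminus: "pcong k a b \<Longrightarrow> pcong k (- a) (- b)"
  by (erule pcongE) (rule pcongI[OF _ Zp_uminus], auto)

lemma pcong_diff: "pcong k a b \<Longrightarrow> pcong k c d \<Longrightarrow> pcong k (a - c) (b - d)"
  using pcong_add[of k a b "- c" "- d"] pcong_uminus[of k c d] by simp

lemma pcong_mult_left: "pcong k a b \<Longrightarrow> c \<in> Zp \<Longrightarrow> pcong k (c * a) (c * b)"
proof (elim pcongE)
  fix w assume "c \<in> Zp" "w \<in> Zp" "a = b + of_nat p ^ k * w"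
  then show ?thesis by (intro pcongI[OF _ Zp_mult[of c w]]) (simp_all add: algebra_simps)
qed

lemma pcong_mult: "pcong k a b \<Longrightarrow> pcong k c d \<Longrightarrow> a \<in> Zp \<Longrightarrow> d \<in> Zp \<Longrightarrow> pcong k (a * c) (b * d)"
  using pcong_trans[OF pcong_mult_left[of k c d a]] pcong_mult_left[of k a b d] by (simp add: mult.commute)

lemma pcong_mem: "pcong k a b \<Longrightarrow> b \<in> Zp \<Longrightarrow> a \<in> Zp"
  by (erule pcongE) (simp add: Zp_add Zp_mult Zp_power)

lemma pcong_power: "pcong k a b \<Longrightarrow> b \<in> Zp \<Longrightarrow> pcong k (a ^ m) (b ^ m)"
  by (induction m) (auto intro!: pcong_mult dest: pcong_mem)

lemma pcong_sum: "(\<And>x. x \<in> I \<Longrightarrow> pcong k (f x) (g x)) \<Longrightarrow> pcong k (sum f I) (sum g I)"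
  by (induction I rule: infinite_finite_induct) (auto intro: pcong_add)

text \<open>An explicit factor p gains one power, so whatever it multiplies has to be known modulo p
  only.\<close>

lemma pcong_lift: "pcong 1 a b \<Longrightarrow> pcong 2 (of_nat p * a) (of_nat p * b)"
  by (erule pcongE) (rule pcongI, simp_all add: algebra_simps power2_eq_square)

lemma pcong_weaken: "pcong 2 a b \<Longrightarrow> pcong 1 a b"
  by (erule pcongE) (rule pcongI[OF _ Zp_mult[OF Zp_of_nat[of p]]], simp_all add: power2_eq_square)

lemma pcong_divide: "pcong k a b \<Longrightarrow> Zp_unit c \<Longrightarrow> pcong k (a / c) (b / c)"
  using pcong_mult_left[of k a b "1 / c"] by (simp add: Zp_unit_def)

lemma pcong_inverse: "pcong k a b \<Longrightarrow> Zp_unit a \<Longrightarrow> Zp_unit b \<Longrightarrow> pcong k (1 / a) (1 / b)"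
proof (elim pcongE)
  fix w assume *: "Zp_unit a" "Zp_unit b" "w \<in> Zp" and ab: "a = b + of_nat p ^ k * w"
  have "1 / a - 1 / b = (b - a) / (a * b)"
    using diff_frac_eq[OF Zp_unit_nz[OF *(1)] Zp_unit_nz[OF *(2)], of 1 1] by simp
  also have "\<dots> = of_nat p ^ k * (- w / (a * b))" unfolding ab by simp
  finally show ?thesis by (rule pcongI) (use * in auto)
qed

lemma pcong_cancel: "pcong k (c * a) (c * b) \<Longrightarrow> Zp_unit c \<Longrightarrow> pcong k a b"
  using pcong_divide[of k "c * a" "c * b" c] Zp_unit_nz by simp

lemma pcong_of_int: "[a = b] (mod (int p ^ k)) \<Longrightarrow> pcong k (of_int a) (of_int b)"
proof -
  assume "[a = b] (mod (int p ^ k))"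
  then obtain t where "a - b = int p ^ k * t" unfolding cong_iff_dvd_diff dvd_def by blast
  then have "of_int a - of_int b = (of_nat p ^ k * of_int t :: rat)"
    by (simp flip: of_int_diff)
  then show ?thesis by (rule pcongI) simp
qed

lemma qcong_iff_pcong: "qcong a b (int p ^ 2) \<longleftrightarrow> pcong 2 a b"
proof -
  have "coprime v (int p) \<longleftrightarrow> \<not> int p dvd v" for v
    using prime_int_p by (metis coprime_commute prime_imp_coprime coprime_absorb_left not_prime_unit)
  then have *: "v \<noteq> 0 \<and> coprime v (int p ^ 2) \<longleftrightarrow> \<not> int p dvd v" for v
    by auto
  have "qcong a b (int p ^ 2) \<longleftrightarrow>
      (\<exists>u v. \<not> int p dvd v \<and> a - b = of_nat p ^ 2 * (of_int u / of_int v))"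
    unfolding qcong_def by (simp only: conj_assoc[symmetric] *) simp
  then show ?thesis unfolding pcong_def Zp_def by blast
qed

section \<open>Binomial coefficients modulo p and p^2, and the Fermat quotient of 2\<close>

lemma Fermat_p: "\<not> p dvd a \<Longrightarrow> pcong 1 (of_nat a ^ (p - 1)) 1"
  using fermat_theorem[OF prime_p, of a] pcong_of_int[of "int a ^ (p - 1)" 1 1]
  by (simp flip: cong_int_iff)

lemma pcong_choose_pred: "j < p \<Longrightarrow> pcong 1 (of_nat (p - 1 choose j)) ((-1) ^ j)"
proof (induction j)
  case 0
  show ?case by simp
next
  case (Suc j)
  have "p - 1 = Suc (p - 2)" using p_gt_2 by simp
  then have "of_nat (Suc j) * of_nat (p - 1 choose Suc j) = (of_nat (p - 1 - j) * of_nat (p - 1 choose j) :: rat)"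
    using choose_absorb[of j "p - 2"] choose_absorb_comp[of "p - 2" j] Suc.prems
    by (simp add: of_nat_diff diff_diff_eq del: binomial_Suc_Suc)
  also have "of_nat (p - 1 - j) = (of_nat p - of_nat (Suc j) :: rat)"
    using Suc.prems by (simp add: of_nat_diff)
  finally have e: "of_nat (Suc j) * of_nat (p - 1 choose Suc j)
      = (of_nat p - of_nat (Suc j)) * (of_nat (p - 1 choose j) :: rat)" .
  have "pcong 1 (of_nat (Suc j) * of_nat (p - 1 choose Suc j)) (- of_nat (Suc j) * of_nat (p - 1 choose j))"
    unfolding e by (rule pcongI[of _ _ _ "of_nat (p - 1 choose j)"]) (auto simp: algebra_simps)
  also have "pcong 1 (- of_nat (Suc j) * of_nat (p - 1 choose j)) (- of_nat (Suc j) * (-1) ^ j)"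
    using Suc by (intro pcong_mult_left Zp_uminus) auto
  also have "- of_nat (Suc j) * (-1) ^ j = of_nat (Suc j) * ((-1) ^ Suc j :: rat)"
    by (simp add: algebra_simps)
  finally show ?case using Zp_unit_small[of "Suc j"] Suc.prems by (blast intro: pcong_cancel)
qed

lemma pcong_choose_p:
  assumes "0 < i" "i < p"
  shows "pcong 2 (of_nat (p choose i)) (of_nat p * (- ((-1) ^ i / of_nat i)))"
proof -
  have u: "Zp_unit (of_nat i)" using assms by (intro Zp_unit_small)
  obtain j where j: "i = Suc j" using assms by (cases i) auto
  have "of_nat i * of_nat (p choose i) = (of_nat p * of_nat (p - 1 choose j) :: rat)"
    using choose_absorb[of j "p - 1"] p_gt_2 unfolding j by simp
  then have e: "of_nat (p choose i) = of_nat p * (of_nat (p - 1 choose j) / of_nat i :: rat)"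
    using assms by (simp add: field_simps)
  show ?thesis unfolding e
    using pcong_divide[OF pcong_choose_pred[of j] u] assms by (intro pcong_lift) (simp add: j)
qed

lemma pcong_choose_p_add: "j < p \<Longrightarrow> pcong 1 (of_nat (p + j choose j)) 1"
proof (induction j)
  case 0
  show ?case by simp
next
  case (Suc j)
  have "of_nat (Suc j) * of_nat (p + Suc j choose Suc j) = ((of_nat p + of_nat (Suc j)) * of_nat (p + j choose j) :: rat)"
    using choose_absorb[of j "p + j"] by (simp del: binomial_Suc_Suc)
  then have "pcong 1 (of_nat (Suc j) * of_nat (p + Suc j choose Suc j)) (of_nat (Suc j) * of_nat (p + j choose j))"
    by (intro pcongI[of _ _ _ "of_nat (p + j choose j)"]) (auto simp: algebra_simps)
  also have "pcong 1 (of_nat (Suc j) * of_nat (p + j choose j)) (of_nat (Suc j) * 1)"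
    using Suc by (intro pcong_mult_left) auto
  finally show ?case using Zp_unit_small[of "Suc j"] Suc.prems by (blast intro: pcong_cancel)
qed

text \<open>These are the coefficients of (1-z)^(-p) in degrees 1 to p - 1. Each is p/j times a
  binomial coefficient that is 1 modulo p.\<close>

lemma pcong_choose_p_add':
  assumes "0 < j" "j < p"
  shows "pcong 2 (of_nat (p - 1 + j choose j)) (of_nat p * (1 / of_nat j))"
proof -
  have u: "Zp_unit (of_nat j)" using assms by (intro Zp_unit_small)
  obtain i where i: "j = Suc i" using assms by (cases j) auto
  have pj: "p - 1 + j = p + i" using p_gt_2 i by simp
  have "of_nat j * of_nat (p + i choose j) = (of_nat p * of_nat (p + i choose i) :: rat)"
  proof -
    have "Suc (p - 1 + i) = p + i" using p_gt_2 by simp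
    then show ?thesis unfolding i
      using choose_absorb[of i "p - 1 + i"] choose_absorb_comp[of "p - 1 + i" i]
      by (simp del: binomial_Suc_Suc)
  qed
  then have e: "of_nat (p - 1 + j choose j) = of_nat p * (of_nat (p + i choose i) / of_nat j :: rat)"
    using assms unfolding pj by (simp add: field_simps)
  show ?thesis unfolding e
    using pcong_divide[OF pcong_choose_p_add[of i] u] assms by (intro pcong_lift) (simp add: i)
qed

text \<open>Expand (1+1)^p modulo p^2. The symmetry of row p folds the inner binomials onto the
  indices 1 to (p-1)/2, and the resulting factor 2 cancels.\<close>

lemma pcong_two_power:
  "pcong 2 (2 ^ (p - 1)) (1 + of_nat p * (\<Sum>j<(p - 1) div 2. (-1) ^ j / of_nat (Suc j)))"
proof -
  define n where "n = (p - 1) div 2"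
  have n: "p = 2 * n + 1" using odd_p unfolding n_def by (auto elim: oddE)
  have "(2 :: rat) ^ p = of_nat ((1 + 1) ^ p)" by simp
  also have "\<dots> = (\<Sum>i\<le>p. of_nat (p choose i))" by (simp only: binomial of_nat_sum) simp
  also have "\<dots> = 2 + (\<Sum>i\<in>{1..<p}. of_nat (p choose i))"
  proof -
    have "{..p} = insert 0 (insert p {1..<p})" using p_gt_2 by auto
    moreover have "p \<noteq> 0" using p_gt_2 by auto
    ultimately show ?thesis by simp
  qed
  finally have two: "(2 :: rat) ^ p = 2 + (\<Sum>i\<in>{1..<p}. of_nat (p choose i))" .
  have "{1..<p} = {1..n} \<union> {n + 1..2 * n}" using n by auto
  then have "(\<Sum>i\<in>{1..<p}. of_nat (p choose i) :: rat) = (\<Sum>i\<in>{1..n}. of_nat (p choose i)) + (\<Sum>i\<in>{n + 1..2 * n}. of_nat (p choose i))"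
    by (simp add: sum.union_disjoint)
  also have "(\<Sum>i\<in>{n + 1..2 * n}. of_nat (p choose i) :: rat) = (\<Sum>i\<in>{1..n}. of_nat (p choose i))"
    by (rule sum.reindex_bij_witness[of _ "\<lambda>i. p - i" "\<lambda>i. p - i"]) (use n in \<open>auto simp: binomial_symmetric[symmetric]\<close>)
  also have "(\<Sum>i\<in>{1..n}. of_nat (p choose i) :: rat) = (\<Sum>j<n. of_nat (p choose Suc j))"
    by (rule sum.reindex_bij_witness[of _ Suc "\<lambda>i. i - 1"]) auto
  finally have eq: "(2 :: rat) * 2 ^ (p - 1) = 2 * (1 + (\<Sum>j<n. of_nat (p choose Suc j)))"
    using two n by simp
  have "pcong 2 (2 * 2 ^ (p - 1)) (2 * (1 + (\<Sum>j<n. of_nat p * ((-1) ^ j / of_nat (Suc j)))))"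
    unfolding eq
  proof (intro pcong_mult_left pcong_add pcong_sum pcong_refl)
    fix j assume "j \<in> {..<n}"
    then show "pcong 2 (of_nat (p choose Suc j)) (of_nat p * ((-1) ^ j / of_nat (Suc j)))"
      using pcong_choose_p[of "Suc j"] n by simp
  qed auto
  then show ?thesis unfolding n_def[symmetric] sum_distrib_left by (rule pcong_cancel) simp
qed

end

section \<open>Delannoy sums modulo the square of p\<close>

text \<open>The power series (1-z)^(-M-1).\<close>

definition choose_fps :: "nat \<Rightarrow> rat fps" where
  "choose_fps M = Abs_fps (\<lambda>k. of_nat (M + k choose k))"

lemma choose_fps_Suc: "(1 - fps_X) * choose_fps (Suc M) = choose_fps M"
proof (rule fps_ext)
  fix k
  show "fps_nth ((1 - fps_X) * choose_fps (Suc M)) k = fps_nth (choose_fps M) k"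
    by (cases k) (simp_all add: left_diff_distrib choose_fps_def)
qed

lemma choose_fps_add: "(1 - fps_X) ^ N * choose_fps (N + M) = choose_fps M"
  by (induction N) (simp_all add: mult.assoc choose_fps_Suc mult.left_commute[of "1 - fps_X"])

text \<open>Both sides are the coefficient of z^N in (1+z)^N (1-z)^(-M-1) = (1-z^2)^N
  (1-z)^(-N-M-1). For N + M = p - 1 the last factor is (1-z)^(-p).\<close>

lemma delannoy_sum_expand:
  "(\<Sum>k\<le>N. of_nat (N choose k) * of_nat (M + k choose k)) =
   (\<Sum>i | 2 * i \<le> N. (-1) ^ i * of_nat (N choose i) * of_nat (N + M + (N - 2 * i) choose (N - 2 * i)) :: rat)"
proof -
  have "fps_nth ((1 + fps_X) ^ N * choose_fps M) N = (\<Sum>k\<le>N. of_nat (N choose k) * of_nat (M + k choose k))"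
  proof -
    have "fps_nth (choose_fps M * (1 + fps_X) ^ N) N = (\<Sum>k\<le>N. of_nat (M + k choose k) * of_nat (N choose (N - k)))"
      unfolding fps_mult_nth fps_binomial_of_nat[symmetric] atMost_atLeast0
      by (simp add: choose_fps_def binomial_gbinomial)
    then show ?thesis by (simp add: mult.commute binomial_symmetric[symmetric])
  qed
  moreover have "(1 + fps_X) ^ N * choose_fps M = (1 - fps_X\<^sup>2) ^ N * choose_fps (N + M)"
  proof -
    have "(1 + fps_X) ^ N * choose_fps M = ((1 + fps_X) * (1 - fps_X)) ^ N * choose_fps (N + M)"
      unfolding choose_fps_add[of N M, symmetric] power_mult_distrib by (simp only: mult.assoc)
    also have "(1 + fps_X) * (1 - fps_X) = (1 - fps_X\<^sup>2 :: rat fps)"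
      by (simp add: algebra_simps power2_eq_square)
    finally show ?thesis .
  qed
  moreover have "(1 - fps_X\<^sup>2 :: rat fps) ^ N = (\<Sum>i\<le>N. fps_const ((-1) ^ i * of_nat (N choose i)) * fps_X ^ (2 * i))"
  proof -
    have "(1 - fps_X\<^sup>2 :: rat fps) ^ N = (- fps_X\<^sup>2 + 1) ^ N" by simp
    also have "\<dots> = (\<Sum>i\<le>N. of_nat (N choose i) * (- fps_X\<^sup>2) ^ i)"
      unfolding binomial_ring by simp
    also have "\<dots> = (\<Sum>i\<le>N. fps_const ((-1) ^ i * of_nat (N choose i)) * fps_X ^ (2 * i))"
    proof (rule sum.cong)
      fix i
      have pw: "(- fps_X\<^sup>2 :: rat fps) ^ i = fps_const ((-1) ^ i) * fps_X ^ (2 * i)"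
        by (cases "even i") (simp_all add: power_mult power_minus_odd flip: fps_const_neg)
      show "of_nat (N choose i) * (- fps_X\<^sup>2) ^ i = fps_const ((-1) ^ i * of_nat (N choose i)) * (fps_X ^ (2 * i) :: rat fps)"
        unfolding pw by (simp only: fps_of_nat[symmetric] mult.assoc[symmetric] fps_const_mult mult.commute[of _ "(-1) ^ i"])
    qed simp
    finally show ?thesis .
  qed
  moreover have "fps_nth ((\<Sum>i\<le>N. fps_const ((-1) ^ i * of_nat (N choose i)) * fps_X ^ (2 * i)) * choose_fps (N + M)) N
      = (\<Sum>i\<le>N. if 2 * i \<le> N then (-1) ^ i * of_nat (N choose i) * of_nat (N + M + (N - 2 * i) choose (N - 2 * i)) else 0)"
    unfolding sum_distrib_right fps_sum_nth
    by (intro sum.cong refl) (simp add: mult.assoc fps_X_power_mult_nth choose_fps_def)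
  moreover have "(\<Sum>i\<le>N. if 2 * i \<le> N then (-1) ^ i * of_nat (N choose i) * of_nat (N + M + (N - 2 * i) choose (N - 2 * i)) else 0 :: rat)
      = (\<Sum>i | 2 * i \<le> N. (-1) ^ i * of_nat (N choose i) * of_nat (N + M + (N - 2 * i) choose (N - 2 * i)))"
    unfolding sum.inter_filter[OF finite_atMost, symmetric] by (rule sum.cong) auto
  ultimately show ?thesis by simp
qed

lemma minus_one_power_diff: "i \<le> r \<Longrightarrow> (-1 :: rat) ^ (r - i) = (-1) ^ r * (-1) ^ i"
  by (simp add: minus_one_power_iff)

lemma minus_one_power_cancel: "(-1 :: rat) ^ r * ((-1) ^ r * x) = x"
  by (cases "even r") simp_all

context odd_prime
begin

text \<open>In even degree N = 2r exactly one term, the middle one, uses the constant term of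
  (1-z)^(-p). It gives the main part; every other term carries a factor p. Indices are counted from
  the middle to reach \<open>choose_even_alternating_sum\<close>.\<close>

lemma delannoy_sum_even:
  assumes "2 * r + M = p - 1"
  shows "pcong 2 (\<Sum>k\<le>2 * r. of_nat (2 * r choose k) * of_nat (M + k choose k))
           ((-1) ^ r * of_nat (2 * r choose r) * (1 - of_nat p * alt_harm r / 2))"
proof -
  define F where "F = (\<lambda>i. of_nat (p - 1 + 2 * i choose (2 * i)) :: rat)"
  have "(\<Sum>k\<le>2 * r. of_nat (2 * r choose k) * of_nat (M + k choose k))
      = (\<Sum>i | 2 * i \<le> 2 * r. (-1) ^ i * of_nat (2 * r choose i) * (of_nat (p - 1 + (2 * r - 2 * i) choose (2 * r - 2 * i)) :: rat))"
    unfolding delannoy_sum_expand assms ..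
  also have "\<dots> = (\<Sum>i\<in>{..r}. (-1) ^ r * ((-1) ^ i * of_nat (2 * r choose (r + i))) * F i)"
  proof (rule sum.reindex_bij_witness[of _ "\<lambda>i. r - i" "\<lambda>i. r - i"])
    fix i assume i: "i \<in> {i. 2 * i \<le> 2 * r}"
    then have ir: "i \<le> r" by simp
    then have "2 * r - i = r + (r - i)" by simp
    then have "2 * r choose i = 2 * r choose (r + (r - i))"
      using binomial_symmetric[of i "2 * r"] ir by simp
    moreover have "2 * r - 2 * i = 2 * (r - i)" by simp
    ultimately show "(-1) ^ r * ((-1) ^ (r - i) * of_nat (2 * r choose (r + (r - i)))) * F (r - i)
      = (-1) ^ i * of_nat (2 * r choose i) * (of_nat (p - 1 + (2 * r - 2 * i) choose (2 * r - 2 * i)) :: rat)"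
      using ir by (simp only: F_def minus_one_power_diff mult.assoc minus_one_power_cancel)
  qed auto
  also have "\<dots> = (-1) ^ r * (of_nat (2 * r choose r) + (\<Sum>i<r. (-1) ^ Suc i * of_nat (2 * r choose (r + Suc i)) * F (Suc i)))"
    unfolding sum_distrib_left[symmetric] mult.assoc
    by (subst sum.atMost_shift) (simp add: F_def)
  also have "pcong 2 \<dots> ((-1) ^ r * (of_nat (2 * r choose r) + (\<Sum>i<r. (-1) ^ Suc i * of_nat (2 * r choose (r + Suc i)) * (of_nat p * (1 / of_nat (2 * Suc i))))))"
  proof (intro pcong_mult_left pcong_add pcong_sum pcong_refl)
    fix i assume "i \<in> {..<r}"
    then have "2 * Suc i < p" using assms p_gt_2 by auto
    then show "pcong 2 (F (Suc i)) (of_nat p * (1 / of_nat (2 * Suc i)))"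
      unfolding F_def by (intro pcong_choose_p_add') simp_all
  qed (auto intro!: Zp_mult Zp_power Zp_uminus)
  also have "(-1) ^ r * (of_nat (2 * r choose r) + (\<Sum>i<r. (-1) ^ Suc i * of_nat (2 * r choose (r + Suc i)) * (of_nat p * (1 / of_nat (2 * Suc i)))) :: rat)
     = (-1) ^ r * (of_nat (2 * r choose r) - of_nat p / 2 * (\<Sum>i<r. (-1) ^ i * of_nat (2 * r choose (r + Suc i)) / of_nat (Suc i)))"
    unfolding sum_distrib_left sum_negf[symmetric] diff_conv_add_uminus
    by (intro arg_cong2[where f = "(*)"] arg_cong2[where f = "(+)"] refl sum.cong) (simp add: algebra_simps)
  also have "\<dots> = (-1) ^ r * of_nat (2 * r choose r) * (1 - of_nat p * alt_harm r / 2)"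
    unfolding choose_even_alternating_sum by (simp add: algebra_simps)
  finally show ?thesis .
qed

text \<open>In odd degree the constant term of (1-z)^(-p) is never met, so the whole sum is
  divisible by p.\<close>

lemma delannoy_sum_odd:
  assumes "2 * t + 1 + M = p - 1"
  shows "pcong 2 (\<Sum>k\<le>2 * t + 1. of_nat (2 * t + 1 choose k) * of_nat (M + k choose k))
           (of_nat p * ((-1) ^ t * 16 ^ Suc t / (8 * of_nat (Suc t) * of_nat (2 * Suc t choose Suc t))))"
proof -
  define F where "F = (\<lambda>i. of_nat (p - 1 + (2 * i + 1) choose (2 * i + 1)) :: rat)"
  have "(\<Sum>k\<le>2 * t + 1. of_nat (2 * t + 1 choose k) * of_nat (M + k choose k))
      = (\<Sum>i | 2 * i \<le> 2 * t + 1. (-1) ^ i * of_nat (2 * t + 1 choose i) * (of_nat (p - 1 + (2 * t + 1 - 2 * i) choose (2 * t + 1 - 2 * i)) :: rat))"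
    unfolding delannoy_sum_expand assms ..
  also have "\<dots> = (\<Sum>i\<in>{..<Suc t}. (-1) ^ t * ((-1) ^ i * of_nat (2 * t + 1 choose (t + 1 + i))) * F i)"
  proof (rule sum.reindex_bij_witness[of _ "\<lambda>i. t - i" "\<lambda>i. t - i"])
    fix i assume i: "i \<in> {i. 2 * i \<le> 2 * t + 1}"
    then have it: "i \<le> t" by simp
    then have "2 * t + 1 - i = t + 1 + (t - i)" by simp
    then have "2 * t + 1 choose i = 2 * t + 1 choose (t + 1 + (t - i))"
      using binomial_symmetric[of i "2 * t + 1"] it by (simp del: binomial_Suc_Suc)
    moreover have "2 * t + 1 - 2 * i = 2 * (t - i) + 1" using it by simp
    ultimately show "(-1) ^ t * ((-1) ^ (t - i) * of_nat (2 * t + 1 choose (t + 1 + (t - i)))) * F (t - i)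
      = (-1) ^ i * of_nat (2 * t + 1 choose i) * (of_nat (p - 1 + (2 * t + 1 - 2 * i) choose (2 * t + 1 - 2 * i)) :: rat)"
      using it by (simp only: F_def minus_one_power_diff mult.assoc minus_one_power_cancel)
  qed auto
  finally have e1: "(\<Sum>k\<le>2 * t + 1. of_nat (2 * t + 1 choose k) * of_nat (M + k choose k) :: rat) =
     (\<Sum>i\<in>{..<Suc t}. (-1) ^ t * ((-1) ^ i * of_nat (2 * t + 1 choose (t + 1 + i))) * F i)" .
  have c: "pcong 2 (\<Sum>i\<in>{..<Suc t}. (-1) ^ t * ((-1) ^ i * of_nat (2 * t + 1 choose (t + 1 + i))) * F i)
      (\<Sum>i\<in>{..<Suc t}. (-1) ^ t * ((-1) ^ i * of_nat (2 * t + 1 choose (t + 1 + i))) * (of_nat p * (1 / of_nat (2 * i + 1))))"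
  proof (intro pcong_mult_left pcong_sum)
    fix i assume "i \<in> {..<Suc t}"
    then have "2 * i + 1 < p" using assms p_gt_2 by auto
    then show "pcong 2 (F i) (of_nat p * (1 / of_nat (2 * i + 1)))"
      unfolding F_def by (intro pcong_choose_p_add') simp_all
  qed (auto intro!: Zp_mult Zp_power Zp_uminus)
  have "(\<Sum>i\<in>{..<Suc t}. (-1) ^ t * ((-1) ^ i * of_nat (2 * t + 1 choose (t + 1 + i))) * (of_nat p * (1 / of_nat (2 * i + 1))) :: rat)
     = of_nat p * ((-1) ^ t * (\<Sum>i<Suc t. (-1) ^ i * of_nat (2 * t + 1 choose (t + 1 + i)) / of_nat (2 * i + 1)))"
    unfolding sum_distrib_left by (intro sum.cong refl) (simp add: algebra_simps del: binomial_Suc_Suc)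
  also have "\<dots> = of_nat p * ((-1) ^ t * 16 ^ Suc t / (8 * of_nat (Suc t) * of_nat (2 * Suc t choose Suc t)))"
    unfolding choose_odd_alternating_sum by (simp only: times_divide_eq_right mult.assoc)
  finally have e2: "(\<Sum>i\<in>{..<Suc t}. (-1) ^ t * ((-1) ^ i * of_nat (2 * t + 1 choose (t + 1 + i))) * (of_nat p * (1 / of_nat (2 * i + 1))) :: rat)
     = of_nat p * ((-1) ^ t * 16 ^ Suc t / (8 * of_nat (Suc t) * of_nat (2 * Suc t choose Suc t)))" .
  show ?thesis unfolding e1 using c unfolding e2 .
qed


section \<open>Reduction of the cubic sum and its evaluation by C and h\<close>

abbreviation half_p :: nat where "half_p \<equiv> (p - 1) div 2"

lemma p_eq_half_p: "p = 2 * half_p + 1"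
  using odd_p by (auto elim: oddE)

lemma half_p_pos: "half_p > 0"
  using p_gt_2 by linarith

lemma four_N: "4 * of_nat (half_p * (half_p + 1)) = (of_nat p ^ 2 - 1 :: rat)"
proof -
  have "p ^ 2 = 4 * (half_p * (half_p + 1)) + 1"
    by (subst p_eq_half_p) (simp add: power2_eq_square algebra_simps)
  then have "(of_nat (p ^ 2) :: rat) = of_nat (4 * (half_p * (half_p + 1)) + 1)" by (rule arg_cong)
  then show ?thesis by simp
qed

text \<open>Compare ratios of consecutive terms. After multiplication by (k+1)^2 they are 4(2k+1)^2
  on the left and, by \<open>four_N\<close>, 4((2k+1)^2 - p^2) on the right. For k + 1 < p the
  factor (k+1)^2 is a unit.\<close>

lemma central_binomial_square_pcong:
  "k < p \<Longrightarrow> pcong 2 (of_nat (2 * k choose k) ^ 2) ((-16) ^ k * delannoy_term half_p k)"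
proof (induction k)
  case 0
  show ?case by simp
next
  case (Suc k)
  define c where "c = (of_nat (2 * k choose k) :: rat)"
  define d where "d = delannoy_term half_p k"
  have dZ: "d \<in> Zp" unfolding d_def delannoy_term_def by auto
  have u: "Zp_unit (of_nat (Suc k) ^ 2)" using Suc.prems by (intro Zp_unit_power Zp_unit_small) auto
  have "of_nat (Suc k) ^ 2 * of_nat (2 * Suc k choose Suc k) ^ 2 = (2 * (2 * of_nat k + 1) * c) ^ 2"
    using central_binomial_Suc[of k] by (simp only: c_def power_mult_distrib[symmetric] mult.commute)
  also have "\<dots> = (4 * (2 * of_nat k + 1) ^ 2) * c ^ 2"
    by (simp add: power2_eq_square algebra_simps)
  finally have 1: "of_nat (Suc k) ^ 2 * of_nat (2 * Suc k choose Suc k) ^ 2 = (4 * (2 * of_nat k + 1) ^ 2) * c ^ 2" .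
  have "of_nat (Suc k) ^ 2 * ((-16) ^ Suc k * delannoy_term half_p (Suc k)) = (-16) ^ Suc k * (of_nat (Suc k) ^ 2 * delannoy_term half_p (Suc k))"
    by (simp only: ac_simps)
  also have "\<dots> = (-16) ^ k * (- 4 * (4 * of_nat (half_p * (half_p + 1)) - 4 * of_nat (k * (k + 1)))) * d"
    unfolding delannoy_term_Suc d_def by (simp add: algebra_simps)
  also have "\<dots> = (4 * (2 * of_nat k + 1) ^ 2) * ((-16) ^ k * d) - of_nat p ^ 2 * (4 * (-16) ^ k * d)"
    unfolding four_N by (simp add: power2_eq_square algebra_simps)
  finally have 2: "of_nat (Suc k) ^ 2 * ((-16) ^ Suc k * delannoy_term half_p (Suc k)) =
     (4 * (2 * of_nat k + 1) ^ 2) * ((-16) ^ k * d) - of_nat p ^ 2 * (4 * (-16) ^ k * d)" .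
  have "pcong 2 (c ^ 2) ((-16) ^ k * d)" using Suc by (simp add: c_def d_def)
  then have "pcong 2 ((4 * (2 * of_nat k + 1) ^ 2) * c ^ 2) ((4 * (2 * of_nat k + 1) ^ 2) * ((-16) ^ k * d))"
    by (rule pcong_mult_left) (intro Zp_mult Zp_power Zp_add; simp)
  also have "pcong 2 ((4 * (2 * of_nat k + 1) ^ 2) * ((-16) ^ k * d)) (of_nat (Suc k) ^ 2 * ((-16) ^ Suc k * delannoy_term half_p (Suc k)))"
  proof -
    have "4 * (-16) ^ k * d \<in> Zp" by (intro Zp_mult Zp_power Zp_uminus dZ; simp)
    then show ?thesis unfolding 2 by (intro pcongI[of _ _ _ "4 * (-16) ^ k * d"]) simp_all
  qed
  finally have "pcong 2 (of_nat (Suc k) ^ 2 * of_nat (2 * Suc k choose Suc k) ^ 2) (of_nat (Suc k) ^ 2 * ((-16) ^ Suc k * delannoy_term half_p (Suc k)))"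
    unfolding 1 .
  then show ?case using u by (rule pcong_cancel)
qed

text \<open>P and Y of the overview, at n = (p-1)/2.\<close>

definition delannoy_sum :: rat where "delannoy_sum = (\<Sum>k\<le>half_p. of_nat (half_p choose k) * of_nat (half_p + k choose k))"
definition delannoy_sum_shifted :: rat where "delannoy_sum_shifted = (\<Sum>k\<le>half_p - 1. of_nat (half_p - 1 choose k) * of_nat (half_p + 1 + k choose k))"

lemma delannoy_sums_in_Zp: "delannoy_sum \<in> Zp" "delannoy_sum_shifted \<in> Zp"
  unfolding delannoy_sum_def delannoy_sum_shifted_def by (intro Zp_sum Zp_mult; simp)+

lemma cubic_sum_pcong:
  "pcong 2 (\<Sum>k = 0..half_p. of_nat ((2 * k) choose k) ^ 3 / ((- 8) ^ k * of_nat (k + 1)))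
     (delannoy_sum ^ 2 + (delannoy_sum - 2 * delannoy_sum_shifted) ^ 2 / 2)"
proof -
  have "pcong 2 (\<Sum>k = 0..half_p. of_nat ((2 * k) choose k) ^ 3 / ((- 8) ^ k * of_nat (k + 1)))
     (\<Sum>k\<le>half_p. of_nat (2 * k choose k) * delannoy_term half_p k * 2 ^ k / of_nat (k + 1))"
    unfolding atMost_atLeast0
  proof (rule pcong_sum)
    fix k assume "k \<in> {0..half_p}"
    then have k: "k + 1 < p" using p_gt_2 by auto
    define f where "f = of_nat (2 * k choose k) / ((-8) ^ k * of_nat (k + 1) :: rat)"
    have "f \<in> Zp" unfolding f_def using k by (intro Zp_divide Zp_unit_mult Zp_unit_power Zp_unit_uminus Zp_unit_small) auto
    then have "pcong 2 (f * of_nat (2 * k choose k) ^ 2) (f * ((-16) ^ k * delannoy_term half_p k))"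
      using central_binomial_square_pcong[of k] k by (intro pcong_mult_left) auto
    moreover have "f * of_nat (2 * k choose k) ^ 2 = of_nat ((2 * k) choose k) ^ 3 / ((- 8) ^ k * of_nat (k + 1))"
      unfolding f_def by (simp add: power2_eq_square power3_eq_cube)
    moreover have "f * ((-16) ^ k * delannoy_term half_p k) = of_nat (2 * k choose k) * delannoy_term half_p k * 2 ^ k / of_nat (k + 1)"
    proof -
      have "(-16 :: rat) ^ k = (-8) ^ k * 2 ^ k" by (simp flip: power_mult_distrib)
      then show ?thesis unfolding f_def by (simp add: mult.commute)
    qed
    ultimately show "pcong 2 (of_nat ((2 * k) choose k) ^ 3 / ((- 8) ^ k * of_nat (k + 1)))
      (of_nat (2 * k choose k) * delannoy_term half_p k * 2 ^ k / of_nat (k + 1))" by simp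
  qed
  also have "(\<Sum>k\<le>half_p. of_nat (2 * k choose k) * delannoy_term half_p k * 2 ^ k / of_nat (k + 1))
      = delannoy_sum ^ 2 - 2 * of_nat (half_p * (half_p + 1)) * (delannoy_sum - 2 * delannoy_sum_shifted) ^ 2"
  proof -
    have "Suc (half_p - 1) = half_p" "half_p - 1 + 2 = half_p + 1" using half_p_pos by simp_all
    then show ?thesis using delannoy_catalan_sum[of "half_p - 1"]
      by (simp only: delannoy_sum_def delannoy_sum_shifted_def delannoy_term_def)
  qed
  also have "\<dots> = delannoy_sum ^ 2 - (4 * of_nat (half_p * (half_p + 1))) * (delannoy_sum - 2 * delannoy_sum_shifted) ^ 2 / 2" by simp
  \<comment> \<open>Since 4n(n+1) = p^2 - 1, the coefficient -2n(n+1) is 1/2 modulo p^2.\<close>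
  also have "pcong 2 \<dots> (delannoy_sum ^ 2 + (delannoy_sum - 2 * delannoy_sum_shifted) ^ 2 / 2)"
  proof -
    define D where "D = (delannoy_sum - 2 * delannoy_sum_shifted) ^ 2 / 2"
    have "D \<in> Zp" unfolding D_def by (intro Zp_divide Zp_power Zp_diff Zp_mult delannoy_sums_in_Zp; simp)
    then have "pcong 2 (delannoy_sum ^ 2 - (of_nat p ^ 2 - 1) * D) (delannoy_sum ^ 2 + D)"
      by (intro pcongI[of _ _ _ "- D"]) (simp_all add: algebra_simps Zp_uminus)
    then show ?thesis unfolding four_N D_def by simp
  qed
  finally show ?thesis .
qed

lemma alt_harm_in_Zp: "2 * r < p \<Longrightarrow> alt_harm r \<in> Zp"
  unfolding alt_harm_def by (intro Zp_sum Zp_divide Zp_power Zp_uminus Zp_unit_small) auto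

lemma pcong_delannoy_sums:
  assumes "pcong 2 delannoy_sum a" "pcong 2 (2 * delannoy_sum_shifted) b" "a \<in> Zp" "b \<in> Zp"
  shows "pcong 2 (delannoy_sum ^ 2 + (delannoy_sum - 2 * delannoy_sum_shifted) ^ 2 / 2) (a ^ 2 + (a - b) ^ 2 / 2)"
  using assms by (intro pcong_add pcong_power pcong_divide pcong_diff Zp_diff) simp_all

text \<open>Here n is even, so P is c(1 - ph/2) with c = (-1)^r C, while 2Y is p/c. In P^2 + (P -
  2Y)^2 / 2 the cross term of the second square contributes -p.\<close>

lemma cubic_sum_mod4_1:
  assumes p: "p = 4 * r + 1"
  defines "C \<equiv> of_nat (2 * r choose r) :: rat"
  shows "pcong 2 (\<Sum>k = 0..half_p. of_nat ((2 * k) choose k) ^ 3 / ((- 8) ^ k * of_nat (k + 1)))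
     (3 / 2 * C ^ 2 * (1 - of_nat p * alt_harm r) - of_nat p)"
proof -
  define h where "h = alt_harm r"
  have hZ: "h \<in> Zp" unfolding h_def using p p_gt_2 by (intro alt_harm_in_Zp) simp
  define q where "q = (of_nat p :: rat)"
  have qZ: "q \<in> Zp" by (simp add: q_def)
  define c where "c = (-1) ^ r * C"
  have half_p: "half_p = 2 * r" using p by simp
  have Cu: "Zp_unit C" unfolding C_def using p by (intro Zp_unit_choose) auto
  have cu: "Zp_unit c" unfolding c_def by (intro Zp_unit_mult Zp_unit_power Zp_unit_uminus Cu) simp
  obtain t where t: "r = Suc t" using p p_gt_2 by (cases r) auto
  have 1: "pcong 2 delannoy_sum (c * (1 - q * h / 2))"
  proof -
    have "2 * r + 2 * r = p - 1" using p by simp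
    from delannoy_sum_even[OF this] show ?thesis unfolding delannoy_sum_def half_p c_def C_def h_def q_def .
  qed
  have "pcong 2 delannoy_sum_shifted (q * ((-1) ^ t * 16 ^ Suc t / (8 * of_nat (Suc t) * of_nat (2 * Suc t choose Suc t))))"
  proof -
    have "2 * t + 1 + (half_p + 1) = p - 1" "half_p - 1 = 2 * t + 1" using p t by simp_all
    with delannoy_sum_odd[OF this(1)] show ?thesis unfolding delannoy_sum_shifted_def q_def by (simp only:)
  qed
  \<comment> \<open>As r = t + 1, the sign (-1)^t is opposite to the one in c; the minus sign is
    attached to r.\<close>
  also have "q * ((-1) ^ t * 16 ^ Suc t / (8 * of_nat (Suc t) * of_nat (2 * Suc t choose Suc t)))
      = q * (16 ^ r * (1 / (8 * (- of_nat r) * c)))"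
  proof -
    have "c = - ((-1) ^ t * C)" by (simp add: c_def t)
    then show ?thesis unfolding t[symmetric] C_def[symmetric] by (cases "even t") simp_all
  qed
  finally have "pcong 2 (2 * delannoy_sum_shifted) (2 * (q * (16 ^ r * (1 / (8 * (- of_nat r) * c)))))"
    by (rule pcong_mult_left) simp
  also have "2 * (q * (16 ^ r * (1 / (8 * (- of_nat r) * c)))) = q * (16 ^ r * (1 / (- (4 * of_nat r) * c)))"
    by simp
  \<comment> \<open>Modulo p, 16^r = 2^(p-1) is 1 by Fermat, and -4r = 1 - p is 1.\<close>
  also have "pcong 2 \<dots> (q * (1 * (1 / c)))"
    unfolding q_def
  proof (intro pcong_lift pcong_mult)
    have "(16 :: rat) ^ r = of_nat 2 ^ (p - 1)" by (simp add: p power_mult)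
    moreover have "\<not> p dvd 2" using p_gt_2 by (auto dest: dvd_imp_le)
    ultimately show "pcong 1 (16 ^ r) 1" using Fermat_p[of 2] by simp
    have "Zp_unit (of_nat r)" by (rule Zp_unit_small) (use p t in linarith)+
    then have u: "Zp_unit (- (4 * of_nat r) * c)"
      by (intro Zp_unit_mult Zp_unit_uminus cu) simp
    have q1: "4 * of_nat r = q - 1" by (simp add: q_def p)
    have "- (4 * of_nat r) * c - c = of_nat p ^ 1 * - c" unfolding q1 by (simp add: q_def algebra_simps)
    then have "pcong 1 (- (4 * of_nat r) * c) c"
      by (rule pcongI) (use cu in auto)
    then show "pcong 1 (1 / (- (4 * of_nat r) * c)) (1 / c)" using u cu by (intro pcong_inverse)
    show "1 / c \<in> Zp" using cu by auto
  qed (auto intro: Zp_power)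
  finally have 2: "pcong 2 (2 * delannoy_sum_shifted) (q / c)" by simp
  have "pcong 2 (delannoy_sum ^ 2 + (delannoy_sum - 2 * delannoy_sum_shifted) ^ 2 / 2) ((c * (1 - q * h / 2)) ^ 2 + (c * (1 - q * h / 2) - q / c) ^ 2 / 2)"
    by (rule pcong_delannoy_sums[OF 1 2]; intro Zp_mult Zp_diff Zp_divide cu hZ qZ Zp_unit_in[OF cu]; simp)
  also have "pcong 2 \<dots> (3 / 2 * c ^ 2 * (1 - q * h) - q)"
  proof (rule pcongI)
    define b where "b = 1 / c"
    have cb: "c * b = 1" using Zp_unit_nz[OF cu] by (simp add: b_def)
    have "(c * (1 - q * h / 2) - q * b) ^ 2 = (c * (1 - q * h / 2)) ^ 2 - 2 * q * (1 - q * h / 2) * (c * b) + (q * b) ^ 2"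
      by (simp add: power2_eq_square algebra_simps)
    then have e: "(c * (1 - q * h / 2) - q * b) ^ 2 = (c * (1 - q * h / 2)) ^ 2 - 2 * q * (1 - q * h / 2) + (q * b) ^ 2"
      by (simp only: cb mult_1_right)
    have b: "q / c = q * b" "1 / c ^ 2 = b ^ 2" by (simp_all add: b_def power_one_over)
    show "(c * (1 - q * h / 2)) ^ 2 + (c * (1 - q * h / 2) - q / c) ^ 2 / 2 - (3 / 2 * c ^ 2 * (1 - q * h) - q)
       = of_nat p ^ 2 * (3 / 2 * c ^ 2 * h ^ 2 / 4 + h / 2 + 1 / c ^ 2 / 2)"
      unfolding q_def[symmetric] b e
      by (simp add: power2_eq_square algebra_simps add_divide_distrib diff_divide_distrib)
    show "3 / 2 * c ^ 2 * h ^ 2 / 4 + h / 2 + 1 / c ^ 2 / 2 \<in> Zp"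
      by (intro Zp_add Zp_mult Zp_divide Zp_power Zp_unit_power cu hZ Zp_unit_in[OF cu]; simp)
  qed
  also have "c ^ 2 = C ^ 2" unfolding c_def by (cases "even r") simp_all
  finally show ?thesis using pcong_trans[OF cubic_sum_pcong] by (simp add: h_def q_def)
qed

text \<open>Here n is odd and the roles are exchanged: P is p/c, so P^2 vanishes modulo p^2, and 2Y
  is -(1 + 2p - ph/2) c. The cross term in (P - 2Y)^2 / 2 gives the summand p.\<close>

lemma cubic_sum_mod4_3:
  assumes p: "p = 4 * r + 3"
  defines "C \<equiv> of_nat (2 * r + 1 choose r) :: rat"
  shows "pcong 2 (\<Sum>k = 0..half_p. of_nat ((2 * k) choose k) ^ 3 / ((- 8) ^ k * of_nat (k + 1)))
     ((2 * of_nat p + 2 - 2 ^ (p - 1)) * C ^ 2 / 2 + of_nat p)"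
proof -
  define h where "h = alt_harm r"
  have hZ: "h \<in> Zp" unfolding h_def using p p_gt_2 by (intro alt_harm_in_Zp) simp
  define q where "q = (of_nat p :: rat)"
  have qZ: "q \<in> Zp" by (simp add: q_def)
  have q: "q = 4 * of_nat r + 3" by (simp add: q_def p)
  define c where "c = (-1) ^ r * C"
  have half_p: "half_p = 2 * r + 1" using p by simp
  have Cu: "Zp_unit C" unfolding C_def using p by (intro Zp_unit_choose) auto
  have cu: "Zp_unit c" unfolding c_def by (intro Zp_unit_mult Zp_unit_power Zp_unit_uminus Cu) simp
  have c2: "c ^ 2 = C ^ 2" unfolding c_def by (cases "even r") simp_all
  have p1: "Zp_unit (q - 1)"
    using Zp_unit_small[of "p - 1"] p_gt_2 by (simp add: q_def of_nat_diff)
  have p2: "Zp_unit (q + 1)"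
  proof -
    have "\<not> p dvd p + 1" unfolding dvd_add_triv_left_iff using p_gt_2 by simp
    then show ?thesis using Zp_unit_of_nat[of "p + 1"] by (simp add: q_def add.commute)
  qed
  have 2: "pcong 2 (2 ^ (p - 1)) (1 + q * h - 2 * q)"
  proof -
    \<comment> \<open>Since (p-1)/2 = 2r + 1, one term remains beyond \<open>alt_harm r\<close>. It
      is 2/(p-1), that is -2 modulo p.\<close>
    have "(\<Sum>j<half_p. (-1) ^ j / of_nat (Suc j)) = h + 1 / of_nat (2 * r + 1)"
      unfolding half_p h_def alt_harm_def by simp
    also have "of_nat (2 * r + 1) = (q - 1) / 2" by (simp add: q)
    finally have "pcong 2 (2 ^ (p - 1)) (1 + q * (h + 2 / (q - 1)))"
      using pcong_two_power by (simp add: q_def)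
    also have "pcong 2 \<dots> (1 + q * (h + - 2))"
    proof -
      have "2 / (q - 1) - - 2 = q * (2 / (q - 1))"
        using Zp_unit_nz[OF p1] by (simp add: field_simps)
      then have "2 / (q - 1) - - 2 = of_nat p ^ 1 * (2 / (q - 1))" by (simp only: q_def power_one_right)
      then have "pcong 1 (2 / (q - 1)) (- 2)"
        by (rule pcongI) (rule Zp_divide[OF _ p1], simp)
      then show ?thesis unfolding q_def by (intro pcong_add pcong_refl pcong_lift)
    qed
    also have "1 + q * (h + - 2) = 1 + q * h - 2 * q" by (simp add: algebra_simps)
    finally show ?thesis .
  qed
  have Pc: "pcong 2 delannoy_sum (q / c)"
  proof -
    have "pcong 2 delannoy_sum (q * ((-1) ^ r * 16 ^ Suc r / (8 * of_nat (Suc r) * of_nat (2 * Suc r choose Suc r))))"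
    proof -
      have "2 * r + 1 + (2 * r + 1) = p - 1" using p by simp
      from delannoy_sum_odd[OF this] show ?thesis unfolding delannoy_sum_def half_p q_def .
    qed
    also have "q * ((-1) ^ r * 16 ^ Suc r / (8 * of_nat (Suc r) * of_nat (2 * Suc r choose Suc r)))
        = q * (2 ^ (p - 1) * (1 / ((q + 1) * c)))"
    proof -
      have "2 * r + 1 - r = Suc r" "2 * Suc r = Suc (2 * r + 1)" by simp_all
      then have "2 * Suc r choose Suc r = 2 * (2 * r + 1 choose r)"
        using binomial_symmetric[of r "2 * r + 1"] binomial_Suc_Suc[of "2 * r + 1" r]
        by (simp del: binomial_Suc_Suc)
      then have C2: "of_nat (2 * Suc r choose Suc r) = 2 * C" unfolding C_def by (simp only: of_nat_mult of_nat_numeral)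
      have "p - 1 = 4 * r + 2" using p by simp
      then have pw: "(16 :: rat) ^ Suc r = 4 * 2 ^ (p - 1)" by (simp add: power_add power_mult)
      have D: "8 * of_nat (Suc r) * (2 * C) = 4 * ((q + 1) * C)" by (simp add: q)
      show ?thesis unfolding C2 pw unfolding D c_def by (cases "even r") simp_all
    qed
    also have "pcong 2 \<dots> (q * (1 * (1 / c)))"
      unfolding q_def
    proof (intro pcong_lift pcong_mult)
      have "\<not> p dvd 2" using p_gt_2 by (auto dest: dvd_imp_le)
      then show "pcong 1 (2 ^ (p - 1)) 1" using Fermat_p[of 2] by simp
      have "(of_nat p + 1) * c - c = of_nat p ^ 1 * c" by (simp add: algebra_simps)
      then have "pcong 1 ((of_nat p + 1) * c) c" by (rule pcongI) (rule Zp_unit_in[OF cu])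
      then show "pcong 1 (1 / ((of_nat p + 1) * c)) (1 / c)"
        using Zp_unit_mult[OF p2 cu] cu unfolding q_def by (rule pcong_inverse)
      show "1 / c \<in> Zp" using cu by auto
    qed (auto intro: Zp_power)
    finally show ?thesis by simp
  qed
  define s where "s = - ((1 + 2 * q - q * h / 2) * c)"
  have Yc: "pcong 2 (2 * delannoy_sum_shifted) s"
  proof -
    define C0 where "C0 = (of_nat (2 * r choose r) :: rat)"
    have "of_nat (2 * r + 1 - r) * of_nat (2 * r + 1 choose r) = (of_nat (2 * r + 1) * C0)"
      unfolding C0_def using choose_absorb_comp[of "2 * r" r] by (simp add: of_nat_diff add.commute)
    then have "(of_nat r + 1) * C = (2 * of_nat r + 1) * C0"
      unfolding C_def by (simp add: algebra_simps del: binomial_Suc_Suc)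
    then have "2 * C0 * (q - 1) = C * (q + 1)" unfolding q by (simp add: algebra_simps)
    \<comment> \<open>The quotient (q+1)/(q-1) is expanded to first order in q, with exact remainder
      2 q^2 / (q-1).\<close>
    then have C0: "2 * C0 = C * (- (1 + 2 * q) + q ^ 2 * (2 / (q - 1)))"
      using Zp_unit_nz[OF p1] by (simp add: field_simps power2_eq_square)
    have "pcong 2 delannoy_sum_shifted ((-1) ^ r * C0 * (1 - q * h / 2))"
    proof -
      have "2 * r + (half_p + 1) = p - 1" "half_p - 1 = 2 * r" using p by simp_all
      with delannoy_sum_even[OF this(1)] show ?thesis unfolding delannoy_sum_shifted_def C0_def q_def h_def by (simp only:)
    qed
    then have "pcong 2 (2 * delannoy_sum_shifted) (2 * ((-1) ^ r * C0 * (1 - q * h / 2)))"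
      by (rule pcong_mult_left) simp
    also have "2 * ((-1) ^ r * C0 * (1 - q * h / 2)) = (- (1 + 2 * q) + q ^ 2 * (2 / (q - 1))) * c * (1 - q * h / 2)"
    proof -
      have "2 * ((-1) ^ r * C0 * (1 - q * h / 2)) = (-1) ^ r * (2 * C0) * (1 - q * h / 2)" by simp
      then show ?thesis unfolding C0 c_def by (simp only: ac_simps)
    qed
    also have "pcong 2 \<dots> s"
    proof (rule pcongI)
      define e where "e = 2 / (q - 1)"
      show "(- (1 + 2 * q) + q ^ 2 * (2 / (q - 1))) * c * (1 - q * h / 2) - s = of_nat p ^ 2 * (c * h + 2 / (q - 1) * c * (1 - q * h / 2))"
        unfolding s_def q_def[symmetric] e_def[symmetric] by (simp add: power2_eq_square algebra_simps)
      show "c * h + 2 / (q - 1) * c * (1 - q * h / 2) \<in> Zp"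
        using cu hZ p1 by (intro Zp_add Zp_mult Zp_divide Zp_diff) (auto simp: q_def)
    qed
    finally show ?thesis .
  qed
  have sZ: "s \<in> Zp" unfolding s_def using cu hZ
    by (intro Zp_uminus Zp_mult Zp_diff Zp_add Zp_divide) (auto simp: q_def)
  have "pcong 2 (delannoy_sum ^ 2 + (delannoy_sum - 2 * delannoy_sum_shifted) ^ 2 / 2) ((q / c) ^ 2 + (q / c - s) ^ 2 / 2)"
    using Pc Yc sZ cu by (intro pcong_delannoy_sums) (auto simp: q_def)
  also have "pcong 2 \<dots> ((1 + 4 * q - q * h) * c ^ 2 / 2 + q)"
  proof (rule pcongI)
    define b where "b = 1 / c"
    have cb: "c * b = 1" using Zp_unit_nz[OF cu] by (simp add: b_def)
    have "(q * b - s) ^ 2 = (q * b) ^ 2 + 2 * q * (1 + 2 * q - q * h / 2) * (c * b) + ((1 + 2 * q - q * h / 2) * c) ^ 2"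
      unfolding s_def by (simp add: power2_eq_square algebra_simps)
    then have e: "(q * b - s) ^ 2 = (q * b) ^ 2 + 2 * q * (1 + 2 * q - q * h / 2) + ((1 + 2 * q - q * h / 2) * c) ^ 2"
      by (simp only: cb mult_1_right)
    have b: "q / c = q * b" "1 / c ^ 2 = b ^ 2" by (simp_all add: b_def power_one_over)
    show "(q / c) ^ 2 + (q / c - s) ^ 2 / 2 - ((1 + 4 * q - q * h) * c ^ 2 / 2 + q)
       = of_nat p ^ 2 * (3 / 2 * (1 / c ^ 2) + (2 - h / 2) + (2 - h / 2) ^ 2 * c ^ 2 / 2)"
      unfolding q_def[symmetric] b e
      by (simp add: power2_eq_square algebra_simps add_divide_distrib diff_divide_distrib)
    show "3 / 2 * (1 / c ^ 2) + (2 - h / 2) + (2 - h / 2) ^ 2 * c ^ 2 / 2 \<in> Zp"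
      by (intro Zp_add Zp_mult Zp_divide Zp_power Zp_diff Zp_unit_power cu hZ Zp_unit_in[OF cu]; simp)
  qed
  \<comment> \<open>The coefficient is rearranged so that the value of 2^(p-1) found in
    \<open>2\<close> appears; this yields the first factor of R_1(p).\<close>
  also have "(1 + 4 * q - q * h) * c ^ 2 / 2 + q = (2 * q + 2 - (1 + q * h - 2 * q)) * C ^ 2 / 2 + q"
    by (simp add: c2)
  also have "pcong 2 \<dots> ((2 * q + 2 - 2 ^ (p - 1)) * C ^ 2 / 2 + q)"
  proof -
    have "pcong 2 (C ^ 2 / 2 * (2 * q + 2 - (1 + q * h - 2 * q))) (C ^ 2 / 2 * (2 * q + 2 - 2 ^ (p - 1)))"
      using pcong_sym[OF 2] Cu by (intro pcong_mult_left pcong_diff pcong_refl Zp_divide Zp_power) auto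
    then show ?thesis by (intro pcong_add pcong_refl) (simp add: mult.commute)
  qed
  finally show ?thesis using pcong_trans[OF cubic_sum_pcong] by (simp add: q_def)
qed

end

section \<open>Jacobsthal sums\<close>

context odd_prime
begin

abbreviation leg :: "int \<Rightarrow> int" where "leg a \<equiv> Legendre a (int p)"

abbreviation residues_p :: "int set" where "residues_p \<equiv> {0..<int p}"

lemma leg_cong: "[a = b] (mod int p) \<Longrightarrow> leg a = leg b"
proof -
  assume ab: "[a = b] (mod int p)"
  have "[a = 0] (mod int p) \<longleftrightarrow> [b = 0] (mod int p)" using ab by (simp add: cong_def)
  moreover have "[y ^ 2 = a] (mod int p) \<longleftrightarrow> [y ^ 2 = b] (mod int p)" for y using ab by (simp add: cong_def)
  ultimately show ?thesis unfolding Legendre_def QuadRes_def by simp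
qed

lemma leg_euler: "[leg a = a ^ ((p - 1) div 2)] (mod int p)"
  using euler_criterion[OF prime_p p_gt_2] .

lemma leg_range: "leg a \<in> {-1, 0, 1}"
  unfolding Legendre_def by auto

lemma leg_eq_0_iff: "leg a = 0 \<longleftrightarrow> int p dvd a"
  unfolding Legendre_def by (auto simp: cong_0_iff)

text \<open>Two such values differ by at most 2 < p. This turns Euler's criterion into equalities of
  Legendre symbols.\<close>

lemma small_cong_eq: "[x = y] (mod int p) \<Longrightarrow> x \<in> {-1, 0, 1} \<Longrightarrow> y \<in> {-1, 0, 1} \<Longrightarrow> x = y"
proof -
  assume "[x = y] (mod int p)" and xy: "x \<in> {-1, 0, 1}" "y \<in> {-1, 0, 1}"
  then have "int p dvd x - y" by (simp add: cong_iff_dvd_diff)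
  moreover have "\<bar>x - y\<bar> < int p" using xy p_gt_2 by auto
  ultimately show "x = y" using zdvd_imp_le[of "int p" "\<bar>x - y\<bar>"] by auto
qed

lemma leg_mult: "leg (a * b) = leg a * leg b"
proof (rule small_cong_eq)
  have "[leg (a * b) = (a * b) ^ ((p - 1) div 2)] (mod int p)" by (rule leg_euler)
  moreover have "[leg a * leg b = a ^ ((p - 1) div 2) * b ^ ((p - 1) div 2)] (mod int p)"
    by (intro cong_mult leg_euler)
  ultimately show "[leg (a * b) = leg a * leg b] (mod int p)"
    by (metis power_mult_distrib cong_sym cong_trans)
  show "leg (a * b) \<in> {-1, 0, 1}" by (rule leg_range)
  show "leg a * leg b \<in> {-1, 0, 1}" using leg_range[of a] leg_range[of b] by auto
qed

lemma leg_0 [simp]: "leg 0 = 0"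
  by (simp add: leg_eq_0_iff)

lemma leg_square: "leg a * leg a = (if int p dvd a then 0 else 1)"
  using leg_range[of a] leg_eq_0_iff[of a] by auto

lemma residues_p_dvd: "x \<in> residues_p \<Longrightarrow> int p dvd x \<longleftrightarrow> x = 0"
  using zdvd_not_zless by force

text \<open>An affine map with invertible slope permutes the residues. Only p-periodicity of f is
  asked, so the rule serves for Legendre symbols and also for residues modulo p^2 of p-th
  powers.\<close>

lemma sum_residues_reindex:
  fixes f :: "int \<Rightarrow> 'b :: comm_monoid_add"
  assumes f: "\<And>a b. [a = b] (mod int p) \<Longrightarrow> f a = f b" and c: "\<not> int p dvd c"
  shows "(\<Sum>x\<in>residues_p. f (c * x + d)) = (\<Sum>x\<in>residues_p. f x)"
proof -
  define g where "g = (\<lambda>x. (c * x + d) mod int p)"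
  have "inj_on g residues_p"
  proof (rule inj_onI)
    fix x y assume xy: "x \<in> residues_p" "y \<in> residues_p" "g x = g y"
    then have "[c * x + d = c * y + d] (mod int p)" by (simp add: g_def cong_def)
    then have "int p dvd c * (x - y)" by (simp add: cong_iff_dvd_diff algebra_simps)
    then have "int p dvd x - y" using c prime_int_p prime_dvd_mult_iff by blast
    then have "[x = y] (mod int p)" by (simp add: cong_iff_dvd_diff)
    then show "x = y" using xy by (simp add: cong_def)
  qed
  moreover have "g ` residues_p \<subseteq> residues_p" using p_gt_2 by (auto simp: g_def)
  ultimately have "bij_betw g residues_p residues_p"
    by (simp add: bij_betw_def endo_inj_surj)
  then have "(\<Sum>x\<in>residues_p. f (g x)) = (\<Sum>x\<in>residues_p. f x)" by (rule sum.reindex_bij_betw)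
  moreover have "f (g x) = f (c * x + d)" for x by (rule f) (simp add: g_def)
  ultimately show ?thesis by simp
qed

lemma primitive_root_exists:
  obtains g :: nat where "\<not> p dvd g" "\<And>k. [g ^ k = 1] (mod p) \<longleftrightarrow> (p - 1) dvd k"
proof -
  have "p \<in> {q ^ k |q k. prime q \<and> odd q \<and> k > 0}"
    using prime_p odd_p by (intro CollectI exI[of _ p] exI[of _ 1]) simp
  then have "p \<in> cyclic_moduli" unfolding cyclic_moduli_def by (rule UnI1[OF UnI2])
  then obtain g where g: "residue_primroot p g" using residue_primroot_iff_in_cyclic_moduli by blast
  then have "ord p g = p - 1" "coprime p g"
    using prime_p by (auto simp: residue_primroot_def totient_prime)
  then have "\<not> p dvd g" "\<And>k. [g ^ k = 1] (mod p) \<longleftrightarrow> (p - 1) dvd k"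
    using prime_p by (auto simp: ord_divides' dest: coprime_common_divisor)
  then show ?thesis by (rule that)
qed

lemma nonresidue_exists: obtains g where "leg g = -1"
proof -
  obtain g :: nat where g: "\<not> p dvd g" "\<And>k. [g ^ k = 1] (mod p) \<longleftrightarrow> (p - 1) dvd k"
    using primitive_root_exists by blast
  have "leg (int g) \<noteq> 1"
  proof
    assume "leg (int g) = 1"
    then have "[int g ^ ((p - 1) div 2) = int 1] (mod int p)"
      using leg_euler[of "int g"] by (simp add: cong_sym_eq)
    then have "[g ^ ((p - 1) div 2) = 1] (mod p)" by (metis cong_int_iff of_nat_power)
    then have "(p - 1) dvd (p - 1) div 2" using g by blast
    then show False using p_gt_2 by (auto dest: dvd_imp_le)
  qed
  moreover have "leg (int g) \<noteq> 0" using g by (simp add: leg_eq_0_iff)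
  ultimately have "leg (int g) = -1" using leg_range[of "int g"] by auto
  then show ?thesis by (rule that)
qed

lemma sum_leg_0: "(\<Sum>x\<in>residues_p. leg x) = 0"
proof -
  obtain g where g: "leg g = -1" by (rule nonresidue_exists)
  then have "\<not> int p dvd g" using leg_eq_0_iff[of g] by auto
  then have "(\<Sum>x\<in>residues_p. leg (g * x + 0)) = (\<Sum>x\<in>residues_p. leg x)"
    by (intro sum_residues_reindex leg_cong)
  then show ?thesis using g by (simp add: leg_mult sum_negf)
qed

lemma sum_leg_shift: "(\<Sum>x\<in>residues_p. leg (x + d)) = 0"
proof -
  have "\<not> int p dvd 1" using p_gt_2 by simp
  then have "(\<Sum>x\<in>residues_p. leg (1 * x + d)) = (\<Sum>x\<in>residues_p. leg x)"
    by (intro sum_residues_reindex leg_cong)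
  then show ?thesis by (simp add: sum_leg_0)
qed

lemma sum_leg_sq: "(\<Sum>x\<in>residues_p. leg x * leg x) = int p - 1"
proof -
  have "(\<Sum>x\<in>residues_p. leg x * leg x) = (\<Sum>x\<in>residues_p. if x \<noteq> 0 then 1 else 0)"
    by (intro sum.cong refl) (auto simp: leg_square residues_p_dvd)
  also have "\<dots> = (\<Sum>x\<in>{x \<in> residues_p. x \<noteq> 0}. 1)" by (rule sum.inter_filter[symmetric]) simp
  also have "{x \<in> residues_p. x \<noteq> 0} = {1..<int p}" by auto
  finally show ?thesis using p_gt_2 by simp
qed

text \<open>The correlation \<open>R w\<close> is the same for all w not divisible by p, as the
  substitution of w a for a shows. Over all w the correlations add up to 0 and \<open>R 0\<close> is
  p - 1, which forces \<open>R 1\<close> = -1.\<close>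

lemma sum_leg_product:
  "(\<Sum>a\<in>residues_p. leg (u + a) * leg (v + a)) = (if [u = v] (mod int p) then int p else 0) - 1"
proof -
  define R where "R = (\<lambda>w. \<Sum>a\<in>residues_p. leg a * leg (a + w))"
  have R0: "R 0 = int p - 1" by (simp add: R_def sum_leg_sq)
  have Rw: "R w = R 1" if "\<not> int p dvd w" for w
  proof -
    have "R w = (\<Sum>a\<in>residues_p. leg (w * a + 0) * leg (w * a + 0 + w))"
      unfolding R_def
      by (rule sum_residues_reindex[of "\<lambda>a. leg a * leg (a + w)", OF _ that, symmetric])
         (intro arg_cong2[where f = "(*)"] leg_cong cong_add cong_refl)
    also have "\<dots> = (\<Sum>a\<in>residues_p. (leg w * leg w) * (leg a * leg (a + 1)))"
      by (intro sum.cong refl) (simp add: leg_mult flip: distrib_left, simp add: leg_mult distrib_left[of w _ 1, simplified, symmetric])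
    finally show ?thesis using that by (simp add: leg_square R_def)
  qed
  have "(\<Sum>w\<in>residues_p. R w) = (\<Sum>a\<in>residues_p. leg a * (\<Sum>w\<in>residues_p. leg (w + a)))"
    unfolding R_def by (subst sum.swap) (simp add: sum_distrib_left add.commute)
  then have "(\<Sum>w\<in>residues_p. R w) = 0" by (simp add: sum_leg_shift)
  moreover have "residues_p = insert 0 {1..<int p}" using p_gt_2 by auto
  then have "(\<Sum>w\<in>residues_p. R w) = R 0 + (\<Sum>w\<in>{1..<int p}. R w)" by simp
  moreover have "(\<Sum>w\<in>{1..<int p}. R w) = (\<Sum>w\<in>{1..<int p}. R 1)"
    by (intro sum.cong refl Rw) (use zdvd_not_zless in force)
  ultimately have "(int p - 1) * (1 + R 1) = 0" using R0 p_gt_2 by (simp add: algebra_simps)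
  then have R1: "R 1 = -1" using p_gt_2 by auto
  have "\<not> int p dvd 1" using p_gt_2 by simp
  then have "(\<Sum>a\<in>residues_p. leg (u + a) * leg (v + a)) = (\<Sum>a\<in>residues_p. leg (u + (1 * a + - u)) * leg (v + (1 * a + - u)))"
    by (intro sum_residues_reindex[of "\<lambda>a. leg (u + a) * leg (v + a)", symmetric]
         arg_cong2[where f = "(*)"] leg_cong cong_add cong_refl)
  also have "\<dots> = R (v - u)" by (simp add: R_def algebra_simps)
  also have "\<dots> = (if [u = v] (mod int p) then int p else 0) - 1"
  proof (cases "int p dvd v - u")
    case True
    then have "[v - u = 0] (mod int p)" by (simp add: cong_0_iff)
    then have "R (v - u) = R 0" unfolding R_def
      by (intro sum.cong refl arg_cong2[where f = "(*)"] leg_cong cong_add cong_refl)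
    moreover have "[u = v] (mod int p)" using True by (simp add: cong_iff_dvd_diff dvd_diff_commute)
    ultimately show ?thesis using R0 by simp
  next
    case False
    then have "\<not> [u = v] (mod int p)" by (simp add: cong_iff_dvd_diff dvd_diff_commute)
    then show ?thesis using Rw[OF False] R1 by simp
  qed
  finally show ?thesis .
qed

section \<open>Jacobsthal sums and the representation of p by two squares\<close>

definition jacobsthal :: "int \<Rightarrow> int" where
  "jacobsthal a = (\<Sum>x\<in>residues_p. leg (x * (x ^ 2 + a)))"

lemma jacobsthal_cong: "[a = b] (mod int p) \<Longrightarrow> jacobsthal a = jacobsthal b"
  unfolding jacobsthal_def by (intro sum.cong refl leg_cong cong_mult cong_add cong_refl)

lemma jacobsthal_scale: "\<not> int p dvd c \<Longrightarrow> jacobsthal (a * c ^ 2) = leg c * jacobsthal a"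
proof -
  assume c: "\<not> int p dvd c"
  have "jacobsthal (a * c ^ 2) = (\<Sum>x\<in>residues_p. leg ((c * x + 0) * ((c * x + 0) ^ 2 + a * c ^ 2)))"
    unfolding jacobsthal_def
    by (rule sum_residues_reindex[of "\<lambda>x. leg (x * (x ^ 2 + a * c ^ 2))", OF _ c, symmetric])
       (intro leg_cong cong_mult cong_add cong_pow cong_refl)
  also have "\<dots> = (\<Sum>x\<in>residues_p. leg (c * (c * c) * (x * (x ^ 2 + a))))"
    by (intro sum.cong refl arg_cong[where f = leg]) (simp add: power2_eq_square algebra_simps)
  also have "\<dots> = leg c * jacobsthal a"
    unfolding leg_mult[of "c * (c * c)"] leg_mult[of c] leg_square jacobsthal_def
    using c by (simp add: sum_distrib_left)
  finally show ?thesis .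
qed

lemma jacobsthal_scale_square:
  assumes "\<not> int p dvd c"
  shows "jacobsthal (a * c ^ 2) ^ 2 = jacobsthal a ^ 2"
  unfolding jacobsthal_scale[OF assms] power_mult_distrib
  using assms leg_square[of c] by (simp add: power2_eq_square)

text \<open>If a b is a square c^2 modulo p, then a c^2 and b a^2 agree modulo p, and scaling by a
  square changes the sum only by a sign. So the squared sum depends only on the quadratic character
  of a.\<close>

lemma jacobsthal_square_eq:
  assumes "leg a = leg b" "leg a \<noteq> 0"
  shows "jacobsthal a ^ 2 = jacobsthal b ^ 2"
proof -
  have nd: "\<not> int p dvd a" "\<not> int p dvd b" using assms by (simp_all flip: leg_eq_0_iff)
  have "leg (a * b) = 1" using assms leg_range[of b] by (auto simp: leg_mult)
  then obtain c where c: "[c ^ 2 = a * b] (mod int p)"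
    unfolding Legendre_def QuadRes_def by (auto split: if_splits)
  have "\<not> int p dvd c"
  proof
    assume "int p dvd c"
    then have "int p dvd c ^ 2" by (simp add: power2_eq_square)
    then have "int p dvd a * b" using c cong_dvd_iff by blast
    then show False using nd prime_int_p prime_dvd_mult_iff by blast
  qed
  then have "jacobsthal (a * c ^ 2) ^ 2 = jacobsthal a ^ 2"
    by (rule jacobsthal_scale_square)
  moreover have "jacobsthal (a * c ^ 2) = jacobsthal (b * a ^ 2)"
    using cong_mult[OF cong_refl[of a] c] by (intro jacobsthal_cong) (simp add: power2_eq_square ac_simps)
  moreover have "jacobsthal (b * a ^ 2) ^ 2 = jacobsthal b ^ 2"
    using nd by (intro jacobsthal_scale_square)
  ultimately show ?thesis by simp
qed

text \<open>Summing over a first gives the correlation of x^2 and y^2, so only y = x and y = -x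
  survive. As -1 is a residue, both contribute equally.\<close>

lemma sum_jacobsthal_square:
  assumes m1: "leg (-1) = 1"
  shows "(\<Sum>a\<in>residues_p. jacobsthal a ^ 2) = 2 * int p * (int p - 1)"
proof -
  have "(\<Sum>a\<in>residues_p. jacobsthal a ^ 2) =
     (\<Sum>a\<in>residues_p. \<Sum>x\<in>residues_p. \<Sum>y\<in>residues_p. leg x * leg y * (leg (x ^ 2 + a) * leg (y ^ 2 + a)))"
    unfolding jacobsthal_def power2_eq_square[of "sum _ _"] sum_product leg_mult
    by (intro sum.cong refl) simp
  also have "\<dots> = (\<Sum>x\<in>residues_p. \<Sum>y\<in>residues_p. leg x * leg y * (\<Sum>a\<in>residues_p. leg (x ^ 2 + a) * leg (y ^ 2 + a)))"
    unfolding sum_distrib_left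
    by (subst sum.swap, rule sum.cong[OF refl], rule sum.swap)
  also have "\<dots> = (\<Sum>x\<in>residues_p. \<Sum>y\<in>residues_p. int p * (leg x * (if [x ^ 2 = y ^ 2] (mod int p) then leg y else 0)) - leg x * leg y)"
    unfolding sum_leg_product by (intro sum.cong refl) (simp add: algebra_simps)
  also have "\<dots> = int p * (\<Sum>x\<in>residues_p. leg x * (\<Sum>y\<in>residues_p. if [x ^ 2 = y ^ 2] (mod int p) then leg y else 0))
      - (\<Sum>x\<in>residues_p. leg x) * (\<Sum>y\<in>residues_p. leg y)"
    unfolding sum_product by (simp add: sum_subtractf sum_distrib_left)
  also have "(\<Sum>x\<in>residues_p. leg x * (\<Sum>y\<in>residues_p. if [x ^ 2 = y ^ 2] (mod int p) then leg y else 0))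
     = (\<Sum>x\<in>residues_p. 2 * (leg x * leg x))"
  proof (intro sum.cong refl)
    fix x assume x: "x \<in> residues_p"
    show "leg x * (\<Sum>y\<in>residues_p. if [x ^ 2 = y ^ 2] (mod int p) then leg y else 0) = 2 * (leg x * leg x)"
    proof (cases "x = 0")
      case False
      have "(\<Sum>y\<in>residues_p. if [x ^ 2 = y ^ 2] (mod int p) then leg y else 0)
         = (\<Sum>y\<in>{y \<in> residues_p. [x ^ 2 = y ^ 2] (mod int p)}. leg y)"
        by (rule sum.inter_filter[symmetric]) simp
      also have "{y \<in> residues_p. [x ^ 2 = y ^ 2] (mod int p)} = {x, int p - x}"
      proof -
        have "[x ^ 2 = y ^ 2] (mod int p) \<longleftrightarrow> y = x \<or> y = int p - x" if y: "y \<in> residues_p" for y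
        proof -
          have "[x ^ 2 = y ^ 2] (mod int p) \<longleftrightarrow> int p dvd (x - y) * (x + y)"
            by (simp add: cong_iff_dvd_diff power2_eq_square algebra_simps)
          also have "\<dots> \<longleftrightarrow> int p dvd x - y \<or> int p dvd x + y"
            using prime_int_p prime_dvd_mult_iff by blast
          also have "int p dvd x - y \<longleftrightarrow> y = x"
          proof
            assume "int p dvd x - y"
            then have "[x = y] (mod int p)" by (simp add: cong_iff_dvd_diff)
            then show "y = x" using x y by (simp add: cong_def)
          qed simp
          also have "int p dvd x + y \<longleftrightarrow> y = int p - x"
          proof
            assume "int p dvd x + y"
            then obtain k where k: "x + y = int p * k" by (auto simp: dvd_def)
            have "0 < x + y" "x + y < int p * 2" using x y False by auto
            then have "0 < k" "k < 2" unfolding k using p_gt_2 by (simp_all add: zero_less_mult_iff)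
            then have "k = 1" by simp
            then show "y = int p - x" using k by simp
          qed simp
          finally show ?thesis .
        qed
        then show ?thesis using x False by auto
      qed
      also have "(\<Sum>y\<in>{x, int p - x}. leg y) = leg x + leg (int p - x)"
      proof -
        have "x \<noteq> int p - x" using odd_p by presburger
        then show ?thesis by simp
      qed
      also have "leg (int p - x) = leg ((-1) * x)" by (rule leg_cong) (simp add: cong_iff_dvd_diff)
      also have "\<dots> = leg x" unfolding leg_mult m1 by simp
      finally show ?thesis by simp
    qed simp
  qed
  also have "\<dots> = 2 * (int p - 1)" by (simp add: sum_leg_sq flip: sum_distrib_left)
  finally show ?thesis by (simp add: sum_leg_0)
qed

text \<open>The squared sums take one value A on residues and one value B on nonresidues; the second
  moment determines A + B.\<close>

lemma jacobsthal_sum_of_squares: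
  assumes m1: "leg (-1) = 1"
  obtains b where "jacobsthal (-1) ^ 2 + b ^ 2 = 4 * int p"
proof -
  obtain g where g: "leg g = -1" by (rule nonresidue_exists)
  define A where "A = jacobsthal (-1) ^ 2"
  define B where "B = jacobsthal g ^ 2"
  \<comment> \<open>This interpolates the three cases by the Legendre symbol, so the known sums of
    \<open>leg a\<close> and its square replace a count of residues and nonresidues.\<close>
  have "2 * jacobsthal a ^ 2 = (leg a * leg a) * (A + B) + leg a * (A - B)" if "a \<in> residues_p" for a
  proof -
    consider "leg a = 0" | "leg a = 1" | "leg a = -1" using leg_range[of a] by auto
    then show ?thesis
    proof cases
      case 1
      then have "a = 0" using that leg_eq_0_iff residues_p_dvd by blast
      moreover have "jacobsthal 0 = (\<Sum>x\<in>residues_p. leg x)" unfolding jacobsthal_def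
      proof (intro sum.cong refl)
        fix x
        show "leg (x * (x ^ 2 + 0)) = leg x" using leg_range[of x] by (auto simp: leg_mult power2_eq_square)
      qed
      ultimately show ?thesis using 1 by (simp add: sum_leg_0)
    next
      case 2
      then show ?thesis using jacobsthal_square_eq[of a "-1"] m1 by (simp add: A_def)
    next
      case 3
      then show ?thesis using jacobsthal_square_eq[of a g] g by (simp add: B_def)
    qed
  qed
  then have "(\<Sum>a\<in>residues_p. 2 * jacobsthal a ^ 2) = (\<Sum>a\<in>residues_p. (leg a * leg a) * (A + B) + leg a * (A - B))"
    by (intro sum.cong) auto
  also have "\<dots> = (int p - 1) * (A + B)"
    by (simp add: sum.distrib sum_leg_sq sum_leg_0 flip: sum_distrib_right)
  finally have "2 * (2 * int p * (int p - 1)) = (int p - 1) * (A + B)"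
    using sum_jacobsthal_square[OF m1] by (simp flip: sum_distrib_left)
  then have "(int p - 1) * (A + B) = (int p - 1) * (4 * int p)" by (simp add: algebra_simps)
  then have "A + B = 4 * int p" using p_gt_2 by simp
  then show ?thesis unfolding A_def B_def by (rule that)
qed

text \<open>The summand is invariant under x to p - x, so the sum is twice its first half. Among the
  n = (p-1)/2 terms of that half only x = 1 gives 0, leaving n - 1 terms equal to 1 or -1, an odd
  number.\<close>

lemma jacobsthal_half_odd:
  assumes m1: "leg (-1) = 1" and n: "even ((p - 1) div 2)"
  obtains a where "jacobsthal (-1) = 2 * a" "odd a"
proof -
  define n where "n = int ((p - 1) div 2)"
  have pn: "int p = 2 * n + 1" unfolding n_def using odd_p by (auto elim!: oddE)
  have n2: "n \<ge> 2" using n p_gt_2 unfolding n_def by (auto elim!: evenE)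
  define f where "f = (\<lambda>x. leg (x * (x ^ 2 + -1)))"
  have fneg: "f (int p - x) = f x" for x
  proof -
    have "f (int p - x) = leg ((-1) * (x * (x ^ 2 + -1)))" unfolding f_def
      by (rule leg_cong) (simp add: cong_iff_dvd_diff power2_eq_square algebra_simps)
    then show ?thesis unfolding leg_mult[of "-1"] m1 f_def by simp
  qed
  define a where "a = (\<Sum>x\<in>{1..n}. f x)"
  have "jacobsthal (-1) = (\<Sum>x\<in>insert 0 ({1..n} \<union> {n + 1..int p - 1}). f x)"
    unfolding jacobsthal_def f_def by (rule sum.cong) (use pn n2 in auto)
  also have "\<dots> = f 0 + ((\<Sum>x\<in>{1..n}. f x) + (\<Sum>x\<in>{n + 1..int p - 1}. f x))"
    using n2 by (simp add: sum.union_disjoint)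
  also have "(\<Sum>x\<in>{n + 1..int p - 1}. f x) = (\<Sum>x\<in>{1..n}. f x)"
    by (rule sum.reindex_bij_witness[of _ "\<lambda>x. int p - x" "\<lambda>x. int p - x"]) (use pn fneg in auto)
  also have "f 0 = 0" by (simp add: f_def)
  finally have 1: "jacobsthal (-1) = 2 * a" by (simp add: a_def)
  have "{x \<in> {1..n}. odd (f x)} = {2..n}"
  proof -
    have "odd (f x) \<longleftrightarrow> x \<noteq> 1" if x: "x \<in> {1..n}" for x
    proof -
      have "odd (f x) \<longleftrightarrow> f x \<noteq> 0" using leg_range[of "x * (x ^ 2 + -1)"] unfolding f_def by auto
      also have "\<dots> \<longleftrightarrow> \<not> int p dvd x * ((x - 1) * (x + 1))"
        unfolding f_def leg_eq_0_iff by (simp add: power2_eq_square algebra_simps)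
      also have "\<dots> \<longleftrightarrow> \<not> int p dvd x \<and> \<not> int p dvd x - 1 \<and> \<not> int p dvd x + 1"
        using prime_int_p by (simp add: prime_dvd_mult_iff)
      also have "\<dots> \<longleftrightarrow> x \<noteq> 1"
        using x pn n2 residues_p_dvd[of x] residues_p_dvd[of "x - 1"] residues_p_dvd[of "x + 1"] by auto
      finally show ?thesis .
    qed
    then show ?thesis using n2 by auto
  qed
  then have "even a \<longleftrightarrow> even (card {2..n})" unfolding a_def by (simp add: even_sum_iff)
  then have "odd a" using n n2 unfolding n_def by (auto simp: nat_diff_distrib)
  then show ?thesis using 1 that by blast
qed

text \<open>Halving both squares gives p = a^2 + b^2 with a odd. Such a representation is unique up
  to order and signs, and parity distinguishes x from 2y.\<close>

lemma jacobsthal_two_squares: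
  assumes m1: "leg (-1) = 1" and n: "even ((p - 1) div 2)" and xy: "int p = x ^ 2 + 4 * y ^ 2"
  shows "jacobsthal (-1) ^ 2 = 4 * x ^ 2"
proof -
  obtain a where a: "jacobsthal (-1) = 2 * a" "odd a" by (rule jacobsthal_half_odd[OF m1 n])
  obtain b' where b': "jacobsthal (-1) ^ 2 + b' ^ 2 = 4 * int p" by (rule jacobsthal_sum_of_squares[OF m1])
  then have "b' ^ 2 = 4 * (int p - a ^ 2)" using a by (simp add: power_mult_distrib)
  then have "even (b' ^ 2)" by simp
  then obtain b where "b' = 2 * b" by auto
  then have ab: "a ^ 2 + b ^ 2 = int p" using b' a by (simp add: power_mult_distrib)
  define z where "z = 2 * y"
  have xz: "x ^ 2 + z ^ 2 = int p" using xy by (simp add: z_def power_mult_distrib)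
  have "(a * z - b * x) * (a * z + b * x) = a ^ 2 * z ^ 2 - b ^ 2 * x ^ 2"
    by (simp add: power2_eq_square algebra_simps)
  also have "\<dots> = int p * (a ^ 2 - x ^ 2)"
  proof -
    have b2: "b ^ 2 = int p - a ^ 2" and z2: "z ^ 2 = int p - x ^ 2" using ab xz by auto
    show ?thesis unfolding b2 z2 by (simp add: algebra_simps)
  qed
  finally have "int p dvd (a * z - b * x) * (a * z + b * x)" by simp
  then have dd: "int p dvd a * z - b * x \<or> int p dvd a * z + b * x"
    using prime_int_p prime_dvd_mult_iff by blast
  \<comment> \<open>The sign of b is chosen so that p divides this particular linear factor.\<close>
  obtain c where c: "c = b \<or> c = - b" and d: "int p dvd a * z - c * x"
    using dd that[of b] that[of "- b"] by auto
  have ac: "a ^ 2 + c ^ 2 = int p" using ab c by auto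
  have sq: "(a * z - c * x) ^ 2 + (a * x + c * z) ^ 2 = int p ^ 2"
  proof -
    have "(a * z - c * x) ^ 2 + (a * x + c * z) ^ 2 = (a ^ 2 + c ^ 2) * (x ^ 2 + z ^ 2)"
      by (simp add: power2_eq_square algebra_simps)
    then show ?thesis by (simp only: ac xz power2_eq_square[of "int p"])
  qed
  obtain k where k: "a * z - c * x = int p * k" using d by (auto simp: dvd_def)
  \<comment> \<open>By \<open>sq\<close> the two squares add up to p^2. For k = 0 the claim follows
    by eliminating c and z. Otherwise the first square already exhausts p^2, which forces a^2 =
    (2y)^2 against a being odd.\<close>
  have "a ^ 2 = x ^ 2"
  proof (cases "k = 0")
    case True
    then have "a * z = c * x" using k by simp
    then have "a ^ 2 * z ^ 2 = c ^ 2 * x ^ 2" by (metis power_mult_distrib)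
    moreover have "c ^ 2 = int p - a ^ 2" "z ^ 2 = int p - x ^ 2" using ac xz by auto
    ultimately have "int p * a ^ 2 = int p * x ^ 2" by (simp add: algebra_simps)
    then show ?thesis using p_gt_2 by simp
  next
    case False
    then have "k ^ 2 \<ge> 1" by (simp add: int_one_le_iff_zero_less)
    then have "int p ^ 2 * 1 \<le> int p ^ 2 * k ^ 2" by (intro mult_left_mono) auto
    then have "(a * x + c * z) ^ 2 \<le> 0" using sq unfolding k power_mult_distrib by linarith
    then have "a * x = - (c * z)" by simp
    then have "a ^ 2 * x ^ 2 = c ^ 2 * z ^ 2" by (metis power_mult_distrib power2_minus)
    moreover have "c ^ 2 = int p - a ^ 2" "z ^ 2 = int p - x ^ 2" using ac xz by auto
    ultimately have "int p * (a ^ 2 + x ^ 2) = int p * int p" by (simp add: algebra_simps)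
    then have "a ^ 2 + x ^ 2 = int p" using p_gt_2 by simp
    then have "a ^ 2 = z ^ 2" using xz by simp
    then have "even (a ^ 2)" by (simp add: z_def)
    then show ?thesis using a by simp
  qed
  then show ?thesis using a by (simp add: power_mult_distrib)
qed

end

section \<open>The Jacobsthal sum modulo the square of p\<close>

context odd_prime
begin

section \<open>Legendre symbols and power sums modulo p^2 by means of p-th powers\<close>

lemma Zp_of_int_pow: "(of_int x :: rat) ^ k \<in> Zp"
  by (intro Zp_power Zp_of_int)

lemma pcong_add_p_power:
  assumes "b \<in> Zp" "w \<in> Zp"
  shows "pcong 2 ((b + of_nat p * w) ^ m) (b ^ m + of_nat m * (of_nat p * w * b ^ (m - 1)))"
proof (induction m)
  case 0
  show ?case by simp
next
  case (Suc m)
  define q where "q = (of_nat p :: rat)"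
  have bw: "b + q * w \<in> Zp" using assms by (simp add: q_def Zp_add Zp_mult)
  have "pcong 2 ((b + q * w) ^ Suc m) ((b + q * w) * (b ^ m + of_nat m * (q * w * b ^ (m - 1))))"
    unfolding power_Suc using Suc.IH bw unfolding q_def by (rule pcong_mult_left)
  also have "pcong 2 \<dots> (b ^ Suc m + of_nat (Suc m) * (q * w * b ^ (Suc m - 1)))"
  proof (rule pcongI)
    have "of_nat m * (b * b ^ (m - 1)) = of_nat m * b ^ m" by (cases m) simp_all
    then have e: "of_nat m * (b * (x * b ^ (m - 1))) = of_nat m * b ^ m * x" for x
      by (simp add: mult.left_commute mult.commute[of x] flip: mult.assoc)
    have "(b + q * w) * (b ^ m + of_nat m * (q * w * b ^ (m - 1))) =
      b ^ Suc m + q * w * b ^ m + of_nat m * (b * ((q * w) * b ^ (m - 1))) + q ^ 2 * (of_nat m * w ^ 2 * b ^ (m - 1))"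
      by (simp add: power2_eq_square algebra_simps)
    then show "(b + q * w) * (b ^ m + of_nat m * (q * w * b ^ (m - 1))) - (b ^ Suc m + of_nat (Suc m) * (q * w * b ^ (Suc m - 1)))
        = of_nat p ^ 2 * (of_nat m * w ^ 2 * b ^ (m - 1))"
      unfolding e q_def[symmetric] by (simp add: algebra_simps)
    show "of_nat m * w ^ 2 * b ^ (m - 1) \<in> Zp" using assms by (intro Zp_mult Zp_power Zp_of_nat)
  qed
  finally show ?case by (simp only: q_def)
qed

text \<open>In the first-order binomial expansion the linear term has one factor p from the exponent
  and one from the difference.\<close>

lemma pcong_pth_power:
  assumes "pcong 1 a b" "b \<in> Zp"
  shows "pcong 2 (a ^ p) (b ^ p)"
proof -
  obtain w where w: "w \<in> Zp" "a = b + of_nat p * w" using assms(1) by (auto elim: pcongE)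
  have "pcong 2 (a ^ p) (b ^ p + of_nat p * (of_nat p * w * b ^ (p - 1)))"
    unfolding w(2) by (rule pcong_add_p_power[OF assms(2) w(1)])
  also have "pcong 2 \<dots> (b ^ p)"
    using w(1) assms(2) by (intro pcongI[of _ _ _ "w * b ^ (p - 1)"] Zp_mult Zp_power) (simp_all add: power2_eq_square)
  finally show ?thesis .
qed

lemma pcong_of_int1: "[a = b] (mod int p) \<Longrightarrow> pcong 1 (of_int a) (of_int b)"
  using pcong_of_int[of a b 1] by simp

lemma cong_if_pcong: "pcong k (of_int a) (of_int b) \<Longrightarrow> [a = b] (mod (int p ^ k))"
proof -
  assume "pcong k (of_int a) (of_int b)"
  then obtain u v where uv: "\<not> int p dvd v" "of_int a - of_int b = (of_nat p ^ k * (of_int u / of_int v) :: rat)"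
    unfolding pcong_def Zp_def by blast
  then have "v \<noteq> 0" by auto
  then have "(of_int a - of_int b) * of_int v = (of_nat p ^ k * of_int u :: rat)" unfolding uv(2) by simp
  then have "of_int ((a - b) * v) = (of_int (int p ^ k * u) :: rat)" by simp
  then have "(a - b) * v = int p ^ k * u" by (simp only: of_int_eq_iff)
  then have "int p ^ k dvd (a - b) * v" by simp
  moreover have "coprime (int p ^ k) v" using uv(1) prime_int_p by (simp add: prime_imp_coprime)
  ultimately show ?thesis by (simp add: coprime_dvd_mult_left_iff cong_iff_dvd_diff)
qed

lemma int_Fermat_pred: "\<not> int p dvd x \<Longrightarrow> [x ^ (p - 1) = 1] (mod int p)"
proof -
  assume x: "\<not> int p dvd x"
  have "p - 1 = half_p + half_p" by (subst p_eq_half_p) simp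
  then have "x ^ (p - 1) = x ^ half_p * x ^ half_p" by (metis power_add)
  then have "[leg x * leg x = x ^ (p - 1)] (mod int p)"
    using cong_mult[OF leg_euler leg_euler, of x x] by (simp only:)
  then show ?thesis using x by (simp add: leg_square cong_sym_eq)
qed

lemma int_Fermat: "[x ^ p = x] (mod int p)"
proof -
  have e: "x ^ p = x * x ^ (p - 1)" using p_gt_2 by (simp add: power_eq_if)
  show ?thesis
  proof (cases "int p dvd x")
    case True
    then show ?thesis unfolding e by (simp add: cong_iff_dvd_diff)
  next
    case False
    then show ?thesis unfolding e using cong_mult[OF cong_refl int_Fermat_pred, of x x] by simp
  qed
qed

text \<open>Euler's criterion raised to the p-th power; the symbol is its own p-th power since p is
  odd.\<close>

lemma pcong_leg: "pcong 2 (of_int (leg a)) ((of_int a ^ half_p) ^ p)"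
proof -
  have "pcong 1 (of_int a ^ half_p) (of_int (leg a))"
    using pcong_sym[OF pcong_of_int1[OF leg_euler[of a]]] by simp
  then have "pcong 2 ((of_int a ^ half_p) ^ p) (of_int (leg a) ^ p)" by (rule pcong_pth_power) simp
  moreover have "of_int (leg a) ^ p = (of_int (leg a) :: rat)"
    using leg_range[of a] odd_p p_gt_2 by auto
  ultimately show ?thesis using pcong_sym by simp
qed

text \<open>So x^p is, modulo p^2, the Teichmueller representative of x.\<close>

lemma pcong_teichmuller: "pcong 2 ((of_int x ^ p) ^ p) ((of_int x :: rat) ^ p)"
  using pcong_pth_power[OF pcong_of_int1[OF int_Fermat[of x]]] by simp

text \<open>If p - 1 divides k, each nonzero x contributes 1, and x = 0 contributes 0 because k > 0.
  Otherwise multiplication by a primitive root g multiplies the sum by G = g^(pk); modulo p this is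
  g^k, which is not 1, so G - 1 is a unit and the sum vanishes.\<close>

lemma power_sum_pcong:
  assumes k: "k > 0"
  shows "pcong 2 (\<Sum>x\<in>residues_p. (of_int x ^ p) ^ k) (if (p - 1) dvd k then of_nat p - 1 else 0)"
proof (cases "(p - 1) dvd k")
  case True
  then obtain d where d: "k = (p - 1) * d" by (auto simp: dvd_def)
  have "residues_p = insert 0 {1..<int p}" using p_gt_2 by auto
  then have "(\<Sum>x\<in>residues_p. ((of_int x :: rat) ^ p) ^ k) = (\<Sum>x\<in>{1..<int p}. (of_int x ^ p) ^ k)"
    using k p_gt_2 by (simp add: power_0_left)
  also have "pcong 2 \<dots> (\<Sum>x\<in>{1..<int p}. 1)"
  proof (rule pcong_sum)
    fix x assume "x \<in> {1..<int p}"
    then have "\<not> int p dvd x" using zdvd_not_zless by force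
    then have "pcong 1 (of_int x ^ (p - 1)) 1" using pcong_of_int1[OF int_Fermat_pred] by force
    then have "pcong 2 ((of_int x ^ (p - 1)) ^ p) (1 ^ p)" by (rule pcong_pth_power) simp
    then have "pcong 2 (((of_int x ^ (p - 1)) ^ p) ^ d) (1 ^ d)" by (intro pcong_power) simp_all
    then show "pcong 2 ((of_int x ^ p) ^ k) 1" unfolding d by (simp add: mult.commute mult.left_commute flip: power_mult)
  qed
  also have "(\<Sum>x\<in>{1..<int p}. 1) = (of_nat p - 1 :: rat)" using p_gt_2 by (simp add: of_nat_diff nat_diff_distrib)
  finally show ?thesis using True by simp
next
  case False
  obtain g :: nat where g: "\<not> p dvd g" "\<And>k. [g ^ k = 1] (mod p) \<longleftrightarrow> (p - 1) dvd k"
    using primitive_root_exists by blast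
  \<comment> \<open>Reduction to the canonical residue makes the summand exactly p-periodic, as the
    reindexing rule demands equality and not congruence.\<close>
  define F where "F = (\<lambda>x :: int. (x ^ p) ^ k mod (int p ^ 2))"
  define S where "S = (\<Sum>x\<in>residues_p. ((of_int x :: rat) ^ p) ^ k)"
  have FS: "pcong 2 (of_int (F x)) ((of_int x ^ p) ^ k)" for x
    using pcong_of_int[of "F x" "(x ^ p) ^ k" 2] by (simp add: F_def)
  have Fper: "F a = F b" if "[a = b] (mod int p)" for a b
  proof -
    have "[a ^ p = b ^ p] (mod (int p ^ 2))"
    proof -
      have "pcong 2 (of_int (a ^ p)) (of_int (b ^ p))" using pcong_pth_power[OF pcong_of_int1[OF that]] by simp
      then show ?thesis by (rule cong_if_pcong)
    qed
    then have "[(a ^ p) ^ k = (b ^ p) ^ k] (mod (int p ^ 2))" by (rule cong_pow)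
    then show ?thesis by (simp add: F_def cong_def)
  qed
  define G where "G = ((of_nat g :: rat) ^ p) ^ k"
  have "pcong 2 S (\<Sum>x\<in>residues_p. of_int (F x))" unfolding S_def by (intro pcong_sum pcong_sym[OF FS])
  also have "(\<Sum>x\<in>residues_p. of_int (F x)) = (\<Sum>x\<in>residues_p. (of_int (F (int g * x + 0)) :: rat))"
    using g(1) Fper by (intro sum_residues_reindex[symmetric]) auto
  also have "pcong 2 \<dots> (\<Sum>x\<in>residues_p. (of_int (int g * x + 0) ^ p) ^ k)" by (intro pcong_sum FS)
  also have "\<dots> = G * S" by (simp add: G_def S_def sum_distrib_left power_mult_distrib)
  finally have "pcong 2 (G * S - S) 0"
    using pcong_diff[OF pcong_sym pcong_refl, of 2 S "G * S" S] by simp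
  then have "pcong 2 ((G - 1) * S) ((G - 1) * 0)" by (simp add: algebra_simps)
  moreover have "Zp_unit (G - 1)"
  proof -
    have "g \<ge> 1" using g(1) by (cases g) auto
    then have "(g ^ p) ^ k \<ge> 1" by simp
    then have "G - 1 = of_nat ((g ^ p) ^ k - 1)" by (simp add: G_def of_nat_diff)
    moreover have "\<not> p dvd (g ^ p) ^ k - 1"
    proof
      assume "p dvd (g ^ p) ^ k - 1"
      then have "[(g ^ p) ^ k = 1] (mod p)" using \<open>(g ^ p) ^ k \<ge> 1\<close> by (simp add: cong_altdef_nat)
      moreover have "[g ^ p = g] (mod p)" using int_Fermat[of "int g"] by (metis cong_int_iff of_nat_power)
      then have "[(g ^ p) ^ k = g ^ k] (mod p)" by (rule cong_pow)
      ultimately have "[g ^ k = 1] (mod p)" using cong_sym cong_trans by blast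
      then show False using g(2) False by blast
    qed
    ultimately show ?thesis using Zp_unit_of_nat by simp
  qed
  ultimately have "pcong 2 S 0" by (rule pcong_cancel)
  then show ?thesis using False by (simp add: S_def)
qed

lemma one_minus_power_expand: "(1 - t :: rat) ^ k = (\<Sum>j\<le>k. (-1) ^ j * of_nat (k choose j) * t ^ j)"
proof -
  have "(1 - t) ^ k = (- t + 1) ^ k" by simp
  also have "\<dots> = (\<Sum>j\<le>k. of_nat (k choose j) * (- t) ^ j)" unfolding binomial_ring by simp
  also have "\<dots> = (\<Sum>j\<le>k. (-1) ^ j * of_nat (k choose j) * t ^ j)"
    by (intro sum.cong refl) (simp add: power_minus[of t])
  finally show ?thesis .
qed

text \<open>The inner binomials of row p are multiples of p, and their contribution is p times the
  truncated logarithm of 1 - t.\<close>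

lemma one_minus_pth_power_pcong:
  assumes t: "t \<in> Zp" "pcong 2 (t ^ p) t"
  shows "pcong 2 ((1 - t) ^ p) (1 - t + of_nat p * - (\<Sum>i\<in>{1..<p}. t ^ i / of_nat i))"
proof -
  have "{..p} = insert 0 (insert p {1..<p})" using p_gt_2 by auto
  moreover have "p \<noteq> 0" using p_gt_2 by auto
  ultimately have "(1 - t) ^ p = 1 - t ^ p + (\<Sum>i\<in>{1..<p}. (-1) ^ i * of_nat (p choose i) * t ^ i)"
    unfolding one_minus_power_expand using odd_p by simp
  also have "pcong 2 \<dots> (1 - t + (\<Sum>i\<in>{1..<p}. - (of_nat p * (t ^ i / of_nat i))))"
  proof (intro pcong_add pcong_diff pcong_refl t pcong_sum)
    fix i assume i: "i \<in> {1..<p}"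
    have "pcong 2 ((-1) ^ i * t ^ i * of_nat (p choose i)) ((-1) ^ i * t ^ i * (of_nat p * (- ((-1) ^ i / of_nat i))))"
      using i t by (intro pcong_mult_left pcong_choose_p Zp_mult Zp_power Zp_uminus) auto
    moreover have "(-1) ^ i * t ^ i * (of_nat p * (- ((-1) ^ i / of_nat i))) = - (of_nat p * (t ^ i / of_nat i))"
      by (cases "even i") simp_all
    ultimately show "pcong 2 ((-1) ^ i * of_nat (p choose i) * t ^ i) (- (of_nat p * (t ^ i / of_nat i)))"
      by (simp add: ac_simps)
  qed
  also have "1 - t + (\<Sum>i\<in>{1..<p}. - (of_nat p * (t ^ i / of_nat i))) = 1 - t + of_nat p * - (\<Sum>i\<in>{1..<p}. t ^ i / of_nat i)"
    by (simp add: sum_negf sum_distrib_left)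
  finally show ?thesis .
qed

text \<open>The first sum needs the power sums modulo p^2, where they are (p-1)
  \<open>\<iota>\<close>. The second carries a factor p, so modulo p they are just
  -\<open>\<iota>\<close>; this sign cancels the one of the truncated logarithm.\<close>

lemma jacobsthal_pcong_expand:
  assumes m1: "leg (-1) = 1"
  defines "\<iota> \<equiv> \<lambda>k. if (p - 1) dvd k then 1 else 0 :: rat"
  shows "pcong 2 (of_int (jacobsthal (-1)))
     ((\<Sum>j\<le>half_p. (-1) ^ j * of_nat (half_p choose j) * ((of_nat p - 1) * \<iota> (half_p + 2 * j)))
      + of_nat p * (of_nat half_p * (\<Sum>j\<le>half_p - 1. \<Sum>i\<in>{1..<p}. (-1) ^ j * of_nat (half_p - 1 choose j) / of_nat i * \<iota> (half_p + 2 * j + 2 * i))))"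
proof -
  define s where "s = (\<lambda>x :: int. (of_int x :: rat) ^ p)"
  define L where "L = (\<lambda>t. \<Sum>i\<in>{1..<p}. t ^ i / of_nat i :: rat)"
  have sZ: "s x \<in> Zp" for x unfolding s_def by (rule Zp_of_int_pow)
  have LZ: "L t \<in> Zp" if "t \<in> Zp" for t
    unfolding L_def using that by (intro Zp_sum Zp_divide Zp_power Zp_unit_small) auto
  have tm: "pcong 2 (of_int (leg (x * (x ^ 2 + -1)))) (s x ^ half_p * (1 - s x ^ 2) ^ half_p + of_nat p * (- of_nat half_p * (s x ^ half_p * (1 - s x ^ 2) ^ (half_p - 1) * L (s x ^ 2))))" for x
  proof -
    \<comment> \<open>As -1 is a residue, x^2 - 1 may become 1 - x^2. Replacing x by x^p inside does
      not change the symbol and makes t = s^2 satisfy the hypothesis on t^p.\<close>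
    have "leg (x * (x ^ 2 + -1)) = leg (-1) * leg (x * (x ^ 2 + -1))" using m1 by simp
    also have "\<dots> = leg (x * (1 - x ^ 2))" by (subst leg_mult[symmetric]) (simp add: algebra_simps)
    also have "\<dots> = leg x * leg (1 - (x ^ p) ^ 2)"
      unfolding leg_mult
      by (intro arg_cong2[where f = "(*)"] refl leg_cong cong_diff cong_pow cong_refl cong_sym[OF int_Fermat])
    finally have e: "of_int (leg (x * (x ^ 2 + -1))) = (of_int (leg x) * of_int (leg (1 - (x ^ p) ^ 2)) :: rat)" by simp
    have 1: "pcong 2 (of_int (leg x)) (s x ^ half_p)"
      using pcong_leg[of x] unfolding s_def by (simp add: mult.commute flip: power_mult)
    have "pcong 2 (of_int (leg (1 - (x ^ p) ^ 2))) (((1 - s x ^ 2) ^ p) ^ half_p)"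
      using pcong_leg[of "1 - (x ^ p) ^ 2"] unfolding s_def by (simp add: mult.commute flip: power_mult)
    also have "pcong 2 \<dots> ((1 - s x ^ 2 + of_nat p * - L (s x ^ 2)) ^ half_p)"
      unfolding L_def
    proof (intro pcong_power one_minus_pth_power_pcong)
      show "pcong 2 ((s x ^ 2) ^ p) (s x ^ 2)"
        using pcong_power[OF pcong_teichmuller[of x] Zp_of_int_pow, of 2] unfolding s_def
        by (simp add: mult.assoc mult.commute mult.left_commute flip: power_mult)
      have "1 - s x ^ 2 + of_nat p * - L (s x ^ 2) \<in> Zp"
        by (intro Zp_add Zp_diff Zp_mult Zp_uminus LZ Zp_power sZ Zp_of_nat Zp_numeral)
      then show "1 - s x ^ 2 + of_nat p * - (\<Sum>i\<in>{1..<p}. (s x ^ 2) ^ i / of_nat i) \<in> Zp"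
        by (simp only: L_def)
    qed (use sZ in \<open>auto intro: Zp_power\<close>)
    also have "pcong 2 \<dots> ((1 - s x ^ 2) ^ half_p + of_nat half_p * (of_nat p * - L (s x ^ 2) * (1 - s x ^ 2) ^ (half_p - 1)))"
      by (intro pcong_add_p_power Zp_diff Zp_uminus LZ Zp_power sZ Zp_numeral)
    finally have 2: "pcong 2 (of_int (leg (1 - (x ^ p) ^ 2))) ((1 - s x ^ 2) ^ half_p + of_nat half_p * (of_nat p * - L (s x ^ 2) * (1 - s x ^ 2) ^ (half_p - 1)))" .
    have "pcong 2 (of_int (leg x) * of_int (leg (1 - (x ^ p) ^ 2)))
       (s x ^ half_p * ((1 - s x ^ 2) ^ half_p + of_nat half_p * (of_nat p * - L (s x ^ 2) * (1 - s x ^ 2) ^ (half_p - 1))))"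
      by (intro pcong_mult 1 2 Zp_add Zp_diff Zp_uminus Zp_mult LZ Zp_power sZ Zp_of_nat Zp_of_int Zp_numeral)
    then show ?thesis unfolding e by (simp add: algebra_simps)
  qed
  define \<sigma> where "\<sigma> = (\<lambda>k. \<Sum>x\<in>residues_p. s x ^ k)"
  have \<sigma>: "pcong 2 (\<sigma> k) ((of_nat p - 1) * \<iota> k)" if "k > 0" for k
    using power_sum_pcong[OF that] unfolding \<sigma>_def s_def \<iota>_def by (auto split: if_splits)
  have \<sigma>1: "pcong 1 (\<sigma> k) (- \<iota> k)" if "k > 0" for k
  proof -
    have "pcong 1 (\<sigma> k) ((of_nat p - 1) * \<iota> k)" using \<sigma>[OF that] by (rule pcong_weaken)
    also have "pcong 1 \<dots> (- \<iota> k)" by (rule pcongI[of _ _ _ "\<iota> k"]) (simp_all add: \<iota>_def algebra_simps)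
    finally show ?thesis .
  qed
  have e1: "s x ^ half_p * (1 - s x ^ 2) ^ half_p = (\<Sum>j\<le>half_p. (-1) ^ j * of_nat (half_p choose j) * s x ^ (half_p + 2 * j))" for x
    unfolding one_minus_power_expand sum_distrib_left
    by (intro sum.cong refl) (simp add: power_add power_mult)
  have e2: "s x ^ half_p * (1 - s x ^ 2) ^ (half_p - 1) * L (s x ^ 2) =
     (\<Sum>j\<le>half_p - 1. \<Sum>i\<in>{1..<p}. (-1) ^ j * of_nat (half_p - 1 choose j) / of_nat i * s x ^ (half_p + 2 * j + 2 * i))" for x
    unfolding one_minus_power_expand L_def sum_distrib_left[of "s x ^ half_p"] sum_product
    by (intro sum.cong refl) (simp add: power_add power_mult)
  have "of_int (jacobsthal (-1)) = (\<Sum>x\<in>residues_p. (of_int (leg (x * (x ^ 2 + -1))) :: rat))"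
    unfolding jacobsthal_def by simp
  also have "pcong 2 \<dots> (\<Sum>x\<in>residues_p. s x ^ half_p * (1 - s x ^ 2) ^ half_p + of_nat p * (- of_nat half_p * (s x ^ half_p * (1 - s x ^ 2) ^ (half_p - 1) * L (s x ^ 2))))"
    by (rule pcong_sum) (rule tm)
  also have "\<dots> = (\<Sum>x\<in>residues_p. s x ^ half_p * (1 - s x ^ 2) ^ half_p)
      + of_nat p * (- of_nat half_p * (\<Sum>x\<in>residues_p. s x ^ half_p * (1 - s x ^ 2) ^ (half_p - 1) * L (s x ^ 2)))"
    by (simp only: sum.distrib sum_distrib_left)
  also have "(\<Sum>x\<in>residues_p. s x ^ half_p * (1 - s x ^ 2) ^ half_p) = (\<Sum>j\<le>half_p. (-1) ^ j * of_nat (half_p choose j) * \<sigma> (half_p + 2 * j))"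
    unfolding e1 \<sigma>_def sum_distrib_left by (rule sum.swap)
  also have "(\<Sum>x\<in>residues_p. s x ^ half_p * (1 - s x ^ 2) ^ (half_p - 1) * L (s x ^ 2))
      = (\<Sum>j\<le>half_p - 1. \<Sum>i\<in>{1..<p}. (-1) ^ j * of_nat (half_p - 1 choose j) / of_nat i * \<sigma> (half_p + 2 * j + 2 * i))"
    unfolding e2 \<sigma>_def sum_distrib_left
    by (subst sum.swap, rule sum.cong[OF refl], rule sum.swap)
  also have "pcong 2 ((\<Sum>j\<le>half_p. (-1) ^ j * of_nat (half_p choose j) * \<sigma> (half_p + 2 * j))
      + of_nat p * (- of_nat half_p * (\<Sum>j\<le>half_p - 1. \<Sum>i\<in>{1..<p}. (-1) ^ j * of_nat (half_p - 1 choose j) / of_nat i * \<sigma> (half_p + 2 * j + 2 * i))))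
     ((\<Sum>j\<le>half_p. (-1) ^ j * of_nat (half_p choose j) * ((of_nat p - 1) * \<iota> (half_p + 2 * j)))
      + of_nat p * (- of_nat half_p * (\<Sum>j\<le>half_p - 1. \<Sum>i\<in>{1..<p}. (-1) ^ j * of_nat (half_p - 1 choose j) / of_nat i * (- \<iota> (half_p + 2 * j + 2 * i)))))"
    using half_p_pos
    by (intro pcong_add pcong_lift pcong_mult_left pcong_sum \<sigma> \<sigma>1 Zp_mult Zp_power Zp_uminus Zp_divide Zp_unit_small) auto
  also have "of_nat p * (- of_nat half_p * (\<Sum>j\<le>half_p - 1. \<Sum>i\<in>{1..<p}. (-1) ^ j * of_nat (half_p - 1 choose j) / of_nat i * (- \<iota> (half_p + 2 * j + 2 * i))))
     = of_nat p * (of_nat half_p * (\<Sum>j\<le>half_p - 1. \<Sum>i\<in>{1..<p}. (-1) ^ j * of_nat (half_p - 1 choose j) / of_nat i * \<iota> (half_p + 2 * j + 2 * i)))"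
    by (simp add: sum_negf)
  finally show ?thesis .
qed

end

section \<open>Closed forms for the sums in the expansion, and the resulting value\<close>

lemma choose_alternating_partial_sum:
  "(\<Sum>i<k. (-1) ^ i * of_nat (Suc N choose (Suc b + i))) = (of_nat (N choose b) - (-1) ^ k * of_nat (N choose (b + k)) :: rat)"
  by (induction k) (simp_all add: algebra_simps)

text \<open>The partial fraction formula at y = -3m with 2m linear factors; their product is (2m)!
  times 3m choose 2m, the sign being even.\<close>

lemma choose_beta_sum:
  assumes m: "m > 0"
  shows "of_nat (2 * m) * (\<Sum>j<2 * m. (-1) ^ j * of_nat (2 * m - 1 choose j) / of_nat (3 * m - j)) = (- 1 / of_nat (3 * m choose m) :: rat)"
proof -
  define y where "y = (- of_nat (3 * m) :: rat)"
  obtain M where M: "2 * m = Suc M" using m by (cases "2 * m") auto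
  have "(\<Sum>j<2 * m. (-1) ^ j * of_nat (2 * m - 1 choose j) / of_nat (3 * m - j)) =
     (\<Sum>j\<le>M. - ((-1) ^ j * of_nat (M choose j) / (y + of_nat j) :: rat))"
    unfolding M lessThan_Suc_atMost diff_Suc_1
  proof (rule sum.cong)
    fix j assume "j \<in> {..M}"
    then have "j < 3 * m" using M by auto
    then have "(of_nat (3 * m - j) :: rat) = - (y + of_nat j)" by (simp add: y_def of_nat_diff)
    then show "(-1) ^ j * of_nat (M choose j) / of_nat (3 * m - j) = - ((-1) ^ j * of_nat (M choose j) / (y + of_nat j) :: rat)"
      by (simp only: minus_divide_right)
  qed simp
  also have "\<dots> = - (fact M / pochhammer y (Suc M))"
    unfolding sum_negf
  proof (subst alternating_choose_partial_fraction)
    fix j assume "j \<le> M"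
    then have "j < 3 * m" using M by auto
    then have "(of_nat j :: rat) < of_nat (3 * m)" by (simp only: of_nat_less_iff)
    then show "y + of_nat j \<noteq> 0" by (simp add: y_def)
  qed simp
  also have "pochhammer y (Suc M) = fact (Suc M) * of_nat (3 * m choose m)"
  proof -
    have "(of_nat (3 * m choose (2 * m)) :: rat) = (-1) ^ (2 * m) * pochhammer y (2 * m) / fact (2 * m)"
      unfolding y_def binomial_gbinomial by (rule gbinomial_pochhammer)
    moreover have "3 * m choose (2 * m) = 3 * m choose m" using binomial_symmetric[of m "3 * m"] by simp
    ultimately show ?thesis unfolding M[symmetric] by (simp add: field_simps)
  qed
  finally have "of_nat (2 * m) * (\<Sum>j<2 * m. (-1) ^ j * of_nat (2 * m - 1 choose j) / of_nat (3 * m - j))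
      = - (of_nat (Suc M) * fact M / (fact (Suc M) * of_nat (3 * m choose m)) :: rat)" by (simp add: M)
  also have "(of_nat (Suc M) * fact M :: rat) = fact (Suc M)" by (simp only: fact_Suc)
  finally show ?thesis by simp
qed

text \<open>Counted from the middle, 2m times the binomial of row 2m - 1 is m + (i+1) times one of
  row 2m. Dividing by i + 1 separates m times \<open>choose_even_alternating_sum\<close> from a
  telescoping alternating sum equal to half of C.\<close>

lemma choose_odd_half_sum:
  assumes m: "m > 0"
  shows "of_nat (2 * m) * (\<Sum>j<m. (-1) ^ j * of_nat (2 * m - 1 choose j) / of_nat (m - j))
     = (- ((-1) ^ m) * (of_nat m * alt_harm m + 1 / 2) * of_nat (2 * m choose m) :: rat)"
proof -
  define C where "C = (of_nat (2 * m choose m) :: rat)"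
  obtain M where M: "2 * m = Suc M" using m by (cases "2 * m") auto
  have "(\<Sum>j<m. (-1) ^ j * of_nat (2 * m - 1 choose j) / of_nat (m - j)) =
    (\<Sum>i<m. - ((-1) ^ m) * ((-1) ^ i * of_nat (2 * m - 1 choose (m + i)) / of_nat (Suc i)) :: rat)"
  proof (rule sum.reindex_bij_witness[of _ "\<lambda>i. m - 1 - i" "\<lambda>i. m - 1 - i"])
    fix j assume "j \<in> {..<m}"
    then have j: "j < m" by simp
    have "2 * m - 1 - j = m + (m - 1 - j)" using j by simp
    then have 1: "2 * m - 1 choose j = 2 * m - 1 choose (m + (m - 1 - j))"
      using binomial_symmetric[of j "2 * m - 1"] j by simp
    have 2: "Suc (m - 1 - j) = m - j" using j by simp
    have "(-1 :: rat) ^ m = (-1) ^ (m - 1 - j) * (-1) ^ Suc j"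
      using j by (simp flip: power_add power_Suc)
    then have 3: "- ((-1) ^ m) * ((-1) ^ (m - 1 - j) * x) = (-1) ^ j * x" for x :: rat
      by (cases "even (m - 1 - j)") simp_all
    show "- ((-1) ^ m) * ((-1) ^ (m - 1 - j) * of_nat (2 * m - 1 choose (m + (m - 1 - j))) / of_nat (Suc (m - 1 - j)))
       = ((-1) ^ j * of_nat (2 * m - 1 choose j) / of_nat (m - j) :: rat)"
      unfolding 1[symmetric] 2 times_divide_eq_right[symmetric] 3 ..
  qed auto
  also have "\<dots> = - ((-1) ^ m) * (\<Sum>i<m. (-1) ^ i * of_nat (M choose (m + i)) / of_nat (Suc i))"
    unfolding sum_distrib_left M by simp
  finally have e0: "(\<Sum>j<m. (-1) ^ j * of_nat (2 * m - 1 choose j) / of_nat (m - j)) =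
    (- ((-1) ^ m) * (\<Sum>i<m. (-1) ^ i * of_nat (M choose (m + i)) / of_nat (Suc i)) :: rat)" .
  have e: "of_nat (2 * m) * (\<Sum>j<m. (-1) ^ j * of_nat (2 * m - 1 choose j) / of_nat (m - j)) =
    - ((-1) ^ m) * (\<Sum>i<m. (-1) ^ i * (of_nat (2 * m) * of_nat (M choose (m + i))) / of_nat (Suc i) :: rat)"
  proof -
    have "of_nat (2 * m) * (\<Sum>i<m. (-1) ^ i * of_nat (M choose (m + i)) / of_nat (Suc i))
        = (\<Sum>i<m. (-1) ^ i * (of_nat (2 * m) * of_nat (M choose (m + i))) / of_nat (Suc i) :: rat)"
      unfolding sum_distrib_left
      by (intro sum.cong refl) (simp only: times_divide_eq_right mult.left_commute)
    then show ?thesis unfolding e0 by (simp only: mult.left_commute[of "of_nat (2 * m)"])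
  qed
  have "(\<Sum>i<m. (-1) ^ i * (of_nat (2 * m) * of_nat (M choose (m + i))) / of_nat (Suc i) :: rat)
     = (\<Sum>i<m. of_nat m * ((-1) ^ i * of_nat (2 * m choose (m + Suc i)) / of_nat (Suc i)) + (-1) ^ i * of_nat (Suc M choose (Suc m + i)))"
  proof (intro sum.cong refl)
    fix i
    have "of_nat (2 * m) * of_nat (M choose (m + i)) = (of_nat m + of_nat (Suc i)) * (of_nat (2 * m choose (m + Suc i)) :: rat)"
      using choose_absorb[of "m + i" M] unfolding M[symmetric] by (simp add: ac_simps)
    moreover have "Suc M choose (Suc m + i) = 2 * m choose (m + Suc i)" by (simp only: M add_Suc add_Suc_right)
    moreover have "(of_nat (Suc i) :: rat) \<noteq> 0" by simp
    ultimately show "(-1) ^ i * (of_nat (2 * m) * of_nat (M choose (m + i))) / of_nat (Suc i)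
      = of_nat m * ((-1) ^ i * of_nat (2 * m choose (m + Suc i)) / of_nat (Suc i)) + (-1) ^ i * (of_nat (Suc M choose (Suc m + i)) :: rat)"
      by (simp add: add_divide_distrib distrib_left distrib_right del: of_nat_Suc binomial_Suc_Suc)
  qed
  also have "\<dots> = of_nat m * (C * alt_harm m) + (of_nat (M choose m) - (-1) ^ m * of_nat (M choose (m + m)))"
    unfolding sum.distrib sum_distrib_left[symmetric] choose_even_alternating_sum choose_alternating_partial_sum C_def ..
  also have "M choose (m + m) = 0" using M by (intro binomial_eq_0) simp
  also have "of_nat (M choose m) = C / 2"
  proof -
    have "of_nat (Suc M - m) * of_nat (Suc M choose m) = (of_nat (Suc M) * of_nat (M choose m) :: rat)"
      using choose_absorb_comp[of M m] M by (simp add: of_nat_diff del: of_nat_Suc)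
    then have "of_nat m * C = 2 * of_nat m * (of_nat (M choose m) :: rat)"
      unfolding M[symmetric] C_def by simp
    then show ?thesis using m by simp
  qed
  finally show ?thesis unfolding e C_def[symmetric] by (simp add: algebra_simps)
qed

context odd_prime
begin

text \<open>Upper negation turns the left side into (-1)^k times -2m-1 choose k, and -2m - 1 = 2m -
  p.\<close>

lemma choose_3m_pcong:
  assumes "p = 4 * m + 1" "k < p"
  shows "pcong 1 (of_nat (2 * m + k choose k)) ((-1) ^ k * of_nat (2 * m choose k))"
  using assms(2)
proof (induction k)
  case 0
  show ?case by simp
next
  case (Suc k)
  define q where "q = (of_nat p :: rat)"
  have "of_nat (Suc k) * of_nat (2 * m + Suc k choose Suc k) = (of_nat (2 * m + Suc k) * of_nat (2 * m + k choose k) :: rat)"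
    using choose_absorb[of k "2 * m + k"] by (simp only: add_Suc_right)
  also have "of_nat (2 * m + Suc k) = (q - (of_nat (2 * m) - of_nat k) :: rat)"
    unfolding q_def assms(1) by simp
  finally have 1: "of_nat (Suc k) * of_nat (2 * m + Suc k choose Suc k) = (q - (of_nat (2 * m) - of_nat k)) * of_nat (2 * m + k choose k)" .
  have "pcong 1 (of_nat (Suc k) * of_nat (2 * m + Suc k choose Suc k)) (- (of_nat (2 * m) - of_nat k) * of_nat (2 * m + k choose k))"
    unfolding 1 q_def by (rule pcongI[of _ _ _ "of_nat (2 * m + k choose k)"]) (simp_all add: algebra_simps)
  also have "pcong 1 \<dots> (- (of_nat (2 * m) - of_nat k) * ((-1) ^ k * of_nat (2 * m choose k)))"
    using Suc by (intro pcong_mult_left Zp_uminus Zp_diff) auto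
  also have "- (of_nat (2 * m) - of_nat k) * ((-1) ^ k * of_nat (2 * m choose k)) = (-1) ^ Suc k * ((of_nat (2 * m) - of_nat k) * (of_nat (2 * m choose k) :: rat))"
    by (simp only: power_Suc minus_mult_left minus_mult_right mult_1_left mult.left_commute)
  also have "\<dots> = of_nat (Suc k) * ((-1) ^ Suc k * of_nat (2 * m choose Suc k))"
    unfolding choose_Suc_ratio[symmetric] by (simp only: ac_simps)
  finally show ?case using Zp_unit_small[of "Suc k"] Suc.prems by (blast intro: pcong_cancel)
qed

text \<open>The exponent is 4mk exactly for i = 2mk - m - j. In the range of i, k = 2 always gives
  3m - j; k = 1 gives m - j when j < m, and k = 3 gives 5m - j when j is at least m.\<close>

lemma jacobsthal_inner_sum:
  assumes p: "p = 4 * m + 1" and j: "j < 2 * m"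
  shows "(\<Sum>i\<in>{1..<p}. c / of_nat i * (if (p - 1) dvd (2 * m + 2 * j + 2 * i) then 1 else 0 :: rat))
     = c / of_nat (3 * m - j) + c / of_nat (if j < m then m - j else 5 * m - j)"
proof -
  define e where "e = (if j < m then m - j else 5 * m - j)"
  have iff: "(p - 1) dvd (2 * m + 2 * j + 2 * i) \<longleftrightarrow> i = 3 * m - j \<or> i = e" if i: "i \<in> {1..<p}" for i
  proof
    assume "(p - 1) dvd (2 * m + 2 * j + 2 * i)"
    then obtain k where "2 * m + 2 * j + 2 * i = (4 * m) * k" using p by (auto simp: dvd_def)
    then have k: "m + j + i = 2 * (m * k)" by simp
    have "k < 4"
    proof (rule ccontr)
      assume "\<not> k < 4"
      then have "m * 4 \<le> m * k" by (intro mult_left_mono) auto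
      moreover have "i \<le> 4 * m" using i p by auto
      ultimately show False using k j by linarith
    qed
    moreover have "k \<noteq> 0" using k i by (cases k) auto
    ultimately have "k = 1 \<or> k = 2 \<or> k = 3" by auto
    then show "i = 3 * m - j \<or> i = e" using k i j p unfolding e_def by auto
  next
    assume "i = 3 * m - j \<or> i = e"
    then have "2 * m + 2 * j + 2 * i = 4 * m * 2 \<or> 2 * m + 2 * j + 2 * i = 4 * m * 1 \<or> 2 * m + 2 * j + 2 * i = 4 * m * 3"
      using j unfolding e_def by (auto split: if_splits)
    then show "(p - 1) dvd (2 * m + 2 * j + 2 * i)" using p by (metis add_diff_cancel_right' dvd_triv_left)
  qed
  have "(\<Sum>i\<in>{1..<p}. c / of_nat i * (if (p - 1) dvd (2 * m + 2 * j + 2 * i) then 1 else 0 :: rat))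
     = (\<Sum>i\<in>{1..<p}. if i = 3 * m - j \<or> i = e then c / of_nat i else 0)"
    by (rule sum.cong) (simp_all only: iff, simp_all)
  also have "\<dots> = (\<Sum>i\<in>{i \<in> {1..<p}. i = 3 * m - j \<or> i = e}. c / of_nat i)"
    by (rule sum.inter_filter[symmetric]) simp
  also have "{i \<in> {1..<p}. i = 3 * m - j \<or> i = e} = {3 * m - j, e}"
    using p j unfolding e_def by auto
  also have "(\<Sum>i\<in>{3 * m - j, e}. c / of_nat i) = c / of_nat (3 * m - j) + c / of_nat e"
  proof -
    have "3 * m - j \<noteq> e" using j unfolding e_def by auto
    then show ?thesis by simp
  qed
  finally show ?thesis unfolding e_def .
qed

text \<open>Reflecting the upper half by j' = 2m - 1 - j changes the sign, as 2m - 1 is odd. Its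
  denominator is p - (m - j'), so modulo p the sign changes back and both halves agree.\<close>

lemma jacobsthal_folded_sum_pcong:
  assumes p: "p = 4 * m + 1"
  shows "pcong 1 (\<Sum>j<2 * m. (-1) ^ j * of_nat (2 * m - 1 choose j) / of_nat (if j < m then m - j else 5 * m - j))
     (2 * (\<Sum>j<m. (-1) ^ j * of_nat (2 * m - 1 choose j) / of_nat (m - j)))"
proof -
  define f where "f = (\<lambda>j. (-1) ^ j * of_nat (2 * m - 1 choose j) :: rat)"
  have "{..<2 * m} = {..<m} \<union> {m..<2 * m}" by auto
  then have "(\<Sum>j<2 * m. f j / of_nat (if j < m then m - j else 5 * m - j)) =
     (\<Sum>j<m. f j / of_nat (if j < m then m - j else 5 * m - j)) + (\<Sum>j\<in>{m..<2 * m}. f j / of_nat (if j < m then m - j else 5 * m - j))"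
    by (simp only: sum.union_disjoint[of "{..<m}" "{m..<2 * m}"] finite_lessThan finite_atLeastLessThan ivl_disj_int)
  also have "(\<Sum>j<m. f j / of_nat (if j < m then m - j else 5 * m - j)) = (\<Sum>j<m. f j / of_nat (m - j))"
    by (rule sum.cong) auto
  also have "(\<Sum>j\<in>{m..<2 * m}. f j / of_nat (if j < m then m - j else 5 * m - j)) = (\<Sum>j<m. - f j * (1 / of_nat (p - (m - j))))"
  proof (rule sum.reindex_bij_witness[of _ "\<lambda>i. 2 * m - 1 - i" "\<lambda>i. 2 * m - 1 - i"])
    fix j assume j: "j \<in> {m..<2 * m}"
    then have "j \<le> 2 * m - 1" by auto
    then have "2 * m - 1 choose (2 * m - 1 - j) = 2 * m - 1 choose j" by (rule binomial_symmetric[symmetric])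
    moreover have "(-1 :: rat) ^ (2 * m - 1 - j) = - ((-1) ^ j)"
    proof -
      have "(-1 :: rat) ^ (2 * m - 1 - j) * (-1) ^ Suc j = (-1) ^ (2 * m)" using j by (simp flip: power_add power_Suc)
      then show ?thesis by (cases "even j") simp_all
    qed
    ultimately have "f (2 * m - 1 - j) = - f j" by (simp add: f_def)
    moreover have "p - (m - (2 * m - 1 - j)) = 5 * m - j" using j p by auto
    ultimately show "- f (2 * m - 1 - j) * (1 / of_nat (p - (m - (2 * m - 1 - j)))) = f j / of_nat (if j < m then m - j else 5 * m - j)"
      using j by simp
  qed auto
  also have "pcong 1 ((\<Sum>j<m. f j / of_nat (m - j)) + (\<Sum>j<m. - f j * (1 / of_nat (p - (m - j)))))
     ((\<Sum>j<m. f j / of_nat (m - j)) + (\<Sum>j<m. - f j * (1 / - of_nat (m - j))))"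
  proof (intro pcong_add pcong_refl pcong_sum pcong_mult_left)
    fix j assume j: "j \<in> {..<m}"
    show "- f j \<in> Zp" unfolding f_def by (intro Zp_uminus Zp_mult Zp_power) simp_all
    have "pcong 1 (of_nat (p - (m - j))) (- of_nat (m - j))"
    proof -
      have "m - j \<le> p" using p by simp
      then show ?thesis by (intro pcongI[of _ _ _ 1]) (simp_all add: of_nat_diff)
    qed
    moreover have "Zp_unit (of_nat (p - (m - j)))" "Zp_unit (- of_nat (m - j))"
      using p j by (intro Zp_unit_small Zp_unit_uminus; simp)+
    ultimately show "pcong 1 (1 / of_nat (p - (m - j))) (1 / - of_nat (m - j))" by (rule pcong_inverse)
  qed
  also have "(\<Sum>j<m. f j / of_nat (m - j)) + (\<Sum>j<m. - f j * (1 / - of_nat (m - j))) = 2 * (\<Sum>j<m. f j / of_nat (m - j))"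
  proof -
    have "- a * (1 / - b) = a / b" for a b :: rat by simp
    then show ?thesis by (simp only: mult_2)
  qed
  finally show ?thesis by (simp only: f_def)
qed


lemma leg_minus_one: "p = 4 * m + 1 \<Longrightarrow> leg (-1) = 1"
  using leg_euler[of "-1"] leg_range[of "-1"] by (intro small_cong_eq) simp_all

text \<open>In the first sum only j = m survives. The two indices left in each inner sum give
  \<open>II\<close>, evaluated by the Beta-type sum, and \<open>III\<close>, evaluated by folding;
  both carry the factor p and are needed modulo p only.\<close>

lemma jacobsthal_pcong:
  assumes p: "p = 4 * m + 1"
  defines "C \<equiv> of_nat (2 * m choose m) :: rat"
  shows "pcong 2 (of_int (jacobsthal (-1))) (- ((-1) ^ m) * (C * (1 - of_nat p * alt_harm m / 2) + of_nat p / C))"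
proof -
  define q where "q = (of_nat p :: rat)"
  define h where "h = alt_harm m"
  define e where "e = ((-1) ^ m :: rat)"
  define \<iota> where "\<iota> = (\<lambda>k. if (p - 1) dvd k then 1 else 0 :: rat)"
  have m: "m > 0" using p p_gt_2 by simp
  have half_p: "half_p = 2 * m" using p by simp
  have q: "2 * of_nat (2 * m) = q - 1" by (simp add: q_def p)
  have hZ: "h \<in> Zp" unfolding h_def using p m by (intro alt_harm_in_Zp) simp
  have Cu: "Zp_unit C" unfolding C_def using p by (intro Zp_unit_choose) auto
  have eZ: "e \<in> Zp" unfolding e_def by (intro Zp_power Zp_uminus) simp
  have "(\<Sum>j\<le>2 * m. (-1) ^ j * of_nat (2 * m choose j) * ((q - 1) * \<iota> (2 * m + 2 * j)))
     = (\<Sum>j\<le>2 * m. if j = m then (-1) ^ j * of_nat (2 * m choose j) * (q - 1) else 0)"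
  proof (intro sum.cong refl)
    fix j assume "j \<in> {..2 * m}"
    have "(p - 1) dvd (2 * m + 2 * j) \<longleftrightarrow> j = m"
    proof
      assume "(p - 1) dvd (2 * m + 2 * j)"
      then obtain k where "2 * m + 2 * j = (4 * m) * k" using p by (auto simp: dvd_def)
      then have k: "m + j = 2 * (m * k)" by simp
      have "k < 2"
      proof (rule ccontr)
        assume "\<not> k < 2"
        then have "m * 2 \<le> m * k" by (intro mult_left_mono) auto
        moreover have "j \<le> 2 * m" using \<open>j \<in> {..2 * m}\<close> by simp
        ultimately show False using k m by linarith
      qed
      moreover have "k \<noteq> 0" using k m by (cases k) auto
      ultimately have "k = 1" by simp
      then show "j = m" using k by simp
    qed (use p in simp)
    then show "(-1) ^ j * of_nat (2 * m choose j) * ((q - 1) * \<iota> (2 * m + 2 * j))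
      = (if j = m then (-1) ^ j * of_nat (2 * m choose j) * (q - 1) else 0)"
      by (simp add: \<iota>_def)
  qed
  also have "\<dots> = e * C * (q - 1)" by (simp add: e_def C_def)
  finally have 1: "(\<Sum>j\<le>2 * m. (-1) ^ j * of_nat (2 * m choose j) * ((q - 1) * \<iota> (2 * m + 2 * j))) = e * C * (q - 1)" .
  define II where "II = (\<Sum>j<2 * m. (-1) ^ j * of_nat (2 * m - 1 choose j) / of_nat (3 * m - j) :: rat)"
  define III where "III = (\<Sum>j<2 * m. (-1) ^ j * of_nat (2 * m - 1 choose j) / of_nat (if j < m then m - j else 5 * m - j) :: rat)"
  have 2: "(\<Sum>j\<le>2 * m - 1. \<Sum>i\<in>{1..<p}. (-1) ^ j * of_nat (2 * m - 1 choose j) / of_nat i * \<iota> (2 * m + 2 * j + 2 * i)) = II + III"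
  proof -
    have "{..2 * m - 1} = {..<2 * m}" using m by auto
    then have "(\<Sum>j\<le>2 * m - 1. \<Sum>i\<in>{1..<p}. (-1) ^ j * of_nat (2 * m - 1 choose j) / of_nat i * \<iota> (2 * m + 2 * j + 2 * i))
      = (\<Sum>j<2 * m. (-1) ^ j * of_nat (2 * m - 1 choose j) / of_nat (3 * m - j) + (-1) ^ j * of_nat (2 * m - 1 choose j) / of_nat (if j < m then m - j else 5 * m - j))"
      unfolding \<iota>_def using jacobsthal_inner_sum[OF p] by (intro sum.cong) auto
    then show ?thesis unfolding II_def III_def sum.distrib .
  qed
  have c2: "pcong 1 (of_nat (2 * m) * II) (- (e / C))"
  proof -
    have "of_nat (2 * m) * II = - 1 / of_nat (3 * m choose m)" unfolding II_def by (rule choose_beta_sum[OF m])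
    also have "\<dots> = - (1 / of_nat (2 * m + m choose m))" by (simp add: mult.commute)
    also have "pcong 1 \<dots> (- (1 / (e * C)))"
    proof (intro pcong_uminus pcong_inverse)
      show "pcong 1 (of_nat (2 * m + m choose m)) (e * C)"
        using choose_3m_pcong[OF p, of m] p unfolding e_def C_def by simp
      show "Zp_unit (of_nat (2 * m + m choose m))" using p m by (intro Zp_unit_choose) auto
      show "Zp_unit (e * C)" unfolding e_def by (intro Zp_unit_mult Zp_unit_power Zp_unit_uminus Cu) simp
    qed
    also have "- (1 / (e * C)) = - (e / C)" unfolding e_def by (cases "even m") simp_all
    finally show ?thesis .
  qed
  have c3: "pcong 1 (of_nat (2 * m) * III) (- e * (of_nat (2 * m) * h + 1) * C)"
  proof -
    have "pcong 1 (of_nat (2 * m) * III) (of_nat (2 * m) * (2 * (\<Sum>j<m. (-1) ^ j * of_nat (2 * m - 1 choose j) / of_nat (m - j))))"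
      unfolding III_def by (intro pcong_mult_left jacobsthal_folded_sum_pcong[OF p] Zp_of_nat)
    also have "\<dots> = 2 * (of_nat (2 * m) * (\<Sum>j<m. (-1) ^ j * of_nat (2 * m - 1 choose j) / of_nat (m - j)))"
      by (simp only: mult.left_commute)
    also have "\<dots> = - e * (of_nat (2 * m) * h + 1) * C"
      unfolding choose_odd_half_sum[OF m] e_def[symmetric] h_def C_def by (simp add: algebra_simps)
    finally show ?thesis .
  qed
  have "pcong 2 (of_int (jacobsthal (-1))) (e * C * (q - 1) + q * (of_nat (2 * m) * (II + III)))"
    using jacobsthal_pcong_expand[OF leg_minus_one[OF p]] unfolding half_p 1[symmetric] 2[symmetric] unfolding q_def \<iota>_def .
  also have "pcong 2 \<dots> (e * C * (q - 1) + q * (- (e / C) + - e * (of_nat (2 * m) * h + 1) * C))"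
    unfolding q_def distrib_left[of "of_nat (2 * m)"] by (intro pcong_add pcong_refl pcong_lift c2 c3)
  also have "pcong 2 \<dots> (- e * (C * (1 - q * h / 2) + q / C))"
  proof (rule pcongI)
    define b where "b = 1 / C"
    have b: "e / C = e * b" "q / C = q * b" by (simp_all add: b_def)
    have m2: "(of_nat (2 * m) :: rat) = (q - 1) / 2" using q by simp
    show "e * C * (q - 1) + q * (- (e / C) + - e * (of_nat (2 * m) * h + 1) * C) - - e * (C * (1 - q * h / 2) + q / C)
      = of_nat p ^ 2 * (- e * h * C / 2)"
      unfolding b m2 q_def[symmetric] by (simp add: power2_eq_square algebra_simps add_divide_distrib diff_divide_distrib)
    show "- e * h * C / 2 \<in> Zp" by (intro Zp_divide Zp_mult Zp_uminus eZ hZ Zp_unit_in[OF Cu]) simp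
  qed
  finally show ?thesis unfolding e_def q_def h_def .
qed

text \<open>Squaring removes the sign; the cross term of C(1 - ph/2) and p/C contributes 2p, and
  their remaining products lie in p^2 \<open>Zp\<close>.\<close>

lemma two_squares_pcong:
  assumes p: "p = 4 * m + 1" and xy: "int p = x ^ 2 + 4 * y ^ 2"
  defines "C \<equiv> of_nat (2 * m choose m) :: rat"
  shows "pcong 2 (4 * of_int x ^ 2) (C ^ 2 * (1 - of_nat p * alt_harm m) + 2 * of_nat p)"
proof -
  define q where "q = (of_nat p :: rat)"
  define h where "h = alt_harm m"
  have hZ: "h \<in> Zp" unfolding h_def using p p_gt_2 by (intro alt_harm_in_Zp) simp
  have Cu: "Zp_unit C" unfolding C_def using p by (intro Zp_unit_choose) auto
  have qZ: "q \<in> Zp" by (simp add: q_def)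
  have "even half_p" using p by simp
  then have "jacobsthal (-1) ^ 2 = 4 * x ^ 2" using jacobsthal_two_squares[OF leg_minus_one[OF p] _ xy] by blast
  then have "4 * of_int x ^ 2 = (of_int (jacobsthal (-1)) ^ 2 :: rat)"
    by (metis of_int_mult of_int_numeral of_int_power)
  also have "pcong 2 \<dots> ((- ((-1) ^ m) * (C * (1 - q * h / 2) + q / C)) ^ 2)"
    using jacobsthal_pcong[OF p] unfolding C_def[symmetric] q_def[symmetric] h_def[symmetric]
    by (rule pcong_power)
       (intro Zp_mult Zp_add Zp_diff Zp_divide Zp_uminus Zp_power hZ qZ Cu Zp_unit_in[OF Cu]; simp)
  also have "(- ((-1) ^ m) * (C * (1 - q * h / 2) + q / C)) ^ 2 = (C * (1 - q * h / 2) + q / C) ^ 2"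
    unfolding power_mult_distrib by (cases "even m") simp_all
  also have "pcong 2 \<dots> (C ^ 2 * (1 - q * h) + 2 * q)"
  proof (rule pcongI)
    define b where "b = 1 / C"
    have Cb: "C * b = 1" using Zp_unit_nz[OF Cu] by (simp add: b_def)
    have b: "q / C = q * b" "1 / C ^ 2 = b ^ 2" by (simp_all add: b_def power_one_over)
    have "(C * (1 - q * h / 2) + q * b) ^ 2 = (C * (1 - q * h / 2)) ^ 2 + 2 * q * (1 - q * h / 2) * (C * b) + (q * b) ^ 2"
      by (simp add: power2_eq_square algebra_simps)
    then have s: "(C * (1 - q * h / 2) + q * b) ^ 2 = (C * (1 - q * h / 2)) ^ 2 + 2 * q * (1 - q * h / 2) + (q * b) ^ 2"
      by (simp only: Cb mult_1_right)
    show "(C * (1 - q * h / 2) + q / C) ^ 2 - (C ^ 2 * (1 - q * h) + 2 * q) = of_nat p ^ 2 * (C ^ 2 * h ^ 2 / 4 - h + 1 / C ^ 2)"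
      unfolding b s q_def[symmetric] by (simp add: power2_eq_square algebra_simps add_divide_distrib diff_divide_distrib)
    show "C ^ 2 * h ^ 2 / 4 - h + 1 / C ^ 2 \<in> Zp"
      by (intro Zp_mult Zp_add Zp_diff Zp_divide Zp_power Zp_unit_power hZ Cu Zp_unit_in[OF Cu]; simp)
  qed
  finally show ?thesis unfolding q_def h_def .
qed

end

theorem theorem2p7:
  fixes p :: nat
  assumes "prime p" and "odd p"
  defines "S \<equiv> (\<Sum>k = 0..(p - 1) div 2.
      of_nat ((2 * k) choose k) ^ 3 / ((- 8) ^ k * of_nat (k + 1)) :: rat)"
  shows "(p mod 4 = 1 \<longrightarrow> (\<forall>x y :: int. int p = x ^ 2 + 4 * y ^ 2 \<longrightarrow>
            qcong S (- 24 * of_int y ^ 2 + 2 * of_nat p) (int p ^ 2)))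
       \<and> (p mod 4 = 3 \<longrightarrow> qcong S (R1 p / 2 + of_nat p) (int p ^ 2))"
proof -
  interpret odd_prime p using assms(1,2) by unfold_locales
  have "pcong 2 S (- 24 * of_int y ^ 2 + 2 * of_nat p)" if p4: "p mod 4 = 1" and xy: "int p = x ^ 2 + 4 * y ^ 2" for x y :: int
  proof -
    define m where "m = p div 4"
    have p: "p = 4 * m + 1" using p4 unfolding m_def by presburger
    define U where "U = of_nat (2 * m choose m) ^ 2 * (1 - of_nat p * alt_harm m)"
    have pxy: "(of_nat p :: rat) = of_int x ^ 2 + 4 * of_int y ^ 2"
      using arg_cong[OF xy, of "of_int :: int \<Rightarrow> rat"] by simp
    have "pcong 2 S (3 / 2 * of_nat (2 * m choose m) ^ 2 * (1 - of_nat p * alt_harm m) - of_nat p)"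
      unfolding S_def by (rule cubic_sum_mod4_1[OF p])
    \<comment> \<open>Completing U to U + 2p makes 4x^2 appear. Then 6x^2 - 4p becomes 2p - 24y^2 by
      x^2 = p - 4y^2.\<close>
    also have "\<dots> = 3 / 2 * (U + 2 * of_nat p) - 4 * of_nat p"
      by (simp add: U_def)
    also have "pcong 2 \<dots> (3 / 2 * (4 * of_int x ^ 2) - 4 * of_nat p)"
      using pcong_sym[OF two_squares_pcong[OF p xy]] unfolding U_def
      by (intro pcong_diff pcong_mult_left pcong_refl Zp_divide) simp_all
    also have "\<dots> = - 24 * of_int y ^ 2 + 2 * of_nat p" by (simp add: pxy)
    finally show ?thesis .
  qed
  moreover have "pcong 2 S (R1 p / 2 + of_nat p)" if p4: "p mod 4 = 3"
  proof -
    define r where "r = p div 4"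
    have p: "p = 4 * r + 3" using p4 unfolding r_def by presburger
    have "half_p = 2 * r + 1" "p div 4 = r" using p by simp_all
    then show ?thesis using cubic_sum_mod4_3[OF p] unfolding S_def R1_def by (simp only:)
  qed
  ultimately show ?thesis unfolding qcong_iff_pcong by blast
qed

end
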